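(* Let $f_1,\ldots,f_N:\mathbb{R}^n\to\mathbb{R}$, $D_1,\ldots,D_N:\mathbb{R}^n\rightrightarrows\mathbb{R}^n$ and $g:\mathbb{R}^n\to\overline{\mathbb{R}}$ satisfy the standing assumption stated in the context, with $\Phi:=f_1+\cdots+f_N+g$ and $D_\Phi:=D_1+\cdots+D_N+\partial g$. Let $\epsilon>0$ and $x_0\in\operatorname{dom}\Phi$. Assume that there exists a unique $D_\Phi$-trajectory initialized at $x_0$ and that it converges. Then there exists $T_0\geqslant0$ such that for all $T\geqslant T_0$ there exists $\bar\alpha>0$ such that any sequence $(x_k)_{k\in\mathbb{N}}$ generated by proximal random reshuffling (PRR) initialized at $x_0$ with step sizes satisfying $$\alpha_k\in(0,\bar\alpha]\ \ \text{for all } k\in\mathbb{N}\quad\text{and}\quad\sum_{k=0}^\infty\alpha_k=T$$ converges to an $(\epsilon,0)$-near approximate $D_\Phi$-stationary point.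
   Context: Notation: $\mathbb{R}^n$ carries an inner product $\langle\cdot,\cdot\rangle$ with induced norm $\|\cdot\|$; $\overline{\mathbb{R}}=\mathbb{R}\cup\{\pm\infty\}$; $\mathbb{N}=\{0,1,2,\ldots\}$; $\operatorname{dom}\Phi=\{x:\Phi(x)<\infty\}$; $B(x,r)$ is the closed ball of radius $r$ centered at $x$; $d(x,S)=\inf\{\|x-y\|:y\in S\}$ (equal to $+\infty$ if $S=\emptyset$); $D(S)=\bigcup_{x\in S}D(x)$. A set-valued map $D$ is locally bounded if every point has a neighborhood $U$ with $D(U)$ bounded. Conservative field: for a locally Lipschitz $f:\mathbb{R}^n\to\mathbb{R}$, a set-valued map $D:\mathbb{R}^n\rightrightarrows\mathbb{R}^n$ with closed graph and nonempty compact values is a conservative field for $f$ if for every absolutely continuous curve $\gamma:[0,1]\to\mathbb{R}^n$, for almost every $t\in[0,1]$, $\frac{d}{dt}f(\gamma(t))=\langle v,\gamma'(t)\rangle$ for all $v\in D(\gamma(t))$. Standing assumption: (1) $f_1,\ldots,f_N$ ($N\geqslant 1$) are locally Lipschitz; (2) each $D_i$ is a locally bounded conservative field with nonempty convex values for $f_i$; (3) $g$ is proper and convex, its domain is closed, and $g$ is locally Lipschitz on its domain; (4) $\Phi:=f+g$ is bounded below, where $f:=f_1+\cdots+f_N$, and $D_\Phi:=\sum_{i=1}^N D_i+\partial g$, where $\partial g$ is the convex subdifferential. Trajectories: for an interval $I\subset[0,\infty)$, $x:I\to\mathbb{R}^n$ is a solution to $x'\in-D(x)$ if it is absolutely continuous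 (on compact subintervals of $I$) and $x'(t)\in-D(x(t))$ for almost every $t\in I$. A $D$-trajectory is a maximal solution, i.e. a solution on $[0,T)$, $T\in(0,\infty]$, that cannot be extended to a solution on a larger interval; it is initialized at $x_0$ if $x(0)=x_0$. PRR algorithm: given step sizes $\alpha_0,\alpha_1,\ldots>0$ and $x_0\in\operatorname{dom}\Phi$, for $k=0,1,2,\ldots$: set $x_{k,0}=x_k$; choose an arbitrary permutation $\sigma^k$ of $\{1,\ldots,N\}$; for $i=1,\ldots,N$ choose $x_{k,i}\in x_{k,i-1}-\alpha_k D_{\sigma^k_i}(x_{k,i-1})$; set $x_{k+1}=\operatorname{prox}_{\alpha_k g}(x_{k,N})$, where $\operatorname{prox}_{h}(x)=\operatorname{argmin}_{y\in\mathbb{R}^n}\{h(y)+\|y-x\|^2/2\}$. Near approximate stationarity: for $\epsilon,\delta\geqslant 0$, a point $x$ is $(\epsilon,\delta)$-near approximate $D$-stationary if $d(0,D(B(x,\epsilon)))\leqslant\delta$. *)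

theory Defs
  imports "HOL-Analysis.Analysis" "HOL-Library.Set_Algebras" "HOL-Combinatorics.Permutations"
begin

text \<open>Sets are added in the sense of Minkowski (\<^theory>\<open>HOL-Library.Set_Algebras\<close>). A set-valued map
  is a function \<open>'a \<Rightarrow> 'a set\<close>; curves and functions defined on a subset are total functions whose
  values outside that subset are irrelevant.\<close>

section \<open>Extended-real-valued functions\<close>

definition edom :: "('a \<Rightarrow> ereal) \<Rightarrow> 'a set" where
  "edom h = {x. h x < \<infinity>}"

definition proper_fun :: "('a \<Rightarrow> ereal) \<Rightarrow> bool" where
  "proper_fun h \<longleftrightarrow> (\<forall>x. h x \<noteq> -\<infinity>) \<and> edom h \<noteq> {}"

text \<open>Only used for proper functions, so that \<open>\<infinity> - \<infinity>\<close> does not arise; \<open>0 * \<infinity> = 0\<close> in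
  \<^typ>\<open>ereal\<close>.\<close>

definition econvex :: "('a::real_vector \<Rightarrow> ereal) \<Rightarrow> bool" where
  "econvex h \<longleftrightarrow> (\<forall>x y. \<forall>u\<ge>0. \<forall>v\<ge>0. u + v = 1 \<longrightarrow>
     h (u *\<^sub>R x + v *\<^sub>R y) \<le> ereal u * h x + ereal v * h y)"

text \<open>Empty at points outside the domain of a proper function.\<close>

definition subdifferential :: "('a::real_inner \<Rightarrow> ereal) \<Rightarrow> 'a \<Rightarrow> 'a set" where
  "subdifferential h x = {v. \<forall>y. h x + ereal (v \<bullet> (y - x)) \<le> h y}"

text \<open>The set of all minimizers; it is a singleton for proper, convex, lower semicontinuous
  \<open>h\<close>.\<close>

definition prox :: "('a::real_normed_vector \<Rightarrow> ereal) \<Rightarrow> 'a \<Rightarrow> 'a set" where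
  "prox h x = {y. is_arg_min (\<lambda>z. h z + ereal ((norm (z - x))\<^sup>2 / 2)) (\<lambda>_. True) y}"

definition locally_lipschitz_on ::
    "'a::metric_space set \<Rightarrow> ('a \<Rightarrow> 'b::metric_space) \<Rightarrow> bool" where
  "locally_lipschitz_on S f \<longleftrightarrow> (\<forall>x\<in>S. \<exists>r>0. \<exists>L. L-lipschitz_on (ball x r \<inter> S) f)"

section \<open>Conservative fields\<close>

definition locally_bounded :: "('a::metric_space \<Rightarrow> 'b::metric_space set) \<Rightarrow> bool" where
  "locally_bounded D \<longleftrightarrow> (\<forall>x. \<exists>U. open U \<and> x \<in> U \<and> bounded (\<Union>y\<in>U. D y))"

text \<open>The elements of \<open>P\<close> are the endpoint pairs of finitely many non-overlapping intervals
  contained in \<open>S\<close>.\<close>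

definition abs_continuous_on :: "real set \<Rightarrow> (real \<Rightarrow> 'a::metric_space) \<Rightarrow> bool" where
  "abs_continuous_on S x \<longleftrightarrow> (\<forall>e>0. \<exists>d>0. \<forall>P.
     finite P \<and> (\<forall>(s, t)\<in>P. s \<le> t \<and> {s..t} \<subseteq> S) \<and>
     disjoint_family_on (\<lambda>(s, t). {s<..<t}) P \<and> (\<Sum>(s, t)\<in>P. t - s) < d \<longrightarrow>
     (\<Sum>(s, t)\<in>P. dist (x s) (x t)) < e)"

text \<open>The equation for the derivative of \<open>f \<circ> \<gamma>\<close> includes the existence of the derivatives of
  \<open>\<gamma>\<close> and of \<open>f \<circ> \<gamma>\<close>; as both curves are absolutely continuous, these exist almost
  everywhere.\<close>

definition conservative_field ::
    "('a::euclidean_space \<Rightarrow> 'a set) \<Rightarrow> ('a \<Rightarrow> real) \<Rightarrow> bool" where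
  "conservative_field D f \<longleftrightarrow>
     closed {(x, v). v \<in> D x} \<and> (\<forall>x. D x \<noteq> {} \<and> compact (D x)) \<and>
     (\<forall>\<gamma>. abs_continuous_on {0..1} \<gamma> \<longrightarrow>
       (AE t in lebesgue. t \<in> {0..1} \<longrightarrow>
         (\<exists>w. (\<gamma> has_vector_derivative w) (at t within {0..1}) \<and>
           (\<forall>v\<in>D (\<gamma> t).
             ((\<lambda>s. f (\<gamma> s)) has_real_derivative v \<bullet> w) (at t within {0..1})))))"

section \<open>Trajectories\<close>

definition solution ::
    "('a::euclidean_space \<Rightarrow> 'a set) \<Rightarrow> real set \<Rightarrow> (real \<Rightarrow> 'a) \<Rightarrow> bool" where
  "solution D I x \<longleftrightarrow>
     is_interval I \<and> I \<subseteq> {0..} \<and>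
     (\<forall>a b. {a..b} \<subseteq> I \<longrightarrow> abs_continuous_on {a..b} x) \<and>
     (AE t in lebesgue. t \<in> I \<longrightarrow>
       (\<exists>w. (x has_vector_derivative w) (at t within I) \<and> - w \<in> D (x t)))"

definition time_domain :: "ereal \<Rightarrow> real set" where
  "time_domain T = {t. 0 \<le> t \<and> ereal t < T}"

definition trajectory ::
    "('a::euclidean_space \<Rightarrow> 'a set) \<Rightarrow> ereal \<Rightarrow> (real \<Rightarrow> 'a) \<Rightarrow> bool" where
  "trajectory D T x \<longleftrightarrow>
     0 < T \<and> solution D (time_domain T) x \<and>
     \<not> (\<exists>J y. time_domain T \<subset> J \<and> solution D J y \<and> (\<forall>t\<in>time_domain T. y t = x t))"

text \<open>Uniqueness concerns the lifetime and the values on \<open>[0, T)\<close>; convergence is as \<open>t\<close>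
  increases to \<open>T\<close>, which may be infinite.\<close>

definition unique_convergent_trajectory ::
    "('a::euclidean_space \<Rightarrow> 'a set) \<Rightarrow> 'a \<Rightarrow> bool" where
  "unique_convergent_trajectory D x0 \<longleftrightarrow>
     (\<exists>T x. trajectory D T x \<and> x 0 = x0 \<and>
       (\<forall>T' y. trajectory D T' y \<and> y 0 = x0 \<longrightarrow> T' = T \<and> (\<forall>t\<in>time_domain T. y t = x t)) \<and>
       (\<exists>l. ((\<lambda>t. x (real_of_ereal t)) \<longlongrightarrow> l) (at_left T)))"

section \<open>Proximal random reshuffling and approximate stationarity\<close>

definition prr_sequence ::
    "nat \<Rightarrow> (nat \<Rightarrow> 'a::euclidean_space \<Rightarrow> 'a set) \<Rightarrow> ('a \<Rightarrow> ereal) \<Rightarrow> (nat \<Rightarrow> real) \<Rightarrow> 'a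
      \<Rightarrow> (nat \<Rightarrow> 'a) \<Rightarrow> bool" where
  "prr_sequence N D g \<alpha> x0 x \<longleftrightarrow> x 0 = x0 \<and>
     (\<forall>k. \<exists>\<sigma> z. \<sigma> permutes {1..N} \<and> z 0 = x k \<and>
       (\<forall>i\<in>{1..N}. \<exists>d\<in>D (\<sigma> i) (z (i - 1)). z i = z (i - 1) - \<alpha> k *\<^sub>R d) \<and>
       x (Suc k) \<in> prox (\<lambda>y. ereal (\<alpha> k) * g y) (z N))"

text \<open>Unlike \<^const>\<open>infdist\<close>, the distance to the empty set is \<open>\<infinity>\<close>.\<close>

definition edist_set :: "'a::metric_space \<Rightarrow> 'a set \<Rightarrow> ereal" where
  "edist_set x S = (INF y\<in>S. ereal (dist x y))"

definition near_approx_stationary ::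
    "real \<Rightarrow> real \<Rightarrow> ('a::euclidean_space \<Rightarrow> 'a set) \<Rightarrow> 'a \<Rightarrow> bool" where
  "near_approx_stationary \<epsilon> \<delta> D x \<longleftrightarrow> edist_set 0 (\<Union>y\<in>cball x \<epsilon>. D y) \<le> ereal \<delta>"

end

theory Submission
  imports Defs "HOL-Complex_Analysis.Great_Picard"
begin

text \<open>As the step sizes tend to \<open>0\<close>, the iterates up to the first exit from a tube around the
  given trajectory have bounded speed, so by Arzela--Ascoli they subconverge to a Lipschitz curve.
  Since the graph of the right-hand side is closed and its values are convex, separating
  hyperplanes show that this curve is again a solution. It extends to a maximal solution (local
  existence comes from the same compactness argument applied to proximal steps, and Zorn's lemma
  does the rest), hence it is the given trajectory and there was no exit. The trajectory exists for
  all times, because along solutions the subgradient inequality and the local Lipschitz continuity of \<open>g\<close>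
  on its domain bound the speed, and its limit is stationary, because otherwise the velocity would
  eventually stay in a half-space away from the origin.\<close>

section \<open>Absolutely continuous curves\<close>

text \<open>The obstacle is the subdifferential. At boundary points of \<open>edom g\<close> it is
  stable under adding normal vectors, so \<open>H\<close> is in general not locally bounded and the
  standard compactness arguments for differential inclusions do not apply. What replaces the missing
  bound: displacements have to be bounded, subgradients do not. Pairing a step with itself leaves
  the inner product of subgradient and step, which calmness of \<open>g\<close> controls
  (\<open>step_bound\<close>, \<open>solution_lipschitz\<close>). The graph of \<open>H\<close> is
  then used for bounded slopes only, in the form of half-spaces
  (\<open>graphs_converge_halfspace\<close>): these pass through telescoping sums and difference
  quotients, so no weak convergence of derivatives is involved. The uniqueness hypothesis concerns
  maximal solutions, whereas a limit of iterates lives on a compact interval; this is why local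
  existence and continuation have to be established at all.\<close>

lemma AE_iff_negligible: "(AE t in lebesgue. P t) \<longleftrightarrow> negligible {t. \<not> P t}"
  unfolding eventually_ae_filter_negligible using negligible_subset by blast

lemma lipschitz_imp_abs_continuous_on:
  assumes "L-lipschitz_on S x"
  shows "abs_continuous_on S x"
  unfolding abs_continuous_on_def
proof (intro allI impI)
  fix e :: real assume "e > 0"
  have L: "L \<ge> 0" using assms by (rule lipschitz_on_nonneg)
  have "(\<Sum>(s, t)\<in>P. dist (x s) (x t)) < e"
    if P: "finite P" "\<forall>(s, t)\<in>P. s \<le> t \<and> {s..t} \<subseteq> S" "(\<Sum>(s, t)\<in>P. t - s) < e / (L + 1)" for P
  proof -
    have "(\<Sum>(s, t)\<in>P. dist (x s) (x t)) \<le> (\<Sum>(s, t)\<in>P. L * (t - s))"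
    proof (rule sum_mono, clarify)
      fix s t assume "(s, t) \<in> P"
      then have "s \<le> t" "s \<in> S" "t \<in> S" using P by fastforce+
      then show "dist (x s) (x t) \<le> L * (t - s)"
        using lipschitz_onD[OF assms, of s t] by (simp add: dist_real_def)
    qed
    also have "\<dots> = L * (\<Sum>(s, t)\<in>P. t - s)"
      by (simp add: sum_distrib_left case_prod_unfold)
    also have "\<dots> \<le> L * (e / (L + 1))" using P L by (intro mult_left_mono) auto
    also have "\<dots> < e" using L \<open>e > 0\<close> by (simp add: field_simps)
    finally show ?thesis .
  qed
  then show "\<exists>d>0. \<forall>P. finite P \<and> (\<forall>(s, t)\<in>P. s \<le> t \<and> {s..t} \<subseteq> S) \<and>
     disjoint_family_on (\<lambda>(s, t). {s<..<t}) P \<and> (\<Sum>(s, t)\<in>P. t - s) < d \<longrightarrow>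
     (\<Sum>(s, t)\<in>P. dist (x s) (x t)) < e"
    using L \<open>e > 0\<close> by (intro exI[of _ "e / (L + 1)"]) auto
qed

lemma abs_continuous_on_transfer:
  assumes ac: "abs_continuous_on S x" and "T \<subseteq> S" and eq: "\<And>t. t \<in> T \<Longrightarrow> x t = y t"
  shows "abs_continuous_on T y"
  unfolding abs_continuous_on_def
proof (intro allI impI)
  fix e :: real assume "e > 0"
  obtain d where "d > 0" and d: "\<forall>P. finite P \<and> (\<forall>(s, t)\<in>P. s \<le> t \<and> {s..t} \<subseteq> S) \<and>
     disjoint_family_on (\<lambda>(s, t). {s<..<t}) P \<and> (\<Sum>(s, t)\<in>P. t - s) < d \<longrightarrow>
     (\<Sum>(s, t)\<in>P. dist (x s) (x t)) < e"
    using ac[unfolded abs_continuous_on_def, rule_format, OF \<open>e > 0\<close>] by (elim exE conjE)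
  have "(\<Sum>(s, t)\<in>P. dist (y s) (y t)) < e"
    if P: "finite P \<and> (\<forall>(s, t)\<in>P. s \<le> t \<and> {s..t} \<subseteq> T) \<and>
     disjoint_family_on (\<lambda>(s, t). {s<..<t}) P \<and> (\<Sum>(s, t)\<in>P. t - s) < d" for P
  proof -
    have "(\<Sum>(s, t)\<in>P. dist (y s) (y t)) = (\<Sum>(s, t)\<in>P. dist (x s) (x t))"
    proof (intro sum.cong refl, clarify)
      fix s t assume "(s, t) \<in> P"
      with P have "s \<le> t" "{s..t} \<subseteq> T" by blast+
      then have "s \<in> T" "t \<in> T" by auto
      then show "dist (y s) (y t) = dist (x s) (x t)" using eq by simp
    qed
    also have "\<dots> < e"
    proof (rule d[rule_format], intro conjI)
      show "\<forall>(s, t)\<in>P. s \<le> t \<and> {s..t} \<subseteq> S" using P \<open>T \<subseteq> S\<close> by (blast intro: order_trans)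
    qed (use P in simp_all)
    finally show ?thesis .
  qed
  then show "\<exists>d>0. \<forall>P. finite P \<and> (\<forall>(s, t)\<in>P. s \<le> t \<and> {s..t} \<subseteq> T) \<and>
     disjoint_family_on (\<lambda>(s, t). {s<..<t}) P \<and> (\<Sum>(s, t)\<in>P. t - s) < d \<longrightarrow>
     (\<Sum>(s, t)\<in>P. dist (y s) (y t)) < e"
    using \<open>d > 0\<close> by blast
qed

lemma abs_continuous_on_imp_continuous_on:
  fixes x :: "real \<Rightarrow> 'a::metric_space"
  assumes "abs_continuous_on {a..b} x"
  shows "continuous_on {a..b} x"
  unfolding continuous_on_iff
proof (intro ballI allI impI)
  fix t e :: real assume t: "t \<in> {a..b}" and "e > 0"
  obtain d where "d > 0" and d: "\<forall>P. finite P \<and> (\<forall>(s, t)\<in>P. s \<le> t \<and> {s..t} \<subseteq> {a..b}) \<and>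
     disjoint_family_on (\<lambda>(s, t). {s<..<t}) P \<and> (\<Sum>(s, t)\<in>P. t - s) < d \<longrightarrow>
     (\<Sum>(s, t)\<in>P. dist (x s) (x t)) < e"
    using assms[unfolded abs_continuous_on_def, rule_format, OF \<open>e > 0\<close>] by (elim exE conjE)
  have "dist (x s) (x t) < e" if s: "s \<in> {a..b}" "dist s t < d" for s
  proof (cases "s \<le> t")
    case True
    then show ?thesis using d[rule_format, of "{(s, t)}"] s t
      by (auto simp: disjoint_family_on_def dist_real_def)
  next
    case False
    then show ?thesis using d[rule_format, of "{(t, s)}"] s t
      by (auto simp: disjoint_family_on_def dist_real_def dist_commute)
  qed
  then show "\<exists>d>0. \<forall>x'\<in>{a..b}. dist x' t < d \<longrightarrow> dist (x x') (x t) < e"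
    using \<open>d > 0\<close> by blast
qed

section \<open>A mean value inequality for absolutely continuous functions\<close>

lemma derivative_straddle:
  fixes \<phi> :: "real \<Rightarrow> real"
  assumes "(\<phi> has_real_derivative d) (at t)" "d \<le> c" "e > 0"
  shows "\<exists>r>0. \<forall>u\<in>ball t r. \<forall>v\<in>ball t r. u \<le> t \<and> t \<le> v \<longrightarrow> \<phi> v - \<phi> u \<le> (c + e) * (v - u)"
proof -
  have "(\<phi> has_derivative (\<lambda>h. d * h)) (at t)"
    using assms(1) by (simp add: has_field_derivative_def)
  then obtain r where "r > 0" and r: "\<And>s. norm (s - t) < r \<Longrightarrow> norm (\<phi> s - \<phi> t - d * (s - t)) \<le> e * norm (s - t)"
    using \<open>e > 0\<close> unfolding has_derivative_at_alt by blast
  show ?thesis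
  proof (intro exI[of _ r] conjI ballI impI; (elim conjE)?)
    fix u v assume uv: "u \<in> ball t r" "v \<in> ball t r" "u \<le> t" "t \<le> v"
    have "\<phi> v - \<phi> t - d * (v - t) \<le> e * (v - t)" 
      using r[of v] uv by (auto simp: dist_real_def)
    moreover have "- (\<phi> u - \<phi> t - d * (u - t)) \<le> e * (t - u)" 
      using r[of u] uv by (auto simp: dist_real_def)
    \<comment> \<open>As \<open>u\<close> and \<open>v\<close> lie on opposite sides of
      \<open>t\<close>, the two errors add up to exactly \<open>e * (v - u)\<close>; on one side of
      \<open>t\<close> they need not be small relative to \<open>v - u\<close>.\<close>
    ultimately have "\<phi> v - \<phi> u \<le> (d + e) * (v - u)" by (simp add: algebra_simps)
    also have "\<dots> \<le> (c + e) * (v - u)" using uv assms by (intro mult_right_mono) auto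
    finally show "\<phi> v - \<phi> u \<le> (c + e) * (v - u)" .
  qed fact
qed

text \<open>A fine tagged division takes the place of integration: intervals tagged at good points
  obey the straddle estimate, and intervals tagged in the null set \<open>E\<close> lie in an open
  set of small measure, so absolute continuity makes their total increment small.\<close>

lemma increment_le_if_AE_derivative_le:
  fixes \<phi> :: "real \<Rightarrow> real"
  assumes ac: "abs_continuous_on {a..b} \<phi>" and "a \<le> b"
    and ae: "AE t in lebesgue. t \<in> {a<..<b} \<longrightarrow> (\<exists>d\<le>c. (\<phi> has_real_derivative d) (at t))"
  shows "\<phi> b - \<phi> a \<le> c * (b - a)"
proof (rule field_le_epsilon)
  fix \<epsilon> :: real assume "\<epsilon> > 0"
  \<comment> \<open>The errors at the end are \<open>e * (b - a)\<close> from the straddle estimate,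
    \<open>e\<close> from the increments over \<open>p2\<close> and \<open>e\<close> from the length
    missing in \<open>p1\<close>.\<close>
  define e where "e = \<epsilon> / (b - a + 2)"
  have "e > 0" using \<open>\<epsilon> > 0\<close> \<open>a \<le> b\<close> by (simp add: e_def)
  define E where "E = {t\<in>{a..b}. \<not> (\<exists>d\<le>c. (\<phi> has_real_derivative d) (at t))}"
  have "negligible {t. \<not> (t \<in> {a<..<b} \<longrightarrow> (\<exists>d\<le>c. (\<phi> has_real_derivative d) (at t)))}"
    using ae by (simp add: AE_iff_negligible)
  then have "negligible ({t. \<not> (t \<in> {a<..<b} \<longrightarrow> (\<exists>d\<le>c. (\<phi> has_real_derivative d) (at t)))} \<union> {a, b})"
    by (simp add: negligible_Un)
  then have E: "negligible E"
    by (rule negligible_subset) (auto simp: E_def)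
  obtain d0 where "d0 > 0" and d0: "\<forall>P. finite P \<and> (\<forall>(s, t)\<in>P. s \<le> t \<and> {s..t} \<subseteq> {a..b}) \<and>
     disjoint_family_on (\<lambda>(s, t). {s<..<t}) P \<and> (\<Sum>(s, t)\<in>P. t - s) < d0 \<longrightarrow>
     (\<Sum>(s, t)\<in>P. dist (\<phi> s) (\<phi> t)) < e"
    using ac[unfolded abs_continuous_on_def, rule_format, OF \<open>e > 0\<close>] by (elim exE conjE)
  \<comment> \<open>The second entry makes the length missing in \<open>p1\<close> cost at most
    \<open>e\<close>; the absolute value is there because \<open>c + e\<close> may have either
    sign.\<close>
  define d where "d = min d0 (e / (\<bar>c + e\<bar> + 1))"
  have "d > 0" using \<open>d0 > 0\<close> \<open>e > 0\<close> by (simp add: d_def)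
  have E0: "E \<in> null_sets lebesgue" using E by (simp add: negligible_iff_null_sets)
  then obtain U where U: "open U" "E \<subseteq> U" "U - E \<in> lmeasurable" "emeasure lebesgue (U - E) < d"
    using sets_lebesgue_outer_open[OF _ \<open>d > 0\<close>, of E] by blast
  have "U \<in> lmeasurable" "measure lebesgue U < d"
  proof -
    have "U = (U - E) \<union> E" using U by auto
    then show "U \<in> lmeasurable" using U(3) E by (metis fmeasurable.Un negligible_imp_measurable)
    have "measure lebesgue U = measure lebesgue (U - E)"
      using E0 \<open>U \<in> lmeasurable\<close> by (simp add: measure_Diff_null_set fmeasurableD)
    also have "\<dots> < d" using U(3,4) \<open>d > 0\<close>
      by (metis emeasure_eq_measure2 ennreal_less_iff measure_nonneg)
    finally show "measure lebesgue U < d" .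
  qed
  have "\<exists>r>0. (t \<in> E \<longrightarrow> ball t r \<subseteq> U) \<and> (t \<in> {a..b} - E \<longrightarrow>
      (\<forall>u\<in>ball t r. \<forall>v\<in>ball t r. u \<le> t \<and> t \<le> v \<longrightarrow> \<phi> v - \<phi> u \<le> (c + e) * (v - u)))" for t
  proof (cases "t \<in> {a..b} - E")
    case True
    then obtain d where "d \<le> c" "(\<phi> has_real_derivative d) (at t)" by (auto simp: E_def)
    from derivative_straddle[OF this(2,1) \<open>e > 0\<close>]
    show ?thesis using True by blast
  next
    case False
    moreover have "\<exists>r>0. ball t r \<subseteq> U" if "t \<in> E"
      using \<open>open U\<close> \<open>E \<subseteq> U\<close> that by (meson open_contains_ball subsetD)
    ultimately show ?thesis by (cases "t \<in> E") (auto intro: exI[of _ 1])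
  qed
  then obtain r where r: "\<And>t. r t > 0" "\<And>t. t \<in> E \<Longrightarrow> ball t (r t) \<subseteq> U"
    "\<And>t u v. t \<in> {a..b} - E \<Longrightarrow> u \<in> ball t (r t) \<Longrightarrow> v \<in> ball t (r t) \<Longrightarrow> u \<le> t \<Longrightarrow> t \<le> v
       \<Longrightarrow> \<phi> v - \<phi> u \<le> (c + e) * (v - u)"
    by metis
  have "gauge (\<lambda>t. ball t (r t))" using r(1) by (simp add: gauge_def)
  then obtain p where p: "p tagged_division_of {a..b}" "(\<lambda>t. ball t (r t)) fine p"
    using fine_division_exists_real by blast
  have fin: "finite p" using p(1) by (rule tagged_division_of_finite)
  have K: "t \<in> {Inf K..Sup K} \<and> K = {Inf K..Sup K} \<and> Inf K \<le> Sup K \<and> K \<subseteq> {a..b} \<and> K \<subseteq> ball t (r t)" 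
    if tK: "(t, K) \<in> p" for t K
  proof -
    obtain u v where "K = cbox u v" using tagged_division_ofD(4)[OF p(1) tK] by blast
    moreover have "t \<in> K" "K \<subseteq> {a..b}" using tagged_division_ofD(2,3)[OF p(1) tK] by auto
    moreover have "K \<subseteq> ball t (r t)" using p(2) tK by (auto simp: fine_def)
    ultimately show ?thesis by auto
  qed
  define p1 p2 where "p1 = {(t, K) \<in> p. t \<notin> E}" and "p2 = {(t, K) \<in> p. t \<in> E}"
  define P where "P = (\<lambda>(t, K). (Inf K, Sup K)) ` p2"
  \<comment> \<open>\<open>P\<close> is a set of endpoint pairs, so sums over \<open>p2\<close>
    transfer to it only if no interval is tagged twice. Two tags of one interval force it to be
    degenerate, and then both are its only point.\<close>
  have same: "t = t'" if tt: "(t, K) \<in> p" "(t', K) \<in> p" for t t' K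
  proof (rule ccontr)
    assume "t \<noteq> t'"
    then have "interior K = {}" using tagged_division_ofD(5)[OF p(1) tt] by auto
    then have "interior {Inf K..Sup K} = {}" using K[OF tt(1)] by simp
    then have "{Inf K<..<Sup K} = {}" unfolding interior_atLeastAtMost_real .
    then have "Inf K = Sup K" using K[OF tt(1)] unfolding greaterThanLessThan_empty_iff by linarith
    then have "t = Inf K" "t' = Inf K"
      using K[OF tt(1)] K[OF tt(2)] by (metis atLeastAtMost_iff order_antisym)+
    with \<open>t \<noteq> t'\<close> show False by simp
  qed
  have inj: "inj_on (\<lambda>(t, K). (Inf K, Sup K)) p2"
  proof (rule inj_onI, clarify)
    fix t K t' K' assume *: "(t, K) \<in> p2" "(t', K') \<in> p2" "Inf K = Inf K'" "Sup K = Sup K'"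
    then have pp: "(t, K) \<in> p" "(t', K') \<in> p" by (auto simp: p2_def)
    then have "K = K'" using K[OF pp(1)] K[OF pp(2)] * by metis
    with same pp show "t = t' \<and> K = K'" by blast
  qed
  have P: "finite P" "\<forall>(s, t)\<in>P. s \<le> t \<and> {s..t} \<subseteq> {a..b}"
    using fin K by (fastforce simp: P_def p2_def intro: finite_subset[of _ p])+
  have disj: "disjoint_family_on (\<lambda>(s, t). {s<..<t}) P"
    unfolding disjoint_family_on_def
  proof (intro ballI impI)
    fix m n assume mn: "m \<in> P" "n \<in> P" "m \<noteq> n"
    then obtain t K t' K' where *: "(t, K) \<in> p" "(t', K') \<in> p" "m = (Inf K, Sup K)" "n = (Inf K', Sup K')"
      by (auto simp: P_def p2_def)
    then have "interior K \<inter> interior K' = {}" using tagged_division_ofD(5)[OF p(1) *(1,2)] mn by auto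
    moreover have "interior K = {Inf K<..<Sup K}" "interior K' = {Inf K'<..<Sup K'}"
      using K[OF *(1)] K[OF *(2)] by (metis interior_atLeastAtMost_real)+
    ultimately show "(case m of (s, t) \<Rightarrow> {s<..<t}) \<inter> (case n of (s, t) \<Rightarrow> {s<..<t}) = {}"
      using * by simp
  qed
  have "(\<Sum>(s, t)\<in>P. t - s) = (\<Sum>i\<in>P. measure lebesgue (case i of (s, t) \<Rightarrow> {s<..<t}))"
    using P by (intro sum.cong) auto
  also have "\<dots> = measure lebesgue (\<Union>i\<in>P. case i of (s, t) \<Rightarrow> {s<..<t})"
    using P disj by (intro measure_finite_Union[symmetric]) (auto simp: emeasure_lborel_Ioo split: prod.splits)
  also have "\<dots> \<le> measure lebesgue U"
  proof (rule measure_mono_fmeasurable)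
    show "(\<Union>i\<in>P. case i of (s, t) \<Rightarrow> {s<..<t}) \<subseteq> U"
    proof -
      have "{Inf K<..<Sup K} \<subseteq> U" if "(t, K) \<in> p2" for t K
      proof -
        have "K \<subseteq> U" using K[of t K] r(2)[of t] that by (auto simp: p2_def)
        moreover have "{Inf K<..<Sup K} \<subseteq> {Inf K..Sup K}" by auto
        ultimately show ?thesis using K[of t K] that by (auto simp: p2_def)
      qed
      then show ?thesis by (auto simp: P_def)
    qed
    show "(\<Union>i\<in>P. case i of (s, t) \<Rightarrow> {s<..<t}) \<in> sets lebesgue"
      using P by (intro sets.finite_UN) (auto split: prod.splits)
  qed (rule \<open>U \<in> lmeasurable\<close>)
  also have "\<dots> < d" by (rule \<open>measure lebesgue U < d\<close>)
  finally have len: "(\<Sum>(s, t)\<in>P. t - s) < d" .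
  have lenp2: "(\<Sum>(t, K)\<in>p2. Sup K - Inf K) = (\<Sum>(s, t)\<in>P. t - s)"
    unfolding P_def using inj by (subst sum.reindex) (auto simp: case_prod_unfold)
  have "(\<Sum>(t, K)\<in>p2. \<phi> (Sup K) - \<phi> (Inf K)) = (\<Sum>(s, t)\<in>P. \<phi> t - \<phi> s)"
    unfolding P_def using inj by (subst sum.reindex) (auto simp: case_prod_unfold)
  also have "\<dots> \<le> (\<Sum>(s, t)\<in>P. dist (\<phi> s) (\<phi> t))"
    by (intro sum_mono) (auto simp: dist_real_def)
  also have "\<dots> < e" using P disj len by (intro d0[rule_format]) (simp add: d_def)
  finally have p2: "(\<Sum>(t, K)\<in>p2. \<phi> (Sup K) - \<phi> (Inf K)) < e" .
  have p1: "(\<Sum>(t, K)\<in>p1. \<phi> (Sup K) - \<phi> (Inf K)) \<le> (\<Sum>(t, K)\<in>p1. (c + e) * (Sup K - Inf K))"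
  proof (rule sum_mono, clarify)
    fix t K assume "(t, K) \<in> p1"
    then have tK: "(t, K) \<in> p" "t \<notin> E" by (auto simp: p1_def)
    have "Inf K \<in> K" "Sup K \<in> K" using K[OF tK(1)] by (metis atLeastAtMost_iff order_refl)+
    then show "\<phi> (Sup K) - \<phi> (Inf K) \<le> (c + e) * (Sup K - Inf K)"
      using K[OF tK(1)] tK by (intro r(3)[of t]) auto
  qed
  have split: "p = p1 \<union> p2" "p1 \<inter> p2 = {}" "finite p1" "finite p2"
    using fin by (auto simp: p1_def p2_def intro: finite_subset[of _ p])
  have tot: "(\<Sum>(t, K)\<in>p. h (Sup K) - h (Inf K)) = h b - h a" for h :: "real \<Rightarrow> real"
    using additive_tagged_division_1[OF \<open>a \<le> b\<close> p(1), of h] by simp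
  have "\<phi> b - \<phi> a = (\<Sum>(t, K)\<in>p1. \<phi> (Sup K) - \<phi> (Inf K)) + (\<Sum>(t, K)\<in>p2. \<phi> (Sup K) - \<phi> (Inf K))"
    using tot[of \<phi>] split by (simp add: sum.union_disjoint)
  also have "\<dots> \<le> (\<Sum>(t, K)\<in>p1. (c + e) * (Sup K - Inf K)) + e"
    using p1 p2 by simp
  also have "(\<Sum>(t, K)\<in>p1. (c + e) * (Sup K - Inf K)) = (c + e) * (\<Sum>(t, K)\<in>p1. Sup K - Inf K)"
    by (simp add: sum_distrib_left case_prod_unfold)
  also have "(\<Sum>(t, K)\<in>p1. Sup K - Inf K) = (b - a) - (\<Sum>(t, K)\<in>p2. Sup K - Inf K)"
    using tot[of "\<lambda>x. x"] split by (simp add: sum.union_disjoint)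
  also have "(c + e) * \<dots> = (c + e) * (b - a) + - (c + e) * (\<Sum>(s, t)\<in>P. t - s)"
    unfolding lenp2 by (simp add: algebra_simps)
  also have "- (c + e) * (\<Sum>(s, t)\<in>P. t - s) \<le> \<bar>c + e\<bar> * d"
  proof -
    have "(\<Sum>(s, t)\<in>P. t - s) \<ge> 0" using P by (intro sum_nonneg) auto
    then have "- (c + e) * (\<Sum>(s, t)\<in>P. t - s) \<le> \<bar>c + e\<bar> * (\<Sum>(s, t)\<in>P. t - s)"
      by (intro mult_right_mono) auto
    also have "\<dots> \<le> \<bar>c + e\<bar> * d" using len by (intro mult_left_mono) auto
    finally show ?thesis .
  qed
  also have "\<bar>c + e\<bar> * d \<le> e"
  proof -
    have "\<bar>c + e\<bar> * d \<le> \<bar>c + e\<bar> * (e / (\<bar>c + e\<bar> + 1))" by (intro mult_left_mono) (auto simp: d_def)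
    also have "\<dots> \<le> e" using \<open>e > 0\<close> by (simp add: field_simps)
    finally show ?thesis .
  qed
  finally have "\<phi> b - \<phi> a \<le> (c + e) * (b - a) + e + e" by simp
  also have "\<dots> = c * (b - a) + e * (b - a + 2)" by (simp add: algebra_simps)
  also have "e * (b - a + 2) = \<epsilon>" using \<open>a \<le> b\<close> by (simp add: e_def)
  finally show "\<phi> b - \<phi> a \<le> c * (b - a) + \<epsilon>" .
qed

text \<open>McShane extension of each coordinate; estimating the norm by the sum of the coordinates
  costs the factor \<open>DIM('a)\<close>. The constant only has to be uniform over a sequence of
  curves, for equicontinuity, and extending to all times allows chains whose final times
  differ.\<close>

lemma lipschitz_extend_finite:
  fixes u :: "real \<Rightarrow> 'a::euclidean_space"
  assumes "finite S" "S \<noteq> {}" "L-lipschitz_on S u"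
  obtains y where "\<And>s. s \<in> S \<Longrightarrow> y s = u s" "(L * DIM('a))-lipschitz_on UNIV y"
proof -
  have L: "L \<ge> 0" using assms(3) by (rule lipschitz_on_nonneg)
  define \<phi> where "\<phi> b t = Min ((\<lambda>s. u s \<bullet> b + L * \<bar>t - s\<bar>) ` S)" for b t
  define y where "y t = (\<Sum>b\<in>Basis. \<phi> b t *\<^sub>R b)" for t
  have \<phi>_le: "\<phi> b t \<le> u s \<bullet> b + L * \<bar>t - s\<bar>" if "s \<in> S" for b t s
    unfolding \<phi>_def using assms that by (intro Min_le) auto
  have \<phi>_ge: "c \<le> \<phi> b t" if "\<And>s. s \<in> S \<Longrightarrow> c \<le> u s \<bullet> b + L * \<bar>t - s\<bar>" for b t c
    unfolding \<phi>_def using assms that by (intro Min.boundedI) auto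
  have \<phi>_lip: "\<phi> b t - \<phi> b t' \<le> L * \<bar>t - t'\<bar>" for b t t'
  proof -
    have "\<phi> b t - L * \<bar>t - t'\<bar> \<le> \<phi> b t'"
    proof (rule \<phi>_ge)
      fix s assume "s \<in> S"
      have "L * \<bar>t - s\<bar> \<le> L * (\<bar>t' - s\<bar> + \<bar>t - t'\<bar>)" using L by (intro mult_left_mono) auto
      with \<phi>_le[OF \<open>s \<in> S\<close>, of b t] 
      show "\<phi> b t - L * \<bar>t - t'\<bar> \<le> u s \<bullet> b + L * \<bar>t' - s\<bar>" by (simp add: algebra_simps)
    qed
    then show ?thesis by simp
  qed
  have y_inner: "y t \<bullet> b = \<phi> b t" if "b \<in> Basis" for t b
    using that by (simp add: y_def inner_sum_left inner_Basis if_distrib cong: if_cong)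
  show ?thesis
  proof
    fix s assume s: "s \<in> S"
    have "\<phi> b s = u s \<bullet> b" if b: "b \<in> Basis" for b
    proof (rule antisym)
      show "\<phi> b s \<le> u s \<bullet> b" using \<phi>_le[OF s, of b s] by simp
      show "u s \<bullet> b \<le> \<phi> b s"
      proof (rule \<phi>_ge)
        fix s' assume s': "s' \<in> S"
        have "u s \<bullet> b - u s' \<bullet> b \<le> norm (u s - u s')"
          using Basis_le_norm[OF b, of "u s - u s'"] by (simp add: inner_diff_left)
        also have "\<dots> \<le> L * \<bar>s - s'\<bar>"
          using lipschitz_onD[OF assms(3) s s'] by (simp add: dist_norm)
        finally show "u s \<bullet> b \<le> u s' \<bullet> b + L * \<bar>s - s'\<bar>" by simp
      qed
    qed
    then show "y s = u s" using y_inner by (simp add: euclidean_eq_iff[of "y s"])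
  next
    show "(L * DIM('a))-lipschitz_on UNIV y"
    proof (rule lipschitz_onI)
      fix t t' :: real
      have "dist (y t) (y t') \<le> (\<Sum>b\<in>Basis. \<bar>(y t - y t') \<bullet> b\<bar>)"
        unfolding dist_norm by (rule norm_le_l1)
      also have "\<dots> \<le> (\<Sum>b\<in>(Basis::'a set). L * \<bar>t - t'\<bar>)"
        using \<phi>_lip[of _ t t'] \<phi>_lip[of _ t' t]
        by (intro sum_mono) (force simp: inner_diff_left y_inner abs_le_iff abs_minus_commute)
      finally show "dist (y t) (y t') \<le> L * DIM('a) * dist t t'" by (simp add: dist_real_def ac_simps)
    qed (use L in simp)
  qed
qed

text \<open>Rademacher's theorem for curves comes for free here: the definition of a conservative field
  includes the almost everywhere differentiability of absolutely continuous curves.\<close>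

lemma lipschitz_AE_differentiable:
  fixes x :: "real \<Rightarrow> 'a::euclidean_space" and D :: "'a \<Rightarrow> 'a set"
  assumes cf: "conservative_field D f" and lip: "L-lipschitz_on {a..b} x"
  shows "AE t in lebesgue. t \<in> {a..b} \<longrightarrow> (\<exists>w. (x has_vector_derivative w) (at t within {a..b}))"
proof (cases "a < b")
  case False
  then have "negligible {a..b}" by (cases "a = b") auto
  then show ?thesis
    unfolding AE_iff_negligible by (rule negligible_subset) auto
next
  case True
  define h where "h s = a + (b - a) * s" for s
  define \<gamma> where "\<gamma> s = x (h s)" for s
  have h: "h s \<in> {a..b}" if "s \<in> {0..1}" for s
  proof -
    have "(b - a) * s \<ge> 0" "(b - a) * s \<le> b - a" using that True by (auto simp: mult_left_le)
    then show ?thesis by (simp add: h_def)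
  qed
  have "(L * (b - a))-lipschitz_on {0..1} \<gamma>"
  proof (rule lipschitz_onI)
    fix s s' :: real assume "s \<in> {0..1}" "s' \<in> {0..1}"
    then have "dist (\<gamma> s) (\<gamma> s') \<le> L * dist (h s) (h s')"
      using lipschitz_onD[OF lip h h] by (simp add: \<gamma>_def)
    also have "dist (h s) (h s') = (b - a) * dist s s'"
      using True by (simp add: h_def dist_real_def abs_mult right_diff_distrib flip: right_diff_distrib)
    finally show "dist (\<gamma> s) (\<gamma> s') \<le> L * (b - a) * dist s s'" by (simp add: ac_simps)
  qed (use True lipschitz_on_nonneg[OF lip] in simp)
  then have "AE s in lebesgue. s \<in> {0..1} \<longrightarrow> (\<exists>w. (\<gamma> has_vector_derivative w) (at s within {0..1}))"
  proof -
    assume "(L * (b - a))-lipschitz_on {0..1} \<gamma>"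
    then have "abs_continuous_on {0..1} \<gamma>" by (rule lipschitz_imp_abs_continuous_on)
    with cf have "AE t in lebesgue. t \<in> {0..1} \<longrightarrow>
         (\<exists>w. (\<gamma> has_vector_derivative w) (at t within {0..1}) \<and>
           (\<forall>v\<in>D (\<gamma> t). ((\<lambda>s. f (\<gamma> s)) has_real_derivative v \<bullet> w) (at t within {0..1})))"
      unfolding conservative_field_def by blast
    then show ?thesis by (rule AE_mp) (rule AE_I2, blast)
  qed
  then have "negligible {s \<in> {0..1}. \<not> (\<exists>w. (\<gamma> has_vector_derivative w) (at s within {0..1}))}" (is "negligible ?B")
    unfolding AE_iff_negligible by (rule negligible_subset) auto
  then have "negligible (h ` ?B)"
    unfolding h_def
    by (rule negligible_differentiable_image_negligible[rotated]) (auto simp: h_def intro!: derivative_intros)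
  moreover have "{t. \<not> (t \<in> {a..b} \<longrightarrow> (\<exists>w. (x has_vector_derivative w) (at t within {a..b})))} \<subseteq> h ` ?B"
  proof
    fix t assume "t \<in> {t. \<not> (t \<in> {a..b} \<longrightarrow> (\<exists>w. (x has_vector_derivative w) (at t within {a..b})))}"
    then have t: "t \<in> {a..b}" "\<not> (\<exists>w. (x has_vector_derivative w) (at t within {a..b}))" by auto
    define k where "k t = (t - a) / (b - a)" for t
    have hk: "h (k t) = t" for t using True by (simp add: h_def k_def)
    have k: "k t \<in> {0..1}" if "t \<in> {a..b}" for t using that True by (auto simp: k_def)
    have "\<not> (\<exists>w. (\<gamma> has_vector_derivative w) (at (k t) within {0..1}))"
    proof
      assume "\<exists>w. (\<gamma> has_vector_derivative w) (at (k t) within {0..1})"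
      then obtain w where w: "(\<gamma> has_vector_derivative w) (at (k t) within {0..1})" ..
      have "(k has_vector_derivative (1 / (b - a))) (at t within {a..b})"
        unfolding k_def has_real_derivative_iff_has_vector_derivative[symmetric]
        using True by (auto intro!: derivative_eq_intros)
      moreover have "(\<gamma> has_vector_derivative w) (at (k t) within k ` {a..b})"
        using w k by (intro has_vector_derivative_within_subset[OF w]) auto
      ultimately have "((\<gamma> \<circ> k) has_vector_derivative (1 / (b - a)) *\<^sub>R w) (at t within {a..b})"
        by (rule vector_diff_chain_within)
      moreover have "\<gamma> \<circ> k = x" by (auto simp: \<gamma>_def hk)
      ultimately show False using t by auto
    qed
    then show "t \<in> h ` ?B" using k[OF t(1)] hk[of t] by (auto intro!: image_eqI[of _ _ "k t"])
  qed
  ultimately show ?thesis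
    unfolding AE_iff_negligible by (rule negligible_subset)
qed

section \<open>Limits of discrete chains\<close>

text \<open>The outer limit (in the sense of Painleve and Kuratowski) of the sets \<open>A j\<close>
  is contained in the graph of \<open>H\<close>. The indices \<open>r n\<close> only have to tend to
  infinity, so that counterexamples picked with \<open>r n \<ge> n\<close> qualify as they
  are.\<close>

definition graphs_converge :: "(nat \<Rightarrow> ('a::topological_space \<times> 'b::topological_space) set) \<Rightarrow> ('a \<Rightarrow> 'b set) \<Rightarrow> bool" where
  "graphs_converge A H \<longleftrightarrow> (\<forall>r x s p v. filterlim r at_top sequentially \<and> (\<forall>n. (x n, s n) \<in> A (r n)) \<and>
     x \<longlonglongrightarrow> p \<and> s \<longlonglongrightarrow> v \<longrightarrow> v \<in> H p)"

lemma graphs_convergeI: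
  assumes "\<And>r x s p v. filterlim r at_top sequentially \<Longrightarrow> (\<And>n. (x n, s n) \<in> A (r n)) \<Longrightarrow>
    x \<longlonglongrightarrow> p \<Longrightarrow> s \<longlonglongrightarrow> v \<Longrightarrow> v \<in> H p"
  shows "graphs_converge A H"
  unfolding graphs_converge_def using assms by blast

lemma graphs_convergeD:
  assumes "graphs_converge A H" "filterlim r at_top sequentially" "\<And>n. (x n, s n) \<in> A (r n)"
    "x \<longlonglongrightarrow> p" "s \<longlonglongrightarrow> v"
  shows "v \<in> H p"
  using assms(1)[unfolded graphs_converge_def, rule_format, of r x s p v] assms(2-) by blast

text \<open>A sequence of counterexamples has bounded slopes, hence a limit slope \<open>v\<close>
  in \<open>H p\<close> with \<open>a \<bullet> v \<le> b\<close>. Without the bound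
  \<open>V\<close> the slopes could escape to infinity. If \<open>H p\<close> is empty, every choice
  of \<open>a\<close> and \<open>b\<close> qualifies, so no slopes bounded by \<open>V\<close> exist
  near \<open>p\<close> for large \<open>j\<close>; this is how limit curves are forced into the
  domain.\<close>

lemma graphs_converge_halfspace:
  fixes H :: "'a::metric_space \<Rightarrow> 'b::euclidean_space set"
  assumes gc: "graphs_converge A H" and half: "\<And>v. v \<in> H p \<Longrightarrow> b < a \<bullet> v"
  shows "\<exists>\<delta>>0. \<exists>J. \<forall>j x s. j \<ge> J \<longrightarrow> (x, s) \<in> A j \<longrightarrow> dist x p < \<delta> \<longrightarrow> norm s \<le> V \<longrightarrow> b \<le> a \<bullet> s"
proof (rule ccontr)
  assume neg: "\<not> ?thesis"
  have "\<exists>j x s. j \<ge> n \<and> (x, s) \<in> A j \<and> dist x p < 1 / Suc n \<and> norm s \<le> V \<and> a \<bullet> s < b" for n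
  proof -
    have "1 / real (Suc n) > 0" by simp
    with neg show ?thesis by (meson not_le)
  qed
  then obtain r x s where *: "\<And>n. r n \<ge> n" "\<And>n. (x n, s n) \<in> A (r n)" "\<And>n. dist (x n) p < 1 / Suc n"
    "\<And>n. norm (s n) \<le> V" "\<And>n. a \<bullet> s n < b" by metis
  have "bounded (range s)" using *(4) by (auto simp: bounded_iff)
  then obtain v q where q: "strict_mono q" "(s \<circ> q) \<longlonglongrightarrow> v"
    using bounded_imp_convergent_subsequence by blast
  have "(\<lambda>n. dist (x n) p) \<longlonglongrightarrow> 0"
  proof (rule tendsto_sandwich[of "\<lambda>_. 0" _ _ "\<lambda>n. 1 / Suc n"])
    show "(\<lambda>n. 1 / real (Suc n)) \<longlonglongrightarrow> 0"
      using LIMSEQ_inverse_real_of_nat by (simp add: inverse_eq_divide)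
    show "\<forall>\<^sub>F n in sequentially. dist (x n) p \<le> 1 / real (Suc n)"
      using *(3) by (intro always_eventually allI less_imp_le)
  qed auto
  then have "x \<longlonglongrightarrow> p" using tendsto_dist_iff by blast
  then have "(x \<circ> q) \<longlonglongrightarrow> p" using q(1) by (rule LIMSEQ_subseq_LIMSEQ)
  moreover have "filterlim (r \<circ> q) at_top sequentially"
  proof (rule filterlim_at_top_mono[OF filterlim_ident])
    show "\<forall>\<^sub>F n in sequentially. n \<le> (r \<circ> q) n"
      using *(1) seq_suble[OF q(1)] by (auto intro!: always_eventually intro: order_trans)
  qed
  ultimately have "v \<in> H p"
    using gc q(2) *(2) unfolding graphs_converge_def
    by (elim allE[of _ "r \<circ> q"] allE[of _ "x \<circ> q"] allE[of _ "s \<circ> q"]) auto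
  moreover have "a \<bullet> v \<le> b"
    using q(2)[unfolded o_def] *(5) by (intro LIMSEQ_le_const2[of "\<lambda>n. a \<bullet> (s \<circ> q) n"] tendsto_intros) (auto intro: less_imp_le simp: o_def)
  ultimately show False using half by fastforce
qed

section \<open>Discrete chains with time stamps\<close>

lemma chain_increment:
  fixes X :: "nat \<Rightarrow> 'a::real_normed_vector" and t :: "nat \<Rightarrow> real"
  assumes "\<And>k. k < n \<Longrightarrow> norm (X k - X (Suc k)) \<le> V * (t (Suc k) - t k)"
    and "k \<le> m" "m \<le> n"
  shows "norm (X k - X m) \<le> V * (t m - t k)"
  using assms(2,3)
proof (induction m rule: dec_induct)
  case (step m)
  have "norm (X k - X (Suc m)) \<le> norm (X k - X m) + norm (X m - X (Suc m))"
    using norm_triangle_ineq[of "X k - X m" "X m - X (Suc m)"] by simp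
  also have "\<dots> \<le> V * (t m - t k) + V * (t (Suc m) - t m)"
    using step assms(1)[of m] by (intro add_mono) auto
  finally show ?case by (simp add: algebra_simps)
qed simp

lemma chain_inner:
  fixes X :: "nat \<Rightarrow> 'a::real_inner" and t :: "nat \<Rightarrow> real"
  assumes "\<And>q. k \<le> q \<Longrightarrow> q < m \<Longrightarrow> b * (t (Suc q) - t q) \<le> a \<bullet> (X q - X (Suc q))"
    and "k \<le> m"
  shows "b * (t m - t k) \<le> a \<bullet> (X k - X m)"
  using assms(2,1)
proof (induction m rule: dec_induct)
  case (step m)
  have "b * (t m - t k) \<le> a \<bullet> (X k - X m)" by (rule step.IH) (use step.prems in auto)
  moreover have "b * (t (Suc m) - t m) \<le> a \<bullet> (X m - X (Suc m))" using step by auto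
  ultimately show ?case by (simp add: algebra_simps)
qed simp

text \<open>Turns a time into an index of the chain. Index \<open>0\<close> has no preceding step to
  compare with, but there \<open>t 0 = 0 \<le> s\<close>.\<close>

lemma chain_first_index:
  fixes t :: "nat \<Rightarrow> real"
  assumes "t 0 = 0" "\<And>k. k < n \<Longrightarrow> t (Suc k) - t k \<le> \<rho>" "0 \<le> s" "s \<le> t n" "0 \<le> \<rho>"
  defines "k \<equiv> LEAST k. s \<le> t k"
  shows "k \<le> n" "s \<le> t k" "t k \<le> s + \<rho>" "\<And>q. q < k \<Longrightarrow> t q < s"
proof -
  show "k \<le> n" unfolding k_def using assms by (intro Least_le)
  show *: "s \<le> t k" unfolding k_def using assms(4) by (rule LeastI)
  show least: "t q < s" if "q < k" for q
    using that not_less_Least[of q "\<lambda>k. s \<le> t k"] by (simp add: k_def)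
  show "t k \<le> s + \<rho>"
  proof (cases k)
    case 0
    then show ?thesis using assms by simp
  next
    case (Suc q)
    then have "t k - t q \<le> \<rho>" using assms(2)[of q] \<open>k \<le> n\<close> by simp
    moreover have "t q < s" using Suc by (intro least) simp
    ultimately show ?thesis by simp
  qed
qed

text \<open>Strictly increasing time stamps make the chain a function on a finite set of times,
  which is then extended. Between time stamps only the Lipschitz bound matters, so no explicit
  interpolation formula is used.\<close>

lemma chain_interpolation:
  fixes X :: "nat \<Rightarrow> 'a::euclidean_space" and t :: "nat \<Rightarrow> real"
  assumes V: "V \<ge> 0" and t: "\<And>k. k < n \<Longrightarrow> t k < t (Suc k)"
    and step: "\<And>k. k < n \<Longrightarrow> norm (X k - X (Suc k)) \<le> V * (t (Suc k) - t k)"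
  obtains y where "\<And>k. k \<le> n \<Longrightarrow> y (t k) = X k" "(V * DIM('a))-lipschitz_on UNIV y"
proof -
  have mono: "t k < t m" if "k < m" "m \<le> n" for k m
    using that
  proof (induction m)
    case (Suc m)
    have "t m < t (Suc m)" using Suc.prems by (intro t) auto
    with Suc show ?case by (cases "k = m") (auto intro: less_trans)
  qed simp
  have inj: "inj_on t {..n}"
    using mono by (intro inj_onI) (metis atMost_iff less_irrefl linorder_neqE_nat)
  define u where "u = X \<circ> inv_into {..n} t"
  have u: "u (t k) = X k" if "k \<le> n" for k
    using that inj by (simp add: u_def inv_into_f_f)
  have "V-lipschitz_on (t ` {..n}) u"
  proof (rule lipschitz_on_leI)
    fix s s' assume s: "s \<in> t ` {..n}" "s' \<in> t ` {..n}" "s \<le> s'"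
    then obtain k m where km: "k \<le> n" "m \<le> n" "s = t k" "s' = t m" by auto
    then have "k \<le> m" using s mono[of m k] by (meson leI less_le_not_le)
    then show "dist (u s) (u s') \<le> V * dist s s'"
      using chain_increment[where X = X and V = V and t = t and n = n, OF step, of k m] km s by (simp add: u dist_norm)
  qed fact
  then obtain y where "\<And>s. s \<in> t ` {..n} \<Longrightarrow> y s = u s" "(V * DIM('a))-lipschitz_on UNIV y"
    by (rule lipschitz_extend_finite[rotated 2]) auto
  with that show thesis by (metis atMost_iff imageI u)
qed

section \<open>Passage to the limit\<close>

lemma difference_quotient_tendsto:
  fixes y :: "real \<Rightarrow> 'a::real_normed_vector"
  assumes "(y has_vector_derivative w) (at t within S)"
  shows "((\<lambda>s. (y s - y t) /\<^sub>R (s - t)) \<longlongrightarrow> w) (at t within S)"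
proof (rule Lim_null[THEN iffD2], rule tendsto_norm_zero_cancel)
  have "((\<lambda>s. norm (y s - y t - (s - t) *\<^sub>R w) / norm (s - t)) \<longlongrightarrow> 0) (at t within S)"
    using assms by (simp add: has_vector_derivative_def has_derivative_iff_norm)
  then show "((\<lambda>s. norm ((y s - y t) /\<^sub>R (s - t) - w)) \<longlongrightarrow> 0) (at t within S)"
  proof (rule Lim_transform_within[OF _ zero_less_one])
    fix s :: real assume "0 < dist s t"
    then have "(y s - y t) /\<^sub>R (s - t) - w = (y s - y t - (s - t) *\<^sub>R w) /\<^sub>R (s - t)"
      by (simp add: scaleR_diff_right)
    then show "norm (y s - y t - (s - t) *\<^sub>R w) / norm (s - t) = norm ((y s - y t) /\<^sub>R (s - t) - w)"
      by (simp add: divide_inverse mult.commute)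
  qed
qed

lemma right_difference_quotient:
  fixes y :: "real \<Rightarrow> 'a::real_inner"
  assumes "(y has_vector_derivative w) (at t within {0..\<tau>})" "0 \<le> t" "t < \<tau>"
    and "h0 > 0" "\<And>h. 0 < h \<Longrightarrow> h < h0 \<Longrightarrow> b * h \<le> a \<bullet> (y t - y (t + h))"
  shows "b \<le> a \<bullet> (- w)"
proof -
  have "((\<lambda>s. (y s - y t) /\<^sub>R (s - t)) \<longlongrightarrow> w) (at t within {0..\<tau>})"
    using assms(1) by (rule difference_quotient_tendsto)
  then have "((\<lambda>s. (y s - y t) /\<^sub>R (s - t)) \<longlongrightarrow> w) (at t within {t<..<\<tau>})"
    by (rule tendsto_within_subset) (use assms in auto)
  then have "((\<lambda>s. a \<bullet> (- ((y s - y t) /\<^sub>R (s - t)))) \<longlongrightarrow> a \<bullet> (- w)) (at t within {t<..<\<tau>})"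
    by (intro tendsto_intros)
  moreover have "at t within {t<..<\<tau>} \<noteq> bot"
    using assms by (simp add: at_within_eq_bot_iff islimpt_greaterThanLessThan1)
  moreover have "\<forall>\<^sub>F s in at t within {t<..<\<tau>}. b \<le> a \<bullet> (- ((y s - y t) /\<^sub>R (s - t)))"
    unfolding eventually_at
  proof (intro exI[of _ h0] conjI ballI impI)
    fix s assume s: "s \<in> {t<..<\<tau>}" "s \<noteq> t \<and> dist s t < h0"
    then have "b * (s - t) \<le> a \<bullet> (y t - y s)" using assms(5)[of "s - t"] by (simp add: dist_real_def)
    then have "b \<le> (a \<bullet> (y t - y s)) / (s - t)" using s by (simp add: pos_le_divide_eq)
    also have "\<dots> = a \<bullet> (- ((y s - y t) /\<^sub>R (s - t)))"
      by (simp add: divide_inverse inner_diff_right algebra_simps)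
    finally show "b \<le> a \<bullet> (- ((y s - y t) /\<^sub>R (s - t)))" .
  qed fact
  ultimately show ?thesis by (intro tendsto_lowerbound)
qed

text \<open>The compactness theorem behind both local existence and tracking. The chains may have
  different lengths and irregular steps; only their final times have to converge. Convergence of the
  end points is part of the conclusion because the exit argument looks at precisely these points.
  \<open>D\<close> and \<open>f\<close> supply the almost everywhere differentiability of the limit
  curve.\<close>

lemma chain_limit:
  fixes x :: "nat \<Rightarrow> nat \<Rightarrow> 'a::euclidean_space" and t :: "nat \<Rightarrow> nat \<Rightarrow> real"
    and n :: "nat \<Rightarrow> nat" and H D :: "'a \<Rightarrow> 'a set"
  assumes cf: "conservative_field D f" and gc: "graphs_converge A H"
    and H: "\<And>p. convex (H p)" "\<And>p. closed (H p)" and V: "V \<ge> 0"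
    and init: "\<And>j. t j 0 = 0" "\<And>j. x j 0 = p"
    and t: "\<And>j k. k < n j \<Longrightarrow> t j k < t j (Suc k)" "\<And>j k. k < n j \<Longrightarrow> t j (Suc k) - t j k \<le> \<rho> j"
    and A: "\<And>j k. k < n j \<Longrightarrow> (x j k, (x j k - x j (Suc k)) /\<^sub>R (t j (Suc k) - t j k)) \<in> A j"
    and speed: "\<And>j k. k < n j \<Longrightarrow> norm (x j k - x j (Suc k)) \<le> V * (t j (Suc k) - t j k)"
    and lim: "\<rho> \<longlonglongrightarrow> 0" "(\<lambda>j. t j (n j)) \<longlonglongrightarrow> \<tau>"
  obtains r y where "strict_mono r" "solution H {0..\<tau>} y" "y 0 = p"
    "(\<lambda>j. x (r j) (n (r j))) \<longlonglongrightarrow> y \<tau>"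
proof -
  define L where "L = V * DIM('a)"
  have L: "L \<ge> 0" using V by (simp add: L_def)
  have "\<exists>y. (\<forall>k\<le>n j. y (t j k) = x j k) \<and> L-lipschitz_on UNIV y" for j
    using chain_interpolation[where X = "x j" and V = V and t = "t j" and n = "n j", OF V t(1) speed] unfolding L_def by metis
  then obtain Y where Y: "\<And>j k. k \<le> n j \<Longrightarrow> Y j (t j k) = x j k" "\<And>j. L-lipschitz_on UNIV (Y j)"
    by metis
  have Ylip: "dist (Y j s) (Y j s') \<le> L * \<bar>s - s'\<bar>" for j s s'
    using lipschitz_onD[OF Y(2), of s s' j] by (simp add: dist_real_def)
  have Y0: "Y j 0 = p" for j using Y(1)[of 0 j] init by simp
  have T0: "t j (n j) \<ge> 0" for j
  proof -
    have "t j k \<ge> 0" if "k \<le> n j" for k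
      using that
    proof (induction k)
      case (Suc k)
      then show ?case using t(1)[of k j] by simp
    qed (simp add: init)
    then show ?thesis by simp
  qed
  have "\<tau> \<ge> 0" using lim(2) T0 by (intro LIMSEQ_le_const[OF lim(2)]) auto
  have rho0: "0 \<le> \<rho> j" if "n j > 0" for j using t[of 0 j] that by linarith
  obtain g k where g: "continuous_on {0..\<tau>} g" and k: "strict_mono (k :: nat \<Rightarrow> nat)"
    and unif: "\<And>e. 0 < e \<Longrightarrow> \<exists>N. \<forall>n s. n \<ge> N \<and> s \<in> {0..\<tau>} \<longrightarrow> norm (Y (k n) s - g s) < e"
  proof (rule Arzela_Ascoli[of "{0..\<tau>}" Y "norm p + L * \<tau>"])
    fix j s assume "s \<in> {0..\<tau>}"
    then have "norm (Y j s - p) \<le> L * \<tau>"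
      using Ylip[of j s 0] L by (auto simp: Y0 dist_norm intro: order_trans mult_left_mono)
    then show "norm (Y j s) \<le> norm p + L * \<tau>" using norm_triangle_sub[of "Y j s" p] by simp
  next
    fix s e :: real assume "0 < e"
    have "norm (Y j s - Y j s') < e" if "norm (s - s') < e / (L + 1)" for j s'
    proof -
      have "norm (Y j s - Y j s') \<le> L * \<bar>s - s'\<bar>" using Ylip by (simp add: dist_norm)
      also have "\<dots> \<le> L * (e / (L + 1))" using that L by (intro mult_left_mono) auto
      also have "\<dots> < e" using L \<open>0 < e\<close> by (simp add: field_simps)
      finally show ?thesis .
    qed
    then show "\<exists>d>0. \<forall>n y. y \<in> {0..\<tau>} \<and> norm (s - y) < d \<longrightarrow> norm (Y n s - Y n y) < e"
      using L \<open>0 < e\<close> by (intro exI[of _ "e / (L + 1)"]) auto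
  qed (auto intro: that)
  have kinf: "filterlim k at_top sequentially" using k by (rule filterlim_subseq)
  have rk: "(\<lambda>j. \<rho> (k j)) \<longlonglongrightarrow> 0" using lim(1) kinf by (rule filterlim_compose)
  have Tk: "(\<lambda>j. t (k j) (n (k j))) \<longlonglongrightarrow> \<tau>" using lim(2) kinf by (rule filterlim_compose)
  have ptw: "(\<lambda>j. Y (k j) s) \<longlonglongrightarrow> g s" if "s \<in> {0..\<tau>}" for s
    unfolding LIMSEQ_iff using unif that by blast
  \<comment> \<open>Time stamps vary with \<open>j\<close>; the common Lipschitz constant turns
    pointwise convergence into convergence along moving times.\<close>
  have moving: "(\<lambda>j. Y (k j) (S j)) \<longlonglongrightarrow> g s" if "S \<longlonglongrightarrow> s" "s \<in> {0..\<tau>}" for S s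
  proof -
    have "(\<lambda>j. Y (k j) (S j) - Y (k j) s) \<longlonglongrightarrow> 0"
    proof (rule Lim_null_comparison)
      show "\<forall>\<^sub>F j in sequentially. norm (Y (k j) (S j) - Y (k j) s) \<le> L * \<bar>S j - s\<bar>"
        using Ylip by (simp add: dist_norm)
      have "(\<lambda>j. L * \<bar>S j - s\<bar>) \<longlonglongrightarrow> L * \<bar>s - s\<bar>" using that by (intro tendsto_intros)
      then show "(\<lambda>j. L * \<bar>S j - s\<bar>) \<longlonglongrightarrow> 0" by simp
    qed
    from tendsto_add[OF this ptw[OF that(2)]] show ?thesis by simp
  qed
  have glip: "L-lipschitz_on {0..\<tau>} g"
  proof (rule lipschitz_onI)
    fix s s' assume s: "s \<in> {0..\<tau>}" "s' \<in> {0..\<tau>}"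
    have "(\<lambda>j. dist (Y (k j) s) (Y (k j) s')) \<longlonglongrightarrow> dist (g s) (g s')"
      using s by (intro tendsto_intros ptw)
    then show "dist (g s) (g s') \<le> L * dist s s'"
      by (rule LIMSEQ_le_const2) (use Ylip in \<open>auto simp: dist_real_def\<close>)
  qed (rule L)
  \<comment> \<open>A hyperplane separating \<open>- w\<close> from \<open>H (g s)\<close> bounds
    the slopes of all chain steps in a short window after \<open>s\<close>. Summing them and passing
    to the limit bounds the increments of \<open>g\<close>, and dividing by \<open>h\<close> puts
    \<open>- w\<close> on the wrong side of the hyperplane.\<close>
  have velocity: "- w \<in> H (g s)"
    if w: "(g has_vector_derivative w) (at s within {0..\<tau>})" and s: "0 \<le> s" "s < \<tau>" for s w
  proof (rule ccontr)
    assume "- w \<notin> H (g s)"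
    then obtain a b where ab: "a \<bullet> (- w) < b" "\<And>v. v \<in> H (g s) \<Longrightarrow> b < a \<bullet> v"
      using separating_hyperplane_closed_point[OF H, of "- w" "g s"] by blast
    obtain \<delta> J where \<delta>: "\<delta> > 0"
      "\<forall>j x v. j \<ge> J \<longrightarrow> (x, v) \<in> A j \<longrightarrow> dist x (g s) < \<delta> \<longrightarrow> norm v \<le> V \<longrightarrow> b \<le> a \<bullet> v"
      using graphs_converge_halfspace[OF gc ab(2), where V = V] by blast
    \<comment> \<open>Within the window the limit curve moves by at most
      \<open>\<delta> / 2\<close>, which leaves \<open>\<delta> / 2\<close> for the distance between
      chain and limit curve.\<close>
    define h0 where "h0 = min (\<tau> - s) (\<delta> / (2 * (L + 1)))"
    have h0: "h0 > 0" "h0 \<le> \<tau> - s" "h0 \<le> \<delta> / (2 * (L + 1))"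
      using s \<delta>(1) L by (auto simp: h0_def)
    then have h0L: "h0 * (L + 1) \<le> \<delta> / 2"
      using L by (simp add: field_simps)
    have "b * h \<le> a \<bullet> (g s - g (s + h))" if h: "0 < h" "h < h0" for h
    proof -
      define \<kappa> where "\<kappa> u j = (LEAST i. u \<le> t (k j) i)" for u j
      have \<kappa>: "\<forall>\<^sub>F j in sequentially. \<kappa> u j \<le> n (k j) \<and> u \<le> t (k j) (\<kappa> u j) \<and>
          t (k j) (\<kappa> u j) \<le> u + \<rho> (k j) \<and> (\<forall>q<\<kappa> u j. t (k j) q < u)" if u: "0 \<le> u" "u < \<tau>" for u
      proof -
        have "\<forall>\<^sub>F j in sequentially. u < t (k j) (n (k j))" using order_tendstoD(1)[OF Tk u(2)] .
        then show ?thesis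
        proof eventually_elim
          case (elim j)
          then have "n (k j) > 0" using u init by (metis less_le_not_le neq0_conv)
          note * = chain_first_index[OF init(1) t(2) u(1) less_imp_le[OF elim] rho0[OF this]]
          show ?case unfolding \<kappa>_def using * by auto
        qed
      qed
      have t\<kappa>: "(\<lambda>j. t (k j) (\<kappa> u j)) \<longlonglongrightarrow> u" if u: "0 \<le> u" "u < \<tau>" for u
      proof (rule tendsto_sandwich)
        show "\<forall>\<^sub>F j in sequentially. u \<le> t (k j) (\<kappa> u j)" using \<kappa>[OF u] by eventually_elim auto
        show "\<forall>\<^sub>F j in sequentially. t (k j) (\<kappa> u j) \<le> u + \<rho> (k j)" using \<kappa>[OF u] by eventually_elim auto
        show "(\<lambda>j. u + \<rho> (k j)) \<longlonglongrightarrow> u" using tendsto_add[OF tendsto_const rk] by simp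
      qed simp
      have x\<kappa>: "(\<lambda>j. x (k j) (\<kappa> u j)) \<longlonglongrightarrow> g u" if u: "0 \<le> u" "u < \<tau>" for u
      proof -
        have "(\<lambda>j. Y (k j) (t (k j) (\<kappa> u j))) \<longlonglongrightarrow> g u" using u by (intro moving t\<kappa>) auto
        moreover have "\<forall>\<^sub>F j in sequentially. Y (k j) (t (k j) (\<kappa> u j)) = x (k j) (\<kappa> u j)"
          using \<kappa>[OF u] by eventually_elim (auto intro: Y)
        ultimately show ?thesis by (rule Lim_transform_eventually)
      qed
      have sh: "0 \<le> s + h" "s + h < \<tau>" using s h h0 by auto
      obtain M where M: "\<And>m u. m \<ge> M \<Longrightarrow> u \<in> {0..\<tau>} \<Longrightarrow> norm (Y (k m) u - g u) < \<delta> / 2"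
        using unif[of "\<delta> / 2"] \<delta>(1) by auto
      have "\<forall>\<^sub>F j in sequentially. j \<ge> M" by (rule eventually_ge_at_top)
      moreover have "\<forall>\<^sub>F j in sequentially. k j \<ge> J" using kinf by (simp add: filterlim_at_top)
      ultimately have "\<forall>\<^sub>F j in sequentially. b * (t (k j) (\<kappa> (s + h) j) - t (k j) (\<kappa> s j))
          \<le> a \<bullet> (x (k j) (\<kappa> s j) - x (k j) (\<kappa> (s + h) j))"
        using \<kappa>[OF s] \<kappa>[OF sh]
      proof eventually_elim
        case (elim j)
        show ?case
        proof (rule chain_inner)
          show "\<kappa> s j \<le> \<kappa> (s + h) j" using elim h by (meson less_add_same_cancel1 less_le_trans linorder_not_le order_less_asym)
          fix q assume q: "\<kappa> s j \<le> q" "q < \<kappa> (s + h) j"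
          have qn: "q < n (k j)" using q elim by auto
          \<comment> \<open>\<open>q\<close> precedes the first index that reaches
            \<open>s + h\<close>, so every step in the sum starts inside the window, although the
            last one may end after it.\<close>
          have up: "t (k j) q < s + h" using q elim by auto
          have lo: "s \<le> t (k j) q"
          proof -
            have "t (k j) m \<le> t (k j) q" if "m \<le> q" for m
              using that qn
            proof (induction q rule: dec_induct)
              case (step q)
              then show ?case using t(1)[of q "k j"] by simp
            qed simp
            then show ?thesis using q(1) elim by (meson order_trans)
          qed
          have "norm (Y (k j) (t (k j) q) - g (t (k j) q)) < \<delta> / 2"
            using up lo s sh elim by (intro M) auto
          moreover have "dist (g (t (k j) q)) (g s) \<le> \<delta> / 2"
          proof -
            have "dist (g (t (k j) q)) (g s) \<le> L * dist (t (k j) q) s"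
              using up lo s sh by (intro lipschitz_onD[OF glip]) auto
            also have "\<dots> \<le> L * h0" using up lo h L by (intro mult_left_mono) (auto simp: dist_real_def)
            also have "\<dots> \<le> \<delta> / 2" using h0 h0L by (simp add: algebra_simps)
            finally show ?thesis .
          qed
          ultimately have close: "dist (x (k j) q) (g s) < \<delta>"
            using Y(1)[of q "k j"] qn dist_triangle[of "x (k j) q" "g s" "g (t (k j) q)"]
            by (simp add: dist_norm)
          define dt where "dt = t (k j) (Suc q) - t (k j) q"
          have "dt > 0" using t(1)[OF qn] by (simp add: dt_def)
          have "norm ((x (k j) q - x (k j) (Suc q)) /\<^sub>R dt) \<le> V"
          proof -
            have "norm ((x (k j) q - x (k j) (Suc q)) /\<^sub>R dt) = norm (x (k j) q - x (k j) (Suc q)) / dt"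
              using \<open>dt > 0\<close> by (simp add: divide_inverse mult.commute)
            then show ?thesis
              using speed[OF qn] \<open>dt > 0\<close> by (simp add: dt_def[symmetric] pos_divide_le_eq)
          qed
          then have "b \<le> a \<bullet> ((x (k j) q - x (k j) (Suc q)) /\<^sub>R dt)"
            using A[OF qn] elim close by (intro \<delta>(2)[rule_format, of "k j"]) (auto simp: dt_def)
          then show "b * (t (k j) (Suc q) - t (k j) q) \<le> a \<bullet> (x (k j) q - x (k j) (Suc q))"
          proof -
            have "a \<bullet> ((x (k j) q - x (k j) (Suc q)) /\<^sub>R dt) = a \<bullet> (x (k j) q - x (k j) (Suc q)) / dt"
              by (simp only: inner_scaleR_right divide_inverse mult.commute)
            with \<open>b \<le> a \<bullet> _\<close> show ?thesis
              using \<open>dt > 0\<close> by (simp add: dt_def[symmetric] pos_le_divide_eq)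
          qed
        qed
      qed
      moreover have "(\<lambda>j. b * (t (k j) (\<kappa> (s + h) j) - t (k j) (\<kappa> s j))) \<longlonglongrightarrow> b * ((s + h) - s)"
        using s sh by (intro tendsto_intros t\<kappa>)
      moreover have "(\<lambda>j. a \<bullet> (x (k j) (\<kappa> s j) - x (k j) (\<kappa> (s + h) j))) \<longlonglongrightarrow> a \<bullet> (g s - g (s + h))"
        using s sh by (intro tendsto_intros x\<kappa>)
      ultimately show ?thesis
        using tendsto_le[OF sequentially_bot] by fastforce
    qed
    from right_difference_quotient[OF w s h0(1) this] ab(1) show False by simp
  qed
  show thesis
  proof (rule that[OF k])
    show "solution H {0..\<tau>} g"
      unfolding solution_def
    proof (intro conjI allI impI)
      show "abs_continuous_on {a..b} g" if "{a..b} \<subseteq> {0..\<tau>}" for a b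
        using lipschitz_on_subset[OF glip that] by (rule lipschitz_imp_abs_continuous_on)
      \<comment> \<open>The final time admits no right quotient and is discarded as a null
        set.\<close>
      have "AE s in lebesgue. s \<noteq> \<tau>" unfolding AE_iff_negligible by simp
      with lipschitz_AE_differentiable[OF cf glip]
      show "AE s in lebesgue. s \<in> {0..\<tau>} \<longrightarrow>
          (\<exists>w. (g has_vector_derivative w) (at s within {0..\<tau>}) \<and> - w \<in> H (g s))"
      proof eventually_elim
        case (elim s)
        then show ?case using velocity[of _ s] by force
      qed
    qed (auto simp: is_interval_cc)
    show "g 0 = p" using ptw[of 0] Y0 \<open>\<tau> \<ge> 0\<close> by (simp add: LIMSEQ_const_iff)
    have "(\<lambda>j. Y (k j) (t (k j) (n (k j)))) \<longlonglongrightarrow> g \<tau>" using \<open>\<tau> \<ge> 0\<close> by (intro moving Tk) auto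
    then show "(\<lambda>j. x (k j) (n (k j))) \<longlonglongrightarrow> g \<tau>" by (simp add: Y(1))
  qed
qed

section \<open>Closed convex functions and the composite inclusion\<close>

lemma locally_bounded_on_compact:
  fixes D :: "'a::metric_space \<Rightarrow> 'b::metric_space set"
  assumes "locally_bounded D" "compact K"
  shows "bounded (\<Union>x\<in>K. D x)"
proof -
  obtain U where U: "\<And>x. open (U x) \<and> x \<in> U x \<and> bounded (\<Union>y\<in>U x. D y)"
    using assms(1) unfolding locally_bounded_def by metis
  have "K \<subseteq> (\<Union>x\<in>K. U x)" using U by blast
  then obtain F where F: "F \<subseteq> K" "finite F" "K \<subseteq> (\<Union>x\<in>F. U x)"
    using compactE_image[OF assms(2), of K U] U by metis
  have "(\<Union>x\<in>K. D x) \<subseteq> (\<Union>x\<in>F. \<Union>y\<in>U x. D y)" using F(3) by blast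
  moreover have "bounded (\<Union>x\<in>F. \<Union>y\<in>U x. D y)" using F(2) U by (intro bounded_UN) auto
  ultimately show ?thesis by (rule bounded_subset[rotated])
qed

text \<open>Serves to make the values of all \<open>N\<close> fields converge along one and the same
  subsequence.\<close>

lemma common_convergent_subsequence:
  fixes d :: "'i \<Rightarrow> nat \<Rightarrow> 'a::heine_borel"
  assumes "finite I" "\<And>i. i \<in> I \<Longrightarrow> bounded (range (d i))"
  obtains r where "strict_mono (r :: nat \<Rightarrow> nat)" "\<And>i. i \<in> I \<Longrightarrow> convergent (d i \<circ> r)"
proof -
  have "\<exists>r :: nat \<Rightarrow> nat. strict_mono r \<and> (\<forall>i\<in>I. convergent (d i \<circ> r))"
    using assms
  proof (induction I)
    case empty
    show ?case by (intro exI[of _ id]) (simp add: strict_mono_def)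
  next
    case (insert i I)
    have "\<exists>r :: nat \<Rightarrow> nat. strict_mono r \<and> (\<forall>i\<in>I. convergent (d i \<circ> r))"
      using insert.prems by (intro insert.IH) blast
    then obtain r :: "nat \<Rightarrow> nat" where r: "strict_mono r" "\<forall>i\<in>I. convergent (d i \<circ> r)" by blast
    have "bounded (range (d i \<circ> r))"
      using insert.prems[of i] by (rule bounded_subset) auto
    then obtain l q where q: "strict_mono (q :: nat \<Rightarrow> nat)" "(d i \<circ> r \<circ> q) \<longlonglongrightarrow> l"
      using bounded_imp_convergent_subsequence by blast
    have "convergent (d i' \<circ> (r \<circ> q))" if "i' \<in> I" for i'
      using r(2) that convergent_subseq_convergent[OF _ q(1), of "d i' \<circ> r"] by (simp add: o_assoc)
    moreover have "convergent (d i \<circ> (r \<circ> q))" using q(2) by (auto simp: o_assoc convergent_def)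
    ultimately show ?case
      using strict_mono_o[OF r(1) q(1)] by blast
  qed
  with that show thesis by blast
qed

section \<open>Subgradients and resolvents of the convex term\<close>

locale closed_convex_function =
  fixes g :: "'a::euclidean_space \<Rightarrow> ereal"
  assumes proper: "proper_fun g" and convex_g: "econvex g" and closed_dom: "closed (edom g)"
    and lip: "locally_lipschitz_on (edom g) (\<lambda>x. real_of_ereal (g x))"
begin

abbreviation "C \<equiv> edom g"
abbreviation "\<gamma> x \<equiv> real_of_ereal (g x)"

lemma g_eq: "x \<in> C \<Longrightarrow> g x = ereal (\<gamma> x)"
  using proper by (auto simp: proper_fun_def edom_def ereal_real)

lemma g_eq_infinity: "x \<notin> C \<Longrightarrow> g x = \<infinity>"
  by (simp add: edom_def)

lemma dom_nonempty: "C \<noteq> {}"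
  using proper by (simp add: proper_fun_def)

lemma convex_combination:
  assumes "x \<in> C" "y \<in> C" "0 \<le> u" "0 \<le> v" "u + v = 1"
  shows "u *\<^sub>R x + v *\<^sub>R y \<in> C" "\<gamma> (u *\<^sub>R x + v *\<^sub>R y) \<le> u * \<gamma> x + v * \<gamma> y"
proof -
  have "g (u *\<^sub>R x + v *\<^sub>R y) \<le> ereal u * g x + ereal v * g y"
    using convex_g assms unfolding econvex_def by blast
  also have "\<dots> = ereal (u * \<gamma> x + v * \<gamma> y)"
  proof -
    obtain a b where "g x = ereal a" "g y = ereal b" using g_eq assms(1,2) by blast
    then show ?thesis by simp
  qed
  finally have *: "g (u *\<^sub>R x + v *\<^sub>R y) \<le> ereal (u * \<gamma> x + v * \<gamma> y)" .
  then show C: "u *\<^sub>R x + v *\<^sub>R y \<in> C" by (auto simp: edom_def intro: le_less_trans)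
  show "\<gamma> (u *\<^sub>R x + v *\<^sub>R y) \<le> u * \<gamma> x + v * \<gamma> y" using * by (subst (asm) g_eq[OF C]) simp
qed

lemma subdifferential_iff:
  "v \<in> subdifferential g x \<longleftrightarrow> x \<in> C \<and> (\<forall>y\<in>C. \<gamma> x + v \<bullet> (y - x) \<le> \<gamma> y)"
proof (cases "x \<in> C")
  case True
  have "g x + ereal (v \<bullet> (y - x)) \<le> g y \<longleftrightarrow> \<gamma> x + v \<bullet> (y - x) \<le> \<gamma> y" if y: "y \<in> C" for y
  proof -
    obtain a b where "g x = ereal a" "g y = ereal b" using g_eq True y by blast
    then show ?thesis by simp
  qed
  moreover have "g x + ereal (v \<bullet> (y - x)) \<le> g y" if "y \<notin> C" for y
    using g_eq_infinity[OF that] by simp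
  ultimately show ?thesis using True by (auto simp: subdifferential_def)
next
  case False
  obtain y where y: "y \<in> C" using dom_nonempty by blast
  have "\<not> g x + ereal (v \<bullet> (y - x)) \<le> g y"
    using g_eq_infinity[OF False] y by (simp add: edom_def)
  then show ?thesis using False by (auto simp: subdifferential_def)
qed

lemma subdifferentialD:
  assumes "v \<in> subdifferential g x"
  shows "x \<in> C" "\<And>y. y \<in> C \<Longrightarrow> \<gamma> x + v \<bullet> (y - x) \<le> \<gamma> y"
  using assms by (auto simp: subdifferential_iff)

lemma convex_subdifferential: "convex (subdifferential g x)"
proof (rule convexI)
  fix v w :: 'a and a b :: real
  assume *: "v \<in> subdifferential g x" "w \<in> subdifferential g x" "0 \<le> a" "0 \<le> b" "a + b = 1"
  have "\<gamma> x + (a *\<^sub>R v + b *\<^sub>R w) \<bullet> (y - x) \<le> \<gamma> y" if "y \<in> C" for y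
  proof -
    have "a * (\<gamma> x + v \<bullet> (y - x)) + b * (\<gamma> x + w \<bullet> (y - x)) \<le> a * \<gamma> y + b * \<gamma> y"
      using * that by (intro add_mono mult_left_mono subdifferentialD(2)) auto
    moreover have "a * (\<gamma> x + v \<bullet> (y - x)) + b * (\<gamma> x + w \<bullet> (y - x))
        = (a + b) * \<gamma> x + (a *\<^sub>R v + b *\<^sub>R w) \<bullet> (y - x)"
      by (simp add: inner_add_left algebra_simps)
    moreover have "a * \<gamma> y + b * \<gamma> y = (a + b) * \<gamma> y" by (simp add: algebra_simps)
    ultimately show ?thesis using * by simp
  qed
  then show "a *\<^sub>R v + b *\<^sub>R w \<in> subdifferential g x"
    using * by (auto simp: subdifferential_iff)
qed

lemma continuous_on_dom: "continuous_on C \<gamma>"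
  unfolding continuous_on_eq_continuous_within
proof
  fix x assume x: "x \<in> C"
  then obtain r L where r: "r > 0" "L-lipschitz_on (ball x r \<inter> C) \<gamma>"
    using lip unfolding locally_lipschitz_on_def by blast
  have "continuous_on (ball x r \<inter> C) \<gamma>" using r(2) by (rule lipschitz_on_continuous_on)
  then have "continuous (at x within (ball x r \<inter> C)) \<gamma>"
    using x r(1) by (simp add: continuous_on_eq_continuous_within)
  moreover have "at x within (C \<inter> ball x r) = at x within C"
    using r(1) by (intro at_within_nhd[of x "ball x r"]) auto
  ultimately show "continuous (at x within C) \<gamma>" by (simp add: Int_commute)
qed

text \<open>By convexity, a Lipschitz bound near \<open>x\<close> controls the decrease of the function away
  from \<open>x\<close> globally; the constant is uniform on bounded sets.\<close>

lemma calm: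
  "\<exists>L\<ge>0. \<forall>x y. x \<in> C \<longrightarrow> norm x \<le> R \<longrightarrow> y \<in> C \<longrightarrow> \<gamma> x - L * norm (y - x) \<le> \<gamma> y"
proof -
  have "\<exists>L::nat. \<forall>x y. x \<in> C \<longrightarrow> norm x \<le> R \<longrightarrow> y \<in> C \<longrightarrow> \<gamma> x - L * norm (y - x) \<le> \<gamma> y"
  proof (rule ccontr)
    assume "\<not> ?thesis"
    then have "\<forall>n::nat. \<exists>x y. x \<in> C \<and> norm x \<le> R \<and> y \<in> C \<and> \<gamma> y < \<gamma> x - n * norm (y - x)"
      by (simp add: not_le)
    then obtain x y where xy: "\<And>n::nat. x n \<in> C" "\<And>n. norm (x n) \<le> R" "\<And>n. y n \<in> C"
      "\<And>n. \<gamma> (y n) < \<gamma> (x n) - n * norm (y n - x n)" by metis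
    have "bounded (range x)" using xy(2) by (auto simp: bounded_iff)
    then obtain p q where q: "strict_mono (q :: nat \<Rightarrow> nat)" "(x \<circ> q) \<longlonglongrightarrow> p"
      using bounded_imp_convergent_subsequence by blast
    have "p \<in> C" using closed_sequentially[OF closed_dom _ q(2)] xy(1) by simp
    then obtain r L where r: "r > 0" and L: "L-lipschitz_on (ball p r \<inter> C) \<gamma>"
      using lip unfolding locally_lipschitz_on_def by blast
    have "\<forall>\<^sub>F n in sequentially. dist (x (q n)) p < r / 2"
      using tendstoD[OF q(2), of "r / 2"] r by simp
    moreover have "\<forall>\<^sub>F n in sequentially. L \<le> real (q n)"
      using filterlim_compose[OF filterlim_real_sequentially filterlim_subseq[OF q(1)]]
      by (simp add: filterlim_at_top)
    ultimately have "\<forall>\<^sub>F n::nat in sequentially. False"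
    proof eventually_elim
      case (elim n)
      define X Y where "X = x (q n)" and "Y = y (q n)"
      have X: "X \<in> C" "dist X p < r / 2" and Y: "Y \<in> C"
        and less: "\<gamma> Y < \<gamma> X - real (q n) * norm (Y - X)"
        using elim xy by (auto simp: X_def Y_def)
      \<comment> \<open>Pulls \<open>Y\<close> along the segment to a point \<open>Z\<close> within
        \<open>r / 4\<close> of \<open>X\<close>, hence into the ball where the Lipschitz bound
        holds; the formula covers near and far \<open>Y\<close> alike. By convexity the decrease
        from \<open>X\<close> to \<open>Z\<close> is at least the fraction \<open>s\<close> of the
        decrease from \<open>X\<close> to \<open>Y\<close>, so that \<open>s\<close>
        cancels.\<close>
      define s where "s = r / (r + 4 * norm (Y - X))"
      have "r + 4 * norm (Y - X) > 0" using r by (simp add: add_pos_nonneg)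
      then have s: "0 < s" "s \<le> 1" "s * norm (Y - X) \<le> r / 4"
        using r by (auto simp: s_def field_simps)
      define Z where "Z = (1 - s) *\<^sub>R X + s *\<^sub>R Y"
      have Z: "Z \<in> C" "\<gamma> Z \<le> (1 - s) * \<gamma> X + s * \<gamma> Y"
        using convex_combination[OF X(1) Y, of "1 - s" s] s by (auto simp: Z_def)
      have ZX: "Z - X = s *\<^sub>R (Y - X)" by (simp add: Z_def algebra_simps)
      then have dZX: "dist Z X = s * norm (Y - X)" using s by (simp add: dist_norm)
      have "dist Z p < r" using dist_triangle[of Z p X] dZX s X r by simp
      then have "dist (\<gamma> X) (\<gamma> Z) \<le> L * dist X Z"
        using Z X r by (intro lipschitz_onD[OF L]) (auto simp: dist_commute)
      then have "\<gamma> X - \<gamma> Z \<le> L * (s * norm (Y - X))"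
        using dZX by (simp add: dist_real_def dist_commute abs_le_iff)
      with Z(2) have "s * (\<gamma> X - \<gamma> Y) \<le> s * (L * norm (Y - X))" by (simp add: algebra_simps)
      then have "\<gamma> X - \<gamma> Y \<le> L * norm (Y - X)" using s by simp
      also have "\<dots> \<le> real (q n) * norm (Y - X)" using elim by (intro mult_right_mono) auto
      finally show False using less by simp
    qed
    then show False by simp
  qed
  then show ?thesis using of_nat_0_le_iff by blast
qed

text \<open>The domain is closed and \<open>\<gamma>\<close> is continuous on it, so the values
  \<open>\<gamma> (x n)\<close> converge and the subgradient inequalities pass to the limit.\<close>

lemma subdifferential_limit:
  assumes "x \<longlonglongrightarrow> p" "w \<longlonglongrightarrow> v" "\<And>n. w n \<in> subdifferential g (x n)"
  shows "v \<in> subdifferential g p"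
proof -
  have xC: "x n \<in> C" for n using assms(3) by (rule subdifferentialD)
  have p: "p \<in> C" using closed_sequentially[OF closed_dom _ assms(1)] xC by blast
  have "(\<lambda>n. \<gamma> (x n)) \<longlonglongrightarrow> \<gamma> p"
    using continuous_on_tendsto_compose[OF continuous_on_dom assms(1) p] xC by simp
  from tendsto_add[OF this tendsto_inner[OF assms(2) tendsto_diff[OF tendsto_const assms(1)]]]
  have "\<gamma> p + v \<bullet> (y - p) \<le> \<gamma> y" if "y \<in> C" for y
    by (rule LIMSEQ_le_const2) (use subdifferentialD(2)[OF assms(3) that] in blast)
  with p show ?thesis by (simp add: subdifferential_iff)
qed

text \<open>First-order optimality: compare \<open>x\<close> with the point at fraction
  \<open>u\<close> of the segment to \<open>y\<close>, divide by \<open>u\<close> and let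
  \<open>u\<close> tend to \<open>0\<close>. Minimality is stated with real values on
  \<open>C\<close> so that it serves both given proximal points and constructed ones.\<close>

lemma resolvent_if_minimal:
  assumes "\<alpha> > 0" "x \<in> C"
    and min: "\<And>y. y \<in> C \<Longrightarrow> \<alpha> * \<gamma> x + (norm (x - z))\<^sup>2 / 2 \<le> \<alpha> * \<gamma> y + (norm (y - z))\<^sup>2 / 2"
  shows "(z - x) /\<^sub>R \<alpha> \<in> subdifferential g x"
proof -
  have "\<gamma> x + ((z - x) /\<^sub>R \<alpha>) \<bullet> (y - x) \<le> \<gamma> y" if y: "y \<in> C" for y
  proof -
    \<comment> \<open>By convexity the objective grows from \<open>x\<close> by at most
      \<open>u * e\<close> plus a term quadratic in \<open>u\<close>.\<close>
    define e where "e = \<alpha> * (\<gamma> y - \<gamma> x) + (x - z) \<bullet> (y - x)"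
    have "0 \<le> e + u * ((norm (y - x))\<^sup>2 / 2)" if u: "0 < u" "u \<le> 1" for u
    proof -
      define p where "p = (1 - u) *\<^sub>R x + u *\<^sub>R y"
      have p: "p \<in> C" "\<gamma> p \<le> (1 - u) * \<gamma> x + u * \<gamma> y"
        using convex_combination[OF \<open>x \<in> C\<close> y, of "1 - u" u] u by (auto simp: p_def)
      have expand: "(norm (a + u *\<^sub>R b))\<^sup>2 = (norm a)\<^sup>2 + 2 * u * (a \<bullet> b) + u\<^sup>2 * (norm b)\<^sup>2" for a b :: 'a
        unfolding power2_norm_eq_inner
        by (simp add: inner_add_left inner_add_right inner_commute power2_eq_square algebra_simps)
      have pz: "p - z = (x - z) + u *\<^sub>R (y - x)" by (simp add: p_def algebra_simps)
      have "(norm (p - z))\<^sup>2 = (norm (x - z))\<^sup>2 + 2 * u * ((x - z) \<bullet> (y - x)) + u\<^sup>2 * (norm (y - x))\<^sup>2"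
        unfolding pz by (rule expand)
      moreover have "\<alpha> * \<gamma> p \<le> \<alpha> * ((1 - u) * \<gamma> x + u * \<gamma> y)"
        using p(2) \<open>\<alpha> > 0\<close> by simp
      ultimately have "0 \<le> u * (e + u * ((norm (y - x))\<^sup>2 / 2))"
        using min[OF p(1)] by (simp add: e_def algebra_simps power2_eq_square)
      then show ?thesis using u by (simp add: zero_le_mult_iff)
    qed
    then have ev: "\<forall>\<^sub>F u in at_right 0. 0 \<le> e + u * ((norm (y - x))\<^sup>2 / 2)"
      by (intro eventually_at_rightI[of 0 1]) auto
    have "((\<lambda>u. e + u * ((norm (y - x))\<^sup>2 / 2)) \<longlongrightarrow> e + 0 * ((norm (y - x))\<^sup>2 / 2)) (at_right 0)"
      by (intro tendsto_intros)
    then have "0 \<le> e + 0 * ((norm (y - x))\<^sup>2 / 2)"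
      by (rule tendsto_lowerbound[OF _ ev]) simp
    then have "(z - x) \<bullet> (y - x) \<le> \<alpha> * (\<gamma> y - \<gamma> x)"
      by (simp add: e_def inner_diff_left algebra_simps)
    then have "((z - x) \<bullet> (y - x)) / \<alpha> \<le> \<gamma> y - \<gamma> x"
      using \<open>\<alpha> > 0\<close> by (simp add: pos_divide_le_eq mult.commute)
    moreover have "((z - x) /\<^sub>R \<alpha>) \<bullet> (y - x) = ((z - x) \<bullet> (y - x)) / \<alpha>"
      by (simp only: inner_scaleR_left divide_inverse mult.commute)
    ultimately show ?thesis by simp
  qed
  with \<open>x \<in> C\<close> show ?thesis by (simp add: subdifferential_iff)
qed

lemma prox_imp_resolvent:
  assumes "\<alpha> > 0" "x \<in> prox (\<lambda>y. ereal \<alpha> * g y) z"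
  shows "(z - x) /\<^sub>R \<alpha> \<in> subdifferential g x"
proof -
  have min: "ereal \<alpha> * g x + ereal ((norm (x - z))\<^sup>2 / 2) \<le> ereal \<alpha> * g y + ereal ((norm (y - z))\<^sup>2 / 2)" for y
    using assms(2) by (auto simp: prox_def is_arg_min_def not_less)
  \<comment> \<open>The objective is finite at \<open>c\<close>, hence finite at the minimizer; as
    \<open>\<alpha> > 0\<close>, the product with an infinite value stays infinite and forces the
    minimizer into \<open>C\<close>.\<close>
  obtain c where c: "c \<in> C" using dom_nonempty by blast
  have x: "x \<in> C"
  proof (rule ccontr)
    assume "x \<notin> C"
    then have "g x = \<infinity>" by (rule g_eq_infinity)
    then have eq: "ereal \<alpha> * g x + ereal ((norm (x - z))\<^sup>2 / 2) = \<infinity>" using \<open>\<alpha> > 0\<close> by simp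
    obtain a where "g c = ereal a" using g_eq[OF c] by blast
    with min[of c, unfolded eq] show False by simp
  qed
  show ?thesis
  proof (rule resolvent_if_minimal[OF \<open>\<alpha> > 0\<close> x])
    fix y assume "y \<in> C"
    then show "\<alpha> * \<gamma> x + (norm (x - z))\<^sup>2 / 2 \<le> \<alpha> * \<gamma> y + (norm (y - z))\<^sup>2 / 2"
    proof -
      obtain a b where "g x = ereal a" "g y = ereal b" using g_eq x \<open>y \<in> C\<close> by blast
      then show ?thesis using min[of y] by simp
    qed
  qed
qed

text \<open>Needed to build approximate solutions for local existence, whereas a PRR sequence brings
  its proximal points along. Calmness at a fixed \<open>c\<close> lets \<open>\<gamma>\<close>
  decrease at most linearly, so the quadratic term wins outside a ball and a minimum over a compact
  set is global.\<close>

lemma resolvent_exists: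
  assumes "\<alpha> > 0"
  obtains x where "(z - x) /\<^sub>R \<alpha> \<in> subdifferential g x"
proof -
  obtain c where c: "c \<in> C" using dom_nonempty by blast
  obtain L where L: "L \<ge> 0"
    "\<forall>x y. x \<in> C \<longrightarrow> norm x \<le> norm c \<longrightarrow> y \<in> C \<longrightarrow> \<gamma> x - L * norm (y - x) \<le> \<gamma> y"
    using calm by blast
  define e where "e = norm (c - z)"
  \<comment> \<open>For \<open>r \<ge> \<rho>\<close> this gives
    \<open>\<alpha> * L \<le> (r - 2 * e - 1) / 2 \<le> (r - e) / 2\<close>. Multiplied by
    \<open>r + e\<close>, the right-hand side is \<open>(r\<^sup>2 - e\<^sup>2) / 2\<close>, the
    gain of the quadratic term over its value at \<open>c\<close>.\<close>
  define \<rho> where "\<rho> = 2 * \<alpha> * L + 2 * e + 1"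
  define F where "F y = \<alpha> * \<gamma> y + (norm (y - z))\<^sup>2 / 2" for y
  have e: "e \<ge> 0" by (simp add: e_def)
  then have "e \<le> \<rho>" using L \<open>\<alpha> > 0\<close> by (simp add: \<rho>_def)
  have "compact (C \<inter> cball z \<rho>)" using closed_dom by (intro closed_Int_compact) auto
  moreover have "continuous_on (C \<inter> cball z \<rho>) F"
    unfolding F_def by (intro continuous_intros continuous_on_subset[OF continuous_on_dom]) auto
  moreover have cin: "c \<in> C \<inter> cball z \<rho>" using c \<open>e \<le> \<rho>\<close> by (simp add: e_def dist_norm norm_minus_commute)
  ultimately obtain x where x: "x \<in> C \<inter> cball z \<rho>" "\<And>y. y \<in> C \<inter> cball z \<rho> \<Longrightarrow> F x \<le> F y"
    using continuous_attains_inf[of "C \<inter> cball z \<rho>" F] by blast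
  have far: "F c \<le> F y" if y: "y \<in> C" "norm (y - z) > \<rho>" for y
  proof -
    define r where "r = norm (y - z)"
    have r: "r \<ge> \<rho>" using y by (simp add: r_def)
    then have r0: "r \<ge> 0" "r \<ge> e" using \<open>e \<le> \<rho>\<close> e by auto
    have "norm (y - c) \<le> r + e" using norm_triangle_ineq4[of "y - z" "c - z"] by (simp add: r_def e_def)
    then have "L * norm (y - c) \<le> L * (r + e)" using L by (intro mult_left_mono)
    then have "\<gamma> c - L * (r + e) \<le> \<gamma> y" using L(2)[rule_format, OF c _ y(1)] by simp
    then have "\<alpha> * (\<gamma> c - L * (r + e)) \<le> \<alpha> * \<gamma> y" using \<open>\<alpha> > 0\<close> by simp
    then have 1: "\<alpha> * \<gamma> c - \<alpha> * L * (r + e) \<le> \<alpha> * \<gamma> y" by (simp add: algebra_simps)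
    have "\<alpha> * L * (r + e) \<le> ((r - 2 * e - 1) / 2) * (r + e)"
      using r r0 e by (intro mult_right_mono) (auto simp: \<rho>_def)
    also have "\<dots> \<le> ((r - e) / 2) * (r + e)" using r0 e by (intro mult_right_mono) auto
    also have "\<dots> = r\<^sup>2 / 2 - e\<^sup>2 / 2" by (simp add: power2_eq_square field_simps)
    finally show ?thesis using 1 by (simp add: F_def r_def e_def)
  qed
  have "F x \<le> F y" if "y \<in> C" for y
  proof (cases "norm (y - z) \<le> \<rho>")
    case True
    with that show ?thesis by (intro x(2)) (simp add: dist_norm norm_minus_commute)
  next
    case False
    with far[OF that] x(2)[OF cin] show ?thesis by simp
  qed
  then have "(z - x) /\<^sub>R \<alpha> \<in> subdifferential g x"
    using x(1) by (intro resolvent_if_minimal[OF \<open>\<alpha> > 0\<close>]) (auto simp: F_def)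
  then show thesis by (rule that)
qed

end

section \<open>The composite inclusion and its approximate graphs\<close>

locale composite_inclusion = closed_convex_function g
  for g :: "'a::euclidean_space \<Rightarrow> ereal" +
  fixes N :: nat and f :: "nat \<Rightarrow> 'a \<Rightarrow> real" and D :: "nat \<Rightarrow> 'a \<Rightarrow> 'a set"
  assumes N: "N \<ge> 1"
    and bounded_D: "\<And>i. i \<in> {1..N} \<Longrightarrow> locally_bounded (D i)"
    and conservative_D: "\<And>i. i \<in> {1..N} \<Longrightarrow> conservative_field (D i) (f i)"
    and convex_D: "\<And>i x. i \<in> {1..N} \<Longrightarrow> D i x \<noteq> {} \<and> convex (D i x)"
begin

definition "H x = (\<Sum>i=1..N. D i x) + subdifferential g x"

text \<open>An iteration evaluates the fields at the inner iterates and the subdifferential at the proximal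
  point; these are the points \<open>z i\<close> and \<open>x'\<close>.\<close>

definition fuzzy_graph :: "real \<Rightarrow> ('a \<times> 'a) set" where
  "fuzzy_graph \<rho> = {(x, s). \<exists>d z x' w. (\<forall>i\<in>{1..N}. d i \<in> D i (z i) \<and> dist (z i) x \<le> \<rho>) \<and>
     w \<in> subdifferential g x' \<and> dist x' x \<le> \<rho> \<and> s = (\<Sum>i=1..N. d i) + w}"

lemma H_iff: "v \<in> H x \<longleftrightarrow> (\<exists>d w. (\<forall>i\<in>{1..N}. d i \<in> D i x) \<and> w \<in> subdifferential g x \<and> v = (\<Sum>i=1..N. d i) + w)"
  unfolding H_def set_plus_def set_sum_alt[OF finite_atLeastAtMost] by blast

lemma H_dom: "v \<in> H x \<Longrightarrow> x \<in> C"
  by (auto simp: H_iff dest: subdifferentialD)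

lemma convex_H: "convex (H x)"
  unfolding H_def
proof (intro convex_set_plus convex_subdifferential)
  show "convex (\<Sum>i = 1..N. D i x)" using convex_D by (intro convex_set_sum) auto
qed

lemma D_bound:
  "\<exists>M\<ge>0. \<forall>i\<in>{1..N}. \<forall>x d. norm x \<le> R \<longrightarrow> d \<in> D i x \<longrightarrow> norm d \<le> M"
proof -
  have "bounded (\<Union>i\<in>{1..N}. \<Union>x\<in>cball 0 R. D i x)"
    using locally_bounded_on_compact[OF bounded_D compact_cball]
    by (intro bounded_UN[OF finite_atLeastAtMost] ballI)
  then obtain M where "M > 0" "\<forall>x\<in>\<Union>i\<in>{1..N}. \<Union>x\<in>cball 0 R. D i x. norm x \<le> M"
    by (auto simp: bounded_pos)
  then show ?thesis by (intro exI[of _ M]) fastforce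
qed

text \<open>The field values stay bounded near \<open>p\<close>, so they converge along a common
  subsequence. The subgradients then converge as differences of convergent sequences, without any
  bound on the subdifferential, and the closed graphs identify the limits.\<close>

lemma fuzzy_graph_converge:
  assumes "\<rho> \<longlonglongrightarrow> 0"
  shows "graphs_converge (\<lambda>j. fuzzy_graph (\<rho> j)) H"
  unfolding graphs_converge_def
proof (intro allI impI, elim conjE)
  fix r x s p v
  assume r: "filterlim r at_top sequentially" and mem: "\<forall>n. (x n, s n) \<in> fuzzy_graph (\<rho> (r n))"
    and x: "x \<longlonglongrightarrow> p" and s: "s \<longlonglongrightarrow> v"
  have rho: "(\<lambda>n. \<rho> (r n)) \<longlonglongrightarrow> 0" using assms r by (rule filterlim_compose)
  have close: "z \<longlonglongrightarrow> p" if "\<And>n. dist (z n) (x n) \<le> \<rho> (r n)" for z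
  proof -
    have "(\<lambda>n. z n - x n) \<longlonglongrightarrow> 0"
      using rho by (rule Lim_null_comparison[rotated]) (use that in \<open>simp add: dist_norm\<close>)
    from tendsto_add[OF this x] show ?thesis by simp
  qed
  from mem have "\<forall>n. \<exists>d z x' w. (\<forall>i\<in>{1..N}. d i \<in> D i (z i) \<and> dist (z i) (x n) \<le> \<rho> (r n)) \<and>
     w \<in> subdifferential g x' \<and> dist x' (x n) \<le> \<rho> (r n) \<and> s n = (\<Sum>i=1..N. d i) + w"
    by (simp add: fuzzy_graph_def)
  then obtain d z x' w where
    dz: "\<And>n i. i \<in> {1..N} \<Longrightarrow> d n i \<in> D i (z n i) \<and> dist (z n i) (x n) \<le> \<rho> (r n)"
    and w: "\<And>n. w n \<in> subdifferential g (x' n)" "\<And>n. dist (x' n) (x n) \<le> \<rho> (r n)"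
    and s_eq: "\<And>n. s n = (\<Sum>i=1..N. d n i) + w n"
    by metis
  have z: "(\<lambda>n. z n i) \<longlonglongrightarrow> p" if "i \<in> {1..N}" for i using dz[OF that] by (intro close) auto
  have x': "x' \<longlonglongrightarrow> p" using w(2) by (rule close)
  have bdd: "bounded (range (\<lambda>n. d n i))" if i: "i \<in> {1..N}" for i
  proof -
    obtain R where R: "\<And>n. norm (z n i) \<le> R"
      using convergent_imp_bounded[OF z[OF i]] by (auto simp: bounded_iff)
    obtain M where M: "\<forall>i\<in>{1..N}. \<forall>x d. norm x \<le> R \<longrightarrow> d \<in> D i x \<longrightarrow> norm d \<le> M"
      using D_bound by blast
    have "norm (d n i) \<le> M" for n using M i R[of n] dz[OF i, of n] by blast
    then show ?thesis by (auto simp: bounded_iff)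
  qed
  obtain q where q: "strict_mono (q :: nat \<Rightarrow> nat)"
    and conv: "\<And>i. i \<in> {1..N} \<Longrightarrow> convergent ((\<lambda>n. d n i) \<circ> q)"
    using common_convergent_subsequence[of "{1..N}" "\<lambda>i n. d n i"] bdd by auto
  define d' where "d' i = lim ((\<lambda>n. d n i) \<circ> q)" for i
  have d': "(\<lambda>n. d (q n) i) \<longlonglongrightarrow> d' i" if "i \<in> {1..N}" for i
    using conv[OF that] unfolding d'_def convergent_LIMSEQ_iff by (simp add: o_def)
  have sub: "(\<lambda>n. X (q n)) \<longlonglongrightarrow> l" if "X \<longlonglongrightarrow> l" for X :: "nat \<Rightarrow> 'a" and l
    using LIMSEQ_subseq_LIMSEQ[OF that q] by (simp add: o_def)
  have "d' i \<in> D i p" if i: "i \<in> {1..N}" for i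
  proof -
    have "closed {(x, v). v \<in> D i x}" using conservative_D[OF i] by (simp add: conservative_field_def)
    moreover have "(\<lambda>n. (z (q n) i, d (q n) i)) \<longlonglongrightarrow> (p, d' i)"
      using sub[OF z[OF i]] d'[OF i] by (intro tendsto_intros)
    ultimately have "(p, d' i) \<in> {(x, v). v \<in> D i x}"
      using dz[OF i] by (rule_tac closed_sequentially) auto
    then show ?thesis by simp
  qed
  moreover have "(\<lambda>n. w (q n)) \<longlonglongrightarrow> v - (\<Sum>i=1..N. d' i)"
  proof -
    have "(\<lambda>n. s (q n) - (\<Sum>i=1..N. d (q n) i)) \<longlonglongrightarrow> v - (\<Sum>i=1..N. d' i)"
      using sub[OF s] d' by (intro tendsto_intros) auto
    then show ?thesis by (simp add: s_eq)
  qed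
  then have "v - (\<Sum>i=1..N. d' i) \<in> subdifferential g p"
    using sub[OF x'] w(1) by (intro subdifferential_limit[of "\<lambda>n. x' (q n)" p "\<lambda>n. w (q n)"])
  ultimately show "v \<in> H p"
    unfolding H_iff by (intro exI[of _ d'] exI[of _ "v - (\<Sum>i=1..N. d' i)"]) auto
qed

lemma H_fuzzy_graph: "v \<in> H x \<Longrightarrow> (x, v) \<in> fuzzy_graph 0"
  unfolding H_iff fuzzy_graph_def by force

text \<open>The closed graph of \<open>H\<close>, phrased with a constant sequence so that the
  half-space lemma applies to \<open>H\<close> itself.\<close>

lemma graphs_converge_H: "graphs_converge (\<lambda>_. {(x, v). v \<in> H x}) H"
proof (rule graphs_convergeI)
  fix r :: "nat \<Rightarrow> nat" and x s p v
  assume *: "filterlim r at_top sequentially" "\<And>n::nat. (x n, s n) \<in> {(x, v). v \<in> H x}" "x \<longlonglongrightarrow> p" "s \<longlonglongrightarrow> v"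
  have "(\<lambda>_. 0::real) \<longlonglongrightarrow> 0" by simp
  from graphs_convergeD[where r = r and x = x and s = s, OF fuzzy_graph_converge[OF this] *(1) _ *(3,4)] show "v \<in> H p"
    using *(2) H_fuzzy_graph by auto
qed

lemma closed_H: "closed (H x)"
  unfolding closed_sequential_limits
proof (intro allI impI, elim conjE)
  fix v l assume "\<forall>n::nat. v n \<in> H x" "v \<longlonglongrightarrow> l"
  then show "l \<in> H x"
    using graphs_convergeD[OF graphs_converge_H filterlim_ident, of "\<lambda>_. x" v x l] by simp
qed

text \<open>Calmness at \<open>x\<close> together with the subgradient inequality at \<open>x'\<close> bounds the component of
  \<open>w\<close> along the step, although \<open>w\<close> itself is not known to be bounded.\<close>

lemma step_bound:
  "\<exists>V\<ge>0. (\<forall>x x' d z w \<alpha>. x \<in> C \<longrightarrow> norm x \<le> R \<longrightarrow> \<alpha> > 0 \<longrightarrow> w \<in> subdifferential g x' \<longrightarrow>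
      (\<forall>i\<in>{1..N}. norm (z i) \<le> R \<and> d i \<in> D i (z i)) \<longrightarrow>
      x - x' = \<alpha> *\<^sub>R ((\<Sum>i=1..N. d i) + w) \<longrightarrow> norm (x - x') \<le> V * \<alpha>) \<and>
    (\<forall>i\<in>{1..N}. \<forall>x d. norm x \<le> R \<longrightarrow> d \<in> D i x \<longrightarrow> N * norm d \<le> V)"
proof -
  obtain L where L: "L \<ge> 0"
    "\<forall>x y. x \<in> C \<longrightarrow> norm x \<le> R \<longrightarrow> y \<in> C \<longrightarrow> \<gamma> x - L * norm (y - x) \<le> \<gamma> y"
    using calm by blast
  obtain M where M: "M \<ge> 0" "\<forall>i\<in>{1..N}. \<forall>x d. norm x \<le> R \<longrightarrow> d \<in> D i x \<longrightarrow> norm d \<le> M"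
    using D_bound by blast
  show ?thesis
  \<comment> \<open>\<open>N * M\<close> bounds the sum of the field values, \<open>L\<close> the
    share of the subgradient. The second clause is for the inner iterates: each of the
    \<open>N\<close> inner steps then has length at most \<open>V * \<alpha> / N\<close>.\<close>
  proof (intro exI[of _ "N * M + L"] conjI allI ballI impI)
    show "real N * M + L \<ge> 0" using L M by simp
    show "N * norm d \<le> N * M + L" if "i \<in> {1..N}" "norm x \<le> R" "d \<in> D i x" for i x d
    proof -
      have "norm d \<le> M" using M(2) that by blast
      then have "N * norm d \<le> N * M" by (intro mult_left_mono) auto
      with L show ?thesis by simp
    qed
  next
    fix x x' w :: 'a and d z \<alpha>
    assume x: "x \<in> C" "norm x \<le> R" and "\<alpha> > (0::real)" and w: "w \<in> subdifferential g x'"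
      and dz: "\<forall>i\<in>{1..N}. norm (z i) \<le> R \<and> d i \<in> D i (z i)"
      and eq: "x - x' = \<alpha> *\<^sub>R ((\<Sum>i=1..N. d i) + w)"
    have "norm (\<Sum>i=1..N. d i) \<le> (\<Sum>i=1..N. M)"
      using dz M(2) by (intro sum_norm_le) blast
    then have dM: "norm (\<Sum>i=1..N. d i) \<le> N * M" by simp
    have x': "x' \<in> C" using w by (rule subdifferentialD)
    have "\<gamma> x' + w \<bullet> (x - x') \<le> \<gamma> x" by (rule subdifferentialD(2)[OF w x(1)])
    \<comment> \<open>\<open>x'\<close> is not assumed to lie in the ball of radius
      \<open>R\<close>; calmness allows an arbitrary second point of \<open>C\<close>.\<close>
    moreover have "\<gamma> x - L * norm (x - x') \<le> \<gamma> x'"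
      using L(2)[rule_format, OF x x'] by (simp add: norm_minus_commute)
    ultimately have wL: "w \<bullet> (x - x') \<le> L * norm (x - x')" by simp
    have "norm (x - x') * norm (x - x') = (x - x') \<bullet> (x - x')" by (simp add: dot_square_norm power2_eq_square)
    also have "\<dots> = \<alpha> * ((\<Sum>i=1..N. d i) \<bullet> (x - x') + w \<bullet> (x - x'))"
      by (subst (1) eq) (simp add: inner_add_left)
    also have "\<dots> \<le> \<alpha> * (N * M * norm (x - x') + L * norm (x - x'))"
    proof -
      have "(\<Sum>i=1..N. d i) \<bullet> (x - x') \<le> N * M * norm (x - x')"
        using norm_cauchy_schwarz[of "\<Sum>i=1..N. d i" "x - x'"] mult_right_mono[OF dM, of "norm (x - x')"]
        by simp
      with wL \<open>\<alpha> > 0\<close> show ?thesis by (intro mult_left_mono add_mono) auto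
    qed
    finally have "norm (x - x') * norm (x - x') \<le> ((N * M + L) * \<alpha>) * norm (x - x')"
      by (simp add: algebra_simps)
    then show "norm (x - x') \<le> (N * M + L) * \<alpha>"
      using L M \<open>\<alpha> > 0\<close> by (cases "norm (x - x') = 0") (auto simp: mult_le_cancel_right)
  qed
qed

end

section \<open>Solutions and trajectories\<close>

text \<open>Testing with a fixed vector reduces curves to the scalar case. The vector will be the
  displacement of the curve, to bound its speed, or a separating normal, to show a drift.\<close>

lemma inner_increment_le:
  fixes x :: "real \<Rightarrow> 'a::euclidean_space"
  assumes ac: "abs_continuous_on {a..b} x" and "a \<le> b"
    and ae: "AE t in lebesgue. t \<in> {a<..<b} \<longrightarrow>
      (\<exists>w. (x has_vector_derivative w) (at t within {a..b}) \<and> e \<bullet> w \<le> c)"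
  shows "e \<bullet> (x b - x a) \<le> c * (b - a)"
proof -
  have "abs_continuous_on {a..b} (\<lambda>t. e \<bullet> x t)"
    unfolding abs_continuous_on_def
  proof (intro allI impI)
    fix \<epsilon> :: real assume "\<epsilon> > 0"
    then have pos: "\<epsilon> / (norm e + 1) > 0" by (simp add: add_nonneg_pos)
    obtain d where "d > 0" and d: "\<forall>P. finite P \<and> (\<forall>(s, t)\<in>P. s \<le> t \<and> {s..t} \<subseteq> {a..b}) \<and>
       disjoint_family_on (\<lambda>(s, t). {s<..<t}) P \<and> (\<Sum>(s, t)\<in>P. t - s) < d \<longrightarrow>
       (\<Sum>(s, t)\<in>P. dist (x s) (x t)) < \<epsilon> / (norm e + 1)"
      using ac[unfolded abs_continuous_on_def, rule_format, OF pos] by (elim exE conjE)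
    have "(\<Sum>(s, t)\<in>P. dist (e \<bullet> x s) (e \<bullet> x t)) < \<epsilon>"
      if P: "finite P \<and> (\<forall>(s, t)\<in>P. s \<le> t \<and> {s..t} \<subseteq> {a..b}) \<and>
       disjoint_family_on (\<lambda>(s, t). {s<..<t}) P \<and> (\<Sum>(s, t)\<in>P. t - s) < d" for P
    proof -
      have "(\<Sum>(s, t)\<in>P. dist (e \<bullet> x s) (e \<bullet> x t)) \<le> (\<Sum>(s, t)\<in>P. norm e * dist (x s) (x t))"
        using Cauchy_Schwarz_ineq2[of e]
        by (intro sum_mono) (auto simp: dist_norm simp flip: inner_diff_right)
      also have "\<dots> = norm e * (\<Sum>(s, t)\<in>P. dist (x s) (x t))"
        by (simp add: sum_distrib_left case_prod_unfold)
      also have "\<dots> \<le> norm e * (\<epsilon> / (norm e + 1))"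
        using d[rule_format, OF P] by (intro mult_left_mono) auto
      also have "\<dots> < \<epsilon>"
      proof -
        have "0 < norm e + 1" by (simp add: add_nonneg_pos)
        with \<open>\<epsilon> > 0\<close> show ?thesis by (simp add: pos_divide_less_eq algebra_simps)
      qed
      finally show ?thesis .
    qed
    with \<open>d > 0\<close> show "\<exists>d>0. \<forall>P. finite P \<and> (\<forall>(s, t)\<in>P. s \<le> t \<and> {s..t} \<subseteq> {a..b}) \<and>
       disjoint_family_on (\<lambda>(s, t). {s<..<t}) P \<and> (\<Sum>(s, t)\<in>P. t - s) < d \<longrightarrow>
       (\<Sum>(s, t)\<in>P. dist (e \<bullet> x s) (e \<bullet> x t)) < \<epsilon>"
      by blast
  qed
  moreover have "AE t in lebesgue. t \<in> {a<..<b} \<longrightarrow> (\<exists>d\<le>c. ((\<lambda>t. e \<bullet> x t) has_real_derivative d) (at t))"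
    using ae
  proof eventually_elim
    case (elim t)
    show ?case
    proof
      assume t: "t \<in> {a<..<b}"
      with elim obtain w where w: "(x has_vector_derivative w) (at t within {a..b})" "e \<bullet> w \<le> c" by blast
      have "at t within {a..b} = at t" using t by (intro at_within_interior) auto
      with w(1) have "(x has_vector_derivative w) (at t)" by simp
      from bounded_linear.has_vector_derivative[OF bounded_linear_inner_right this, of e]
      have "((\<lambda>t. e \<bullet> x t) has_real_derivative (e \<bullet> w)) (at t)"
        by (simp add: has_real_derivative_iff_has_vector_derivative)
      with w(2) show "\<exists>d\<le>c. ((\<lambda>t. e \<bullet> x t) has_real_derivative d) (at t)" by blast
    qed
  qed
  ultimately show ?thesis
    using increment_le_if_AE_derivative_le[of a b "\<lambda>t. e \<bullet> x t" c] \<open>a \<le> b\<close> by (simp add: inner_diff_right)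
qed

section \<open>Restricting, exhausting and gluing solutions\<close>

lemma abs_continuous_on_empty: "abs_continuous_on {} x"
  by (rule lipschitz_imp_abs_continuous_on[of 0]) simp

lemma solution_subset:
  assumes "solution H I x" "J \<subseteq> I" "is_interval J"
  shows "solution H J x"
proof -
  have "AE t in lebesgue. t \<in> I \<longrightarrow> (\<exists>w. (x has_vector_derivative w) (at t within I) \<and> - w \<in> H (x t))"
    using assms(1) by (simp add: solution_def)
  then have "AE t in lebesgue. t \<in> J \<longrightarrow> (\<exists>w. (x has_vector_derivative w) (at t within J) \<and> - w \<in> H (x t))"
    by eventually_elim (use assms(2) in \<open>blast intro: has_vector_derivative_within_subset\<close>)
  moreover have "\<forall>a b. {a..b} \<subseteq> J \<longrightarrow> abs_continuous_on {a..b} x" "I \<subseteq> {0..}"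
    using assms(1,2) unfolding solution_def by blast+
  ultimately show ?thesis using assms(2,3) unfolding solution_def by blast
qed

lemma solution_cong:
  assumes "solution H I x" "\<And>t. t \<in> I \<Longrightarrow> y t = x t"
  shows "solution H I y"
proof -
  have "AE t in lebesgue. t \<in> I \<longrightarrow> (\<exists>w. (x has_vector_derivative w) (at t within I) \<and> - w \<in> H (x t))"
    using assms(1) by (simp add: solution_def)
  then have "AE t in lebesgue. t \<in> I \<longrightarrow> (\<exists>w. (y has_vector_derivative w) (at t within I) \<and> - w \<in> H (y t))"
    by eventually_elim (metis assms(2) has_vector_derivative_transform)
  moreover have "abs_continuous_on {a..b} y" if "{a..b} \<subseteq> I" for a b
    using assms that by (intro abs_continuous_on_transfer[of "{a..b}" x "{a..b}" y]) (auto simp: solution_def)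
  ultimately show ?thesis using assms(1) unfolding solution_def by blast
qed

lemma is_interval_time_domain: "is_interval (time_domain T)"
  unfolding is_interval_1 time_domain_def by (auto, meson ereal_less_eq(3) le_less_trans)

lemma Icc_subset_time_domain: "ereal b < T \<Longrightarrow> {0..b} \<subseteq> time_domain T"
  unfolding time_domain_def by (auto, meson ereal_less_eq(3) le_less_trans)

text \<open>Each \<open>b\<close> comes with its own null set. Rational \<open>b\<close> suffice,
  because some rational lies strictly between \<open>t\<close> and \<open>T\<close>, and they leave
  a single null set. The derivatives within the short interval and within the whole domain agree at
  \<open>t\<close>, which is not the right end of either.\<close>

lemma solution_time_domainI:
  assumes sol: "\<And>b. 0 \<le> b \<Longrightarrow> ereal b < T \<Longrightarrow> solution H {0..b} x"
  shows "solution H (time_domain T) x"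
  unfolding solution_def
proof (intro conjI allI impI)
  show "is_interval (time_domain T)" by (rule is_interval_time_domain)
  show "time_domain T \<subseteq> {0..}" by (auto simp: time_domain_def)
  show "abs_continuous_on {a..b} x" if ab: "{a..b} \<subseteq> time_domain T" for a b
  proof (cases "a \<le> b")
    case True
    then have "a \<in> time_domain T" "b \<in> time_domain T" using ab by auto
    then have "0 \<le> a" "0 \<le> b" "ereal b < T" by (auto simp: time_domain_def)
    with sol[of b] show ?thesis by (auto simp: solution_def)
  qed (simp add: abs_continuous_on_empty)
  have "AE t in lebesgue. 0 \<le> real_of_rat q \<and> ereal (real_of_rat q) < T \<and> t \<in> {0..real_of_rat q} \<longrightarrow>
      (\<exists>w. (x has_vector_derivative w) (at t within {0..real_of_rat q}) \<and> - w \<in> H (x t))" for q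
    using sol[of "real_of_rat q"] by (cases "0 \<le> real_of_rat q \<and> ereal (real_of_rat q) < T") (auto simp: solution_def)
  then have "AE t in lebesgue. \<forall>q. 0 \<le> real_of_rat q \<and> ereal (real_of_rat q) < T \<and> t \<in> {0..real_of_rat q} \<longrightarrow>
      (\<exists>w. (x has_vector_derivative w) (at t within {0..real_of_rat q}) \<and> - w \<in> H (x t))"
    by (simp add: AE_all_countable)
  then show "AE t in lebesgue. t \<in> time_domain T \<longrightarrow>
      (\<exists>w. (x has_vector_derivative w) (at t within time_domain T) \<and> - w \<in> H (x t))"
  proof eventually_elim
    case (elim t)
    show ?case
    proof
      assume t: "t \<in> time_domain T"
      then obtain z where z: "t < z" "ereal z < T" using ereal_dense2 by (force simp: time_domain_def)
      then obtain q where q: "t < real_of_rat q" "real_of_rat q < z" using of_rat_dense by blast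
      have "ereal (real_of_rat q) < T" using q z by (meson ereal_less_eq(3) less_imp_le le_less_trans)
      moreover have "t \<in> {0..real_of_rat q}" using q(1) t by (simp add: time_domain_def)
      moreover from this have "0 \<le> real_of_rat q" by (meson atLeastAtMost_iff order_trans)
      ultimately obtain w
        where w: "(x has_vector_derivative w) (at t within {0..real_of_rat q})" "- w \<in> H (x t)"
        using elim by blast
      have "at t within {0..real_of_rat q} = at t within time_domain T"
        using q Icc_subset_time_domain[OF \<open>ereal (real_of_rat q) < T\<close>]
        by (intro at_within_nhd[of t "{..<real_of_rat q}"]) (auto simp: time_domain_def)
      with w show "\<exists>w. (x has_vector_derivative w) (at t within time_domain T) \<and> - w \<in> H (x t)"
        by auto
    qed
  qed
qed

lemma AE_shift:
  fixes c :: real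
  assumes "AE t in lebesgue. P t"
  shows "AE t in lebesgue. P (t - c)"
proof -
  have "negligible ((+) c ` {t. \<not> P t})"
    using assms unfolding AE_iff_negligible by (rule negligible_translation)
  moreover have "(+) c ` {t. \<not> P t} = {t. \<not> P (t - c)}"
    by (auto intro!: image_eqI[of _ _ "_ - c"])
  ultimately show ?thesis unfolding AE_iff_negligible by simp
qed

text \<open>The Lipschitz hypotheses give absolute continuity of the glued curve without splitting
  families of intervals at the junction; in the application they come from
  \<open>solution_lipschitz_Icc\<close>. The junction itself is a null set.\<close>

lemma solution_concat:
  assumes x: "solution H {0..b} x" "L-lipschitz_on {0..b} x"
    and y: "solution H {0..c} y" "L-lipschitz_on {0..c} y"
    and "y 0 = x b" "0 \<le> b" "0 \<le> c"
  shows "solution H {0..b + c} (\<lambda>t. if t \<le> b then x t else y (t - b))" (is "solution _ _ ?z")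
  unfolding solution_def
proof (intro conjI allI impI)
  have "L-lipschitz_on {b..b + c} (\<lambda>t. y (t - b))"
  proof (rule lipschitz_onI)
    fix s t assume "s \<in> {b..b + c}" "t \<in> {b..b + c}"
    then have "dist (y (s - b)) (y (t - b)) \<le> L * dist (s - b) (t - b)"
      by (intro lipschitz_onD[OF y(2)]) auto
    then show "dist (y (s - b)) (y (t - b)) \<le> L * dist s t" by (simp add: dist_real_def)
  qed (use x(2) in \<open>rule lipschitz_on_nonneg\<close>)
  then have "L-lipschitz_on {0..b + c} ?z"
    by (intro lipschitz_on_concat x(2)) (use assms in auto)
  then show "abs_continuous_on {u..v} ?z" if "{u..v} \<subseteq> {0..b + c}" for u v
    using that lipschitz_imp_abs_continuous_on lipschitz_on_subset by blast
  have "AE t in lebesgue. t \<in> {0..b} \<longrightarrow> (\<exists>w. (x has_vector_derivative w) (at t within {0..b}) \<and> - w \<in> H (x t))"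
    using x(1) by (simp add: solution_def)
  moreover have "AE t in lebesgue. t - b \<in> {0..c} \<longrightarrow>
      (\<exists>w. (y has_vector_derivative w) (at (t - b) within {0..c}) \<and> - w \<in> H (y (t - b)))"
    using y(1) by (intro AE_shift[of "\<lambda>t. t \<in> {0..c} \<longrightarrow>
      (\<exists>w. (y has_vector_derivative w) (at t within {0..c}) \<and> - w \<in> H (y t))"]) (simp add: solution_def)
  moreover have "AE t in lebesgue. t \<noteq> b" unfolding AE_iff_negligible by simp
  ultimately show "AE t in lebesgue. t \<in> {0..b + c} \<longrightarrow>
      (\<exists>w. (?z has_vector_derivative w) (at t within {0..b + c}) \<and> - w \<in> H (?z t))"
  proof eventually_elim
    case (elim t)
    show ?case
    proof
      assume t: "t \<in> {0..b + c}"
      show "\<exists>w. (?z has_vector_derivative w) (at t within {0..b + c}) \<and> - w \<in> H (?z t)"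
      proof (cases "t < b")
        case True
        then obtain w where w: "(x has_vector_derivative w) (at t within {0..b})" "- w \<in> H (x t)"
          using elim(1) t by auto
        have "at t within {0..b} = at t within {0..b + c}"
          using True \<open>0 \<le> c\<close> by (intro at_within_nhd[of t "{..<b}"]) auto
        with w(1) have "(x has_vector_derivative w) (at t within {0..b + c})" by simp
        then have "(?z has_vector_derivative w) (at t within {0..b + c})"
          by (rule has_vector_derivative_transform_within[where d = "b - t"])
            (use True t in \<open>auto simp: dist_real_def\<close>)
        then show ?thesis using w(2) True by auto
      next
        case False
        with elim have bt: "b < t" by simp
        then obtain w where w: "(y has_vector_derivative w) (at (t - b) within {0..c})" "- w \<in> H (y (t - b))"
          using elim(2) t by auto
        have "((\<lambda>s. s - b) has_vector_derivative 1) (at t within {b..b + c})"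
          by (auto intro!: derivative_eq_intros)
        moreover have "(y has_vector_derivative w) (at (t - b) within (\<lambda>s. s - b) ` {b..b + c})"
          by (rule has_vector_derivative_within_subset[OF w(1)]) auto
        ultimately have "((y \<circ> (\<lambda>s. s - b)) has_vector_derivative 1 *\<^sub>R w) (at t within {b..b + c})"
          by (rule vector_diff_chain_within)
        moreover have "at t within {b..b + c} = at t within {0..b + c}"
          using bt \<open>0 \<le> b\<close> by (intro at_within_nhd[of t "{b<..}"]) auto
        ultimately have "((\<lambda>s. y (s - b)) has_vector_derivative w) (at t within {0..b + c})"
          by (simp add: o_def)
        then have "(?z has_vector_derivative w) (at t within {0..b + c})"
          by (rule has_vector_derivative_transform_within[where d = "t - b"])
            (use bt t in \<open>auto simp: dist_real_def\<close>)
        then show ?thesis using w(2) bt by auto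
      qed
    qed
  qed
qed (auto simp: is_interval_cc)

text \<open>By continuity one exceptional time would produce a whole interval of them. This puts a
  solution into the domain of \<open>g\<close> at every time, in particular at the end point from
  which it is to be continued.\<close>

lemma AE_closed_imp_all:
  fixes x :: "real \<Rightarrow> 'a::metric_space"
  assumes "continuous_on {a..b} x" "closed C" "a < b"
    and ae: "AE t in lebesgue. t \<in> {a..b} \<longrightarrow> x t \<in> C" and t: "t \<in> {a..b}"
  shows "x t \<in> C"
proof (rule ccontr)
  assume "x t \<notin> C"
  then obtain e where "e > 0" and e: "ball (x t) e \<subseteq> - C"
    using \<open>closed C\<close> by (metis ComplI open_Compl openE)
  obtain d where "d > 0" and d: "\<And>s. s \<in> {a..b} \<Longrightarrow> dist s t < d \<Longrightarrow> dist (x s) (x t) < e"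
    using assms(1) t \<open>e > 0\<close> unfolding continuous_on_iff by blast
  define u v where "u = max a (t - d / 2)" and "v = min b (t + d / 2)"
  have uv: "u < v" using t \<open>d > 0\<close> \<open>a < b\<close> by (auto simp: u_def v_def)
  have "x s \<notin> C" if "s \<in> {u..v}" for s
  proof -
    have "s \<in> {a..b}" "dist s t < d" using that \<open>d > 0\<close> by (auto simp: u_def v_def dist_real_def)
    then have "x s \<in> ball (x t) e" using d by (simp add: dist_commute)
    with e show ?thesis by blast
  qed
  then have "{u..v} \<subseteq> {t. \<not> (t \<in> {a..b} \<longrightarrow> x t \<in> C)}" by (auto simp: u_def v_def)
  then have "negligible {u..v}" using ae unfolding AE_iff_negligible by (rule negligible_subset[rotated])
  then show False using negligible_interval(1)[of u v] uv by simp
qed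

section \<open>Speed, local existence and continuation of solutions\<close>

context composite_inclusion
begin

lemma solution_continuous: "solution H I x \<Longrightarrow> {a..b} \<subseteq> I \<Longrightarrow> continuous_on {a..b} x"
  unfolding solution_def by (blast intro: abs_continuous_on_imp_continuous_on)

text \<open>\<open>H\<close> is empty outside the domain. One-point intervals are excluded because
  almost everywhere says nothing there.\<close>

lemma solution_in_dom:
  assumes "solution H {a..b} x" "a < b" "t \<in> {a..b}"
  shows "x t \<in> C"
proof (rule AE_closed_imp_all[OF solution_continuous[OF assms(1) order_refl] closed_dom assms(2) _ assms(3)])
  have "AE t in lebesgue. t \<in> {a..b} \<longrightarrow> (\<exists>w. (x has_vector_derivative w) (at t within {a..b}) \<and> - w \<in> H (x t))"
    using assms(1) by (simp add: solution_def)
  then show "AE t in lebesgue. t \<in> {a..b} \<longrightarrow> x t \<in> C"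
    by eventually_elim (auto dest: H_dom)
qed

text \<open>The subgradient inequality at \<open>x t\<close> and calmness at \<open>x s\<close> for \<open>s < t\<close> bound the component of
  the subgradient along the velocity, so no bound on \<open>H\<close> itself is needed.\<close>

lemma solution_lipschitz:
  "\<exists>V\<ge>0. \<forall>a b x. solution H {a..b} x \<longrightarrow> (\<forall>t\<in>{a..b}. norm (x t) \<le> R) \<longrightarrow> V-lipschitz_on {a..b} x"
proof -
  obtain L where L: "L \<ge> 0"
    "\<forall>x y. x \<in> C \<longrightarrow> norm x \<le> R \<longrightarrow> y \<in> C \<longrightarrow> \<gamma> x - L * norm (y - x) \<le> \<gamma> y"
    using calm by blast
  obtain M where M: "M \<ge> 0" "\<forall>i\<in>{1..N}. \<forall>x d. norm x \<le> R \<longrightarrow> d \<in> D i x \<longrightarrow> norm d \<le> M"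
    using D_bound by blast
  define V where "V = N * M + L"
  have V: "V \<ge> 0" using L M by (simp add: V_def)
  have speed: "norm w \<le> V"
    if sol: "solution H {a..b} x" and R: "\<forall>t\<in>{a..b}. norm (x t) \<le> R" and t: "t \<in> {a<..<b}"
      and w: "(x has_vector_derivative w) (at t within {a..b})" "- w \<in> H (x t)" for a b x t w
  proof -
    obtain d v where dv: "\<forall>i\<in>{1..N}. d i \<in> D i (x t)" "v \<in> subdifferential g (x t)" "- w = (\<Sum>i=1..N. d i) + v"
      using w(2) unfolding H_iff by blast
    have dom: "x s \<in> C" if "s \<in> {a..b}" for s using solution_in_dom[OF sol _ that] t by simp
    have "norm (\<Sum>i=1..N. d i) \<le> (\<Sum>i=1..N. M)"
    proof (rule sum_norm_le)
      fix i assume "i \<in> {1..N}"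
      moreover have "norm (x t) \<le> R" using R t by auto
      ultimately show "norm (d i) \<le> M" using dv(1) M(2) by blast
    qed
    then have dM: "norm (\<Sum>i=1..N. d i) \<le> N * M" by simp
    \<comment> \<open>Left quotients: dividing the subgradient inequality at \<open>x t\<close> by
      \<open>t - s > 0\<close> bounds \<open>v \<bullet> w\<close> from below, as needed because
      \<open>- w\<close> is the element of \<open>H\<close>. Right quotients would bound it from
      above.\<close>
    have lim: "((\<lambda>s. (x s - x t) /\<^sub>R (s - t)) \<longlongrightarrow> w) (at t within {a<..<t})"
      using difference_quotient_tendsto[OF w(1)] by (rule tendsto_within_subset) (use t in auto)
    have "- (v \<bullet> w) \<le> L * norm w"
    proof (rule tendsto_le)
      show "at t within {a<..<t} \<noteq> bot"
        using t by (simp add: at_within_eq_bot_iff islimpt_greaterThanLessThan2)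
      show "((\<lambda>s. L * norm ((x s - x t) /\<^sub>R (s - t))) \<longlongrightarrow> L * norm w) (at t within {a<..<t})"
        by (intro tendsto_intros lim)
      show "((\<lambda>s. - (v \<bullet> ((x s - x t) /\<^sub>R (s - t)))) \<longlongrightarrow> - (v \<bullet> w)) (at t within {a<..<t})"
        by (intro tendsto_intros lim)
      show "\<forall>\<^sub>F s in at t within {a<..<t}. - (v \<bullet> ((x s - x t) /\<^sub>R (s - t))) \<le> L * norm ((x s - x t) /\<^sub>R (s - t))"
        unfolding eventually_at
      proof (intro exI[of _ 1] conjI ballI impI)
        fix s assume s: "s \<in> {a<..<t}" "s \<noteq> t \<and> dist s t < 1"
        then have sab: "s \<in> {a..b}" "t \<in> {a..b}" using t by auto
        have "\<gamma> (x t) + v \<bullet> (x s - x t) \<le> \<gamma> (x s)"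
          using subdifferentialD(2)[OF dv(2) dom[OF sab(1)]] .
        moreover have "\<gamma> (x s) - L * norm (x t - x s) \<le> \<gamma> (x t)"
          using L(2)[rule_format, OF dom[OF sab(1)] _ dom[OF sab(2)]] R sab by blast
        ultimately have "v \<bullet> (x s - x t) \<le> L * norm (x s - x t)" by (simp add: norm_minus_commute)
        then have "(v \<bullet> (x s - x t)) / (t - s) \<le> L * norm (x s - x t) / (t - s)"
          using s by (intro divide_right_mono) auto
        moreover have "- (v \<bullet> ((x s - x t) /\<^sub>R (s - t))) = (v \<bullet> (x s - x t)) / (t - s)"
        proof -
          have "- (v \<bullet> ((x s - x t) /\<^sub>R (s - t))) = - inverse (s - t) * (v \<bullet> (x s - x t))"
            by (simp only: inner_scaleR_right mult_minus_left)
          also have "- inverse (s - t) = inverse (t - s)" by (simp flip: inverse_minus_eq)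
          finally show ?thesis by (simp add: divide_inverse mult.commute)
        qed
        moreover have "L * norm ((x s - x t) /\<^sub>R (s - t)) = L * norm (x s - x t) / (t - s)"
          using s by (simp add: divide_inverse mult.commute abs_minus_commute)
        ultimately show "- (v \<bullet> ((x s - x t) /\<^sub>R (s - t))) \<le> L * norm ((x s - x t) /\<^sub>R (s - t))"
          by simp
      qed simp
    qed
    moreover have "- ((\<Sum>i=1..N. d i) \<bullet> w) \<le> N * M * norm w"
      using Cauchy_Schwarz_ineq2[of "\<Sum>i=1..N. d i" w] mult_right_mono[OF dM, of "norm w"] by simp
    moreover have "norm w * norm w = - ((\<Sum>i=1..N. d i) \<bullet> w) + - (v \<bullet> w)"
    proof -
      have "norm w * norm w = - ((- w) \<bullet> w)" by (simp add: dot_square_norm power2_eq_square)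
      also have "\<dots> = - ((\<Sum>i=1..N. d i) \<bullet> w) + - (v \<bullet> w)" unfolding dv(3) by (simp add: inner_add_left)
      finally show ?thesis .
    qed
    ultimately have "norm w * norm w \<le> V * norm w" by (simp add: V_def algebra_simps)
    then show ?thesis using V by (cases "norm w = 0") (auto simp: mult_le_cancel_right)
  qed
  have "V-lipschitz_on {a..b} x"
    if sol: "solution H {a..b} x" and R: "\<forall>t\<in>{a..b}. norm (x t) \<le> R" for a b x
  proof (rule lipschitz_on_leI[OF _ V])
    fix s t assume st: "s \<in> {a..b}" "t \<in> {a..b}" "s \<le> t"
    have sol': "solution H {s..t} x"
      using sol by (rule solution_subset) (use st in \<open>auto simp: is_interval_cc\<close>)
    have R': "\<forall>u\<in>{s..t}. norm (x u) \<le> R" using R st by auto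
    \<comment> \<open>Testing with the displacement itself makes its squared norm appear on the
      left.\<close>
    define e where "e = x t - x s"
    have "e \<bullet> (x t - x s) \<le> (V * norm e) * (t - s)"
    proof (rule inner_increment_le)
      show "abs_continuous_on {s..t} x" using sol' by (auto simp: solution_def)
      have "AE u in lebesgue. u \<in> {s..t} \<longrightarrow> (\<exists>w. (x has_vector_derivative w) (at u within {s..t}) \<and> - w \<in> H (x u))"
        using sol' by (simp add: solution_def)
      then show "AE u in lebesgue. u \<in> {s<..<t} \<longrightarrow>
          (\<exists>w. (x has_vector_derivative w) (at u within {s..t}) \<and> e \<bullet> w \<le> V * norm e)"
      proof eventually_elim
        case (elim u)
        show ?case
        proof
          assume u: "u \<in> {s<..<t}"
          with elim obtain w where w: "(x has_vector_derivative w) (at u within {s..t})" "- w \<in> H (x u)"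
            by auto
          have "e \<bullet> w \<le> norm e * norm w" by (rule norm_cauchy_schwarz)
          also have "\<dots> \<le> norm e * V" using speed[OF sol' R' u w] by (intro mult_left_mono) auto
          finally show "\<exists>w. (x has_vector_derivative w) (at u within {s..t}) \<and> e \<bullet> w \<le> V * norm e"
            using w(1) by (auto simp: mult.commute)
        qed
      qed
    qed (use st in simp)
    then have "norm e * norm e \<le> (V * (t - s)) * norm e"
      by (simp add: e_def[symmetric] dot_square_norm power2_eq_square mult_ac)
    then have "norm e \<le> V * (t - s)"
      using V st by (cases "norm e = 0") (auto simp: mult_le_cancel_right)
    then show "dist (x s) (x t) \<le> V * dist s t"
      using st by (simp add: e_def dist_norm norm_minus_commute)
  qed
  with V show ?thesis by blast
qed

lemma solution_lipschitz_Icc: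
  assumes "solution H {a..b} x"
  obtains L where "L-lipschitz_on {a..b} x"
proof -
  have "bounded (x ` {a..b})"
    using compact_continuous_image[OF solution_continuous[OF assms order_refl]] by (simp add: compact_imp_bounded)
  then obtain R where "\<forall>t\<in>{a..b}. norm (x t) \<le> R" by (auto simp: bounded_iff)
  with solution_lipschitz[of R] assms that show thesis by blast
qed

text \<open>The approximate solutions consist of proximal steps, explicit in the fields and implicit
  in \<open>g\<close>; the implicit part keeps them in \<open>C\<close>, where
  \<open>step_bound\<close> applies.\<close>

lemma local_existence:
  assumes p: "p \<in> C"
  obtains c y where "c > 0" "solution H {0..c} y" "y 0 = p"
proof -
  define R where "R = norm p + 1"
  obtain V where V: "V \<ge> 0" and step: "\<forall>x x' d z w \<alpha>. x \<in> C \<longrightarrow> norm x \<le> R \<longrightarrow> \<alpha> > 0 \<longrightarrow>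
      w \<in> subdifferential g x' \<longrightarrow> (\<forall>i\<in>{1..N}. norm (z i) \<le> R \<and> d i \<in> D i (z i)) \<longrightarrow>
      x - x' = \<alpha> *\<^sub>R ((\<Sum>i=1..N. d i) + w) \<longrightarrow> norm (x - x') \<le> V * \<alpha>"
    using step_bound[of R] by blast
  \<comment> \<open>At speed \<open>V\<close> the time \<open>c\<close> is too short to move farther
    than \<open>1\<close>, which keeps the iterates in the ball of radius \<open>R\<close>.\<close>
  define c where "c = 1 / (V + 1)"
  have c: "c > 0" "V * c \<le> 1" using V by (auto simp: c_def field_simps)
  define d where "d x i = (SOME v. v \<in> D i x)" for x i
  have d: "d x i \<in> D i x" if "i \<in> {1..N}" for x i
    unfolding d_def using convex_D[OF that, of x] by (simp add: some_in_eq)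
  define nxt where "nxt \<alpha> x = (SOME x'. ((x - \<alpha> *\<^sub>R (\<Sum>i=1..N. d x i)) - x') /\<^sub>R \<alpha> \<in> subdifferential g x')" for \<alpha> x
  have nxt: "((x - \<alpha> *\<^sub>R (\<Sum>i=1..N. d x i)) - nxt \<alpha> x) /\<^sub>R \<alpha> \<in> subdifferential g (nxt \<alpha> x)" if "\<alpha> > 0" for \<alpha> x
    unfolding nxt_def by (rule someI_ex) (use resolvent_exists[OF that] in blast)
  define h where "h j = c / real (Suc j)" for j
  have h: "h j > 0" "real (Suc j) * h j = c" for j using c by (auto simp: h_def)
  define X where "X j k = (nxt (h j) ^^ k) p" for j k
  define w where "w j k = ((X j k - h j *\<^sub>R (\<Sum>i=1..N. d (X j k) i)) - X j (Suc k)) /\<^sub>R h j" for j k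
  have w: "w j k \<in> subdifferential g (X j (Suc k))" for j k
    using nxt[OF h(1)[of j], of "X j k"] by (simp add: w_def X_def)
  have inc: "X j k - X j (Suc k) = h j *\<^sub>R ((\<Sum>i=1..N. d (X j k) i) + w j k)" for j k
    using h(1)[of j] by (simp add: w_def scaleR_add_right)
  have XC: "X j k \<in> C" for j k
    using p subdifferentialD(1)[OF w[of j "k - 1"]] by (cases k) (auto simp: X_def)
  have short: "norm (X j k - X j (Suc k)) \<le> V * h j" if "norm (X j k) \<le> R" for j k
    by (rule step[rule_format, OF XC that h(1) w _ inc]) (use that d in blast)
  \<comment> \<open>The bound on a step holds only from points already known to lie in the ball, so
    distance and step length are controlled together by induction.\<close>
  have near: "norm (X j k - p) \<le> V * (k * h j)" if "k \<le> Suc j" for j k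
    using that
  proof (induction k)
    case (Suc k)
    have "V * (k * h j) \<le> V * c"
      using Suc.prems V h(1)[of j] h(2)[of j, symmetric] by (intro mult_left_mono) (auto intro!: mult_right_mono)
    then have "norm (X j k - p) \<le> 1" using Suc c by simp
    then have "norm (X j k) \<le> R" using norm_triangle_sub[of "X j k" p] by (simp add: R_def)
    from short[OF this] have "norm (X j (Suc k) - X j k) \<le> V * h j" by (simp add: norm_minus_commute)
    moreover have "norm (X j (Suc k) - p) \<le> norm (X j (Suc k) - X j k) + norm (X j k - p)"
      using norm_triangle_ineq[of "X j (Suc k) - X j k" "X j k - p"] by simp
    ultimately show ?case using Suc by (simp add: algebra_simps)
  qed (simp add: X_def)
  have XR: "norm (X j k) \<le> R" if "k \<le> Suc j" for j k
  proof -
    have "V * (k * h j) \<le> V * c"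
      using that V h(1)[of j] h(2)[of j, symmetric] by (intro mult_left_mono) (auto intro!: mult_right_mono)
    then have "norm (X j k - p) \<le> 1" using near[OF that] c by simp
    then show ?thesis using norm_triangle_sub[of "X j k" p] by (simp add: R_def)
  qed
  \<comment> \<open>Dominates both the time step \<open>h j\<close> and the displacement
    \<open>V * h j\<close>.\<close>
  define \<rho> where "\<rho> j = (V + 1) * h j" for j
  have rho: "\<rho> \<longlonglongrightarrow> 0"
  proof -
    have "\<rho> = (\<lambda>j. inverse (real (Suc j)))" using V by (auto simp: \<rho>_def h_def c_def divide_inverse)
    then show ?thesis using LIMSEQ_inverse_real_of_nat by simp
  qed
  obtain r y where "solution H {0..c} y" "y 0 = p"
  proof (rule chain_limit[where x = X and t = "\<lambda>j k. k * h j" and n = Suc and V = V and \<rho> = \<rho>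
        and A = "\<lambda>j. fuzzy_graph (\<rho> j)" and H = H and p = p and \<tau> = c])
    show "conservative_field (D 1) (f 1)" using conservative_D N by simp
    show "graphs_converge (\<lambda>j. fuzzy_graph (\<rho> j)) H" using rho by (rule fuzzy_graph_converge)
    show "real k * h j < real (Suc k) * h j" for k j using h(1)[of j] by simp
    show "real (Suc k) * h j - real k * h j \<le> \<rho> j" for k j
      using h(1)[of j] V by (simp add: \<rho>_def algebra_simps)
    show "norm (X j k - X j (Suc k)) \<le> V * (real (Suc k) * h j - real k * h j)" if "k < Suc j" for j k
      using short[OF XR] that by (simp add: algebra_simps)
    show "(X j k, (X j k - X j (Suc k)) /\<^sub>R (real (Suc k) * h j - real k * h j)) \<in> fuzzy_graph (\<rho> j)"
      if "k < Suc j" for j k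
    proof -
      have eq: "real (Suc k) * h j - real k * h j = h j" by (simp add: algebra_simps)
      have "V * h j \<le> \<rho> j" "0 \<le> \<rho> j" using h(1)[of j] V by (auto simp: \<rho>_def algebra_simps)
      then have "dist (X j (Suc k)) (X j k) \<le> \<rho> j"
        using short[OF XR, of k j] that by (simp add: dist_norm norm_minus_commute)
      moreover have "(X j k - X j (Suc k)) /\<^sub>R h j = (\<Sum>i=1..N. d (X j k) i) + w j k"
        using h(1)[of j] unfolding inc by simp
      ultimately show ?thesis
        unfolding fuzzy_graph_def eq using d w[of j k] \<open>0 \<le> \<rho> j\<close>
        by (intro CollectI case_prodI exI[of _ "d (X j k)"] exI[of _ "\<lambda>_. X j k"] exI[of _ "X j (Suc k)"]
            exI[of _ "w j k"]) auto
    qed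
    show "(\<lambda>j. real (Suc j) * h j) \<longlonglongrightarrow> c" using h(2) by simp
  qed (use V convex_H closed_H rho that in \<open>auto simp: X_def\<close>)
  with c(1) that show thesis by blast
qed

lemma solution_extend:
  assumes x: "solution H {0..b} x" and "b > 0"
  obtains c z where "c > 0" "solution H {0..b + c} z" "\<And>t. t \<in> {0..b} \<Longrightarrow> z t = x t"
proof -
  have "x b \<in> C" using solution_in_dom[OF x, of b] \<open>b > 0\<close> by simp
  then obtain c y where c: "c > 0" and y: "solution H {0..c} y" "y 0 = x b"
    using local_existence by blast
  obtain L1 L2 where "L1-lipschitz_on {0..b} x" "L2-lipschitz_on {0..c} y"
    using solution_lipschitz_Icc[OF x] solution_lipschitz_Icc[OF y(1)] by metis
  then have "(max L1 L2)-lipschitz_on {0..b} x" "(max L1 L2)-lipschitz_on {0..c} y"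
    by (auto intro: lipschitz_on_mono)
  then have "solution H {0..b + c} (\<lambda>t. if t \<le> b then x t else y (t - b))"
    using x y \<open>b > 0\<close> c by (intro solution_concat[where L = "max L1 L2"]) auto
  then show thesis by (rule that[OF c]) simp
qed

text \<open>Zorn's lemma is applied to graphs because curves are total functions with arbitrary
  values after their lifetime; inclusion of graphs encodes longer lifetime and agreement at
  once.\<close>

lemma maximal_extension:
  assumes y: "solution H {0..\<tau>} y" and "\<tau> > 0"
  obtains T z where "ereal \<tau> < T" "trajectory H T z" "\<And>t. t \<in> {0..\<tau>} \<Longrightarrow> z t = y t"
proof -
  define graph where "graph T z = (\<lambda>t. (t, z t)) ` time_domain T" for T :: ereal and z :: "real \<Rightarrow> 'a"
  define A where "A = {graph T z |T z. ereal \<tau> < T \<and> solution H (time_domain T) z \<and> (\<forall>t\<in>{0..\<tau>}. z t = y t)}"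
  have graph_iff: "(t, v) \<in> graph T z \<longleftrightarrow> t \<in> time_domain T \<and> v = z t" for t v T z
    by (auto simp: graph_def)
  have extend: "\<exists>G\<in>A. (\<forall>t\<in>{0..b}. (t, z t) \<in> G)"
    if z: "solution H {0..b} z" "\<tau> \<le> b" "\<And>t. t \<in> {0..\<tau>} \<Longrightarrow> z t = y t" for b z
  proof -
    obtain c z' where c: "c > 0" and z': "solution H {0..b + c} z'" "\<And>t. t \<in> {0..b} \<Longrightarrow> z' t = z t"
      using solution_extend[OF z(1)] z(2) \<open>\<tau> > 0\<close> by auto
    have "time_domain (ereal (b + c)) \<subseteq> {0..b + c}" by (auto simp: time_domain_def)
    then have "solution H (time_domain (ereal (b + c))) z'"
      using z'(1) is_interval_time_domain by (blast intro: solution_subset)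
    moreover have "ereal \<tau> < ereal (b + c)" "\<forall>t\<in>{0..\<tau>}. z' t = y t" using c z z' by auto
    ultimately have "graph (b + c) z' \<in> A" unfolding A_def by blast
    moreover have "(t, z t) \<in> graph (b + c) z'" if "t \<in> {0..b}" for t
      using that c z'(2)[OF that] by (auto simp: graph_iff time_domain_def)
    ultimately show ?thesis by blast
  qed
  have "\<exists>M\<in>A. \<forall>G\<in>A. M \<subseteq> G \<longrightarrow> G = M"
  proof (rule subset_Zorn_nonempty)
    show "A \<noteq> {}" using extend[OF y] by auto
    fix \<C> assume ne: "\<C> \<noteq> {}" and chain: "subset.chain A \<C>"
    have "\<forall>G\<in>\<C>. \<exists>T z. G = graph T z \<and> ereal \<tau> < T \<and> solution H (time_domain T) z \<and> (\<forall>t\<in>{0..\<tau>}. z t = y t)"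
      using chain by (auto simp: subset.chain_def A_def)
    then obtain T z where Tz: "\<And>G. G \<in> \<C> \<Longrightarrow> G = graph (T G) (z G) \<and> ereal \<tau> < T G \<and>
        solution H (time_domain (T G)) (z G) \<and> (\<forall>t\<in>{0..\<tau>}. z G t = y t)"
      by metis
    have agree: "z G t = z G' t" if "G \<in> \<C>" "G' \<in> \<C>" "t \<in> time_domain (T G)" "t \<in> time_domain (T G')" for G G' t
    proof -
      have "G \<subseteq> G' \<or> G' \<subseteq> G" using chain that(1,2) unfolding subset.chain_def by blast
      moreover have "(t, z G t) \<in> G" "(t, z G' t) \<in> G'" using that Tz graph_iff by blast+
      ultimately have "(t, z G t) \<in> G' \<or> (t, z G' t) \<in> G" by blast
      then show ?thesis using that Tz graph_iff by metis
    qed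
    \<comment> \<open>Half-open domains make the union of the chain exactly a graph over
      \<open>[0, S)\<close>: a time lies below \<open>S\<close> iff it lies below some
      \<open>T G\<close>.\<close>
    define S where "S = (SUP G\<in>\<C>. T G)"
    define Z where "Z t = z (SOME G. G \<in> \<C> \<and> t \<in> time_domain (T G)) t" for t
    have Z: "Z t = z G t" if "G \<in> \<C>" "t \<in> time_domain (T G)" for G t
    proof -
      have "(SOME G. G \<in> \<C> \<and> t \<in> time_domain (T G)) \<in> \<C> \<and> t \<in> time_domain (T (SOME G. G \<in> \<C> \<and> t \<in> time_domain (T G)))"
        by (rule someI[of _ G]) (use that in blast)
      with agree that show ?thesis unfolding Z_def by blast
    qed
    have S: "t \<in> time_domain S \<longleftrightarrow> (\<exists>G\<in>\<C>. t \<in> time_domain (T G))" for t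
      by (auto simp: time_domain_def S_def less_SUP_iff)
    have "\<Union>\<C> = graph S Z"
    proof (intro set_eqI iffI; clarify)
      fix t v G assume "(t, v) \<in> G" "G \<in> \<C>"
      then show "(t, v) \<in> graph S Z" using Tz[of G] S Z unfolding graph_iff by (metis graph_iff)
    next
      fix t v assume "(t, v) \<in> graph S Z"
      then obtain G where "G \<in> \<C>" "t \<in> time_domain (T G)" "v = Z t" using S graph_iff by blast
      then have "(t, v) \<in> G" using Tz[of G] Z graph_iff by metis
      then show "(t, v) \<in> \<Union>\<C>" using \<open>G \<in> \<C>\<close> by blast
    qed
    moreover obtain G0 where G0: "G0 \<in> \<C>" using ne by blast
    have "ereal \<tau> < S" using Tz[OF G0] G0 unfolding S_def less_SUP_iff by blast
    moreover have "\<forall>t\<in>{0..\<tau>}. Z t = y t"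
    proof
      fix t assume "t \<in> {0..\<tau>}"
      then have "t \<in> time_domain (T G0)" using Tz[OF G0] Icc_subset_time_domain by blast
      then show "Z t = y t" using Z[OF G0] Tz[OF G0] \<open>t \<in> {0..\<tau>}\<close> by simp
    qed
    moreover have "solution H (time_domain S) Z"
    proof (rule solution_time_domainI)
      fix b assume "0 \<le> b" "ereal b < S"
      then obtain G where G: "G \<in> \<C>" "ereal b < T G" unfolding S_def less_SUP_iff by blast
      then have sub: "{0..b} \<subseteq> time_domain (T G)" by (intro Icc_subset_time_domain)
      have "solution H (time_domain (T G)) (z G)" using Tz[OF G(1)] by blast
      then have "solution H {0..b} (z G)" using sub is_interval_cc by (rule solution_subset)
      then show "solution H {0..b} Z" by (rule solution_cong) (use Z[OF G(1)] sub in blast)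
    qed
    ultimately show "\<Union>\<C> \<in> A" unfolding A_def by blast
  qed
  then obtain M where "M \<in> A" and max: "\<And>G. G \<in> A \<Longrightarrow> M \<subseteq> G \<Longrightarrow> G = M" by blast
  then obtain T z where Mz: "M = graph T z" "ereal \<tau> < T" "solution H (time_domain T) z"
    "\<And>t. t \<in> {0..\<tau>} \<Longrightarrow> z t = y t"
    unfolding A_def by blast
  have "trajectory H T z"
    unfolding trajectory_def
  proof (intro conjI notI)
    have "0 < ereal \<tau>" using \<open>\<tau> > 0\<close> by simp
    also note Mz(2)
    finally show "0 < T" .
    show "solution H (time_domain T) z" by fact
    \<comment> \<open>Maximality in \<open>A\<close> concerns half-open domains, whereas
      \<open>trajectory\<close> admits every larger interval, even one that only adds the end point
      \<open>b\<close>. Such a \<open>w\<close> is a solution on \<open>{0..b}\<close>, and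
      continuing it beyond \<open>b\<close> gives a strictly larger graph in
      \<open>A\<close>.\<close>
    assume "\<exists>J w. time_domain T \<subset> J \<and> solution H J w \<and> (\<forall>t\<in>time_domain T. w t = z t)"
    then obtain J w where J: "time_domain T \<subset> J" "solution H J w" "\<forall>t\<in>time_domain T. w t = z t" by blast
    then obtain t1 where t1: "t1 \<in> J" "t1 \<notin> time_domain T" by blast
    have J0: "J \<subseteq> {0..}" "is_interval J" using J(2) by (auto simp: solution_def)
    then have "T \<le> ereal t1" using t1 by (auto simp: time_domain_def not_less)
    then obtain b where b: "T = ereal b" using \<open>0 < T\<close> by (cases T) auto
    have "\<tau> < b" using Mz(2) b by simp
    have "0 \<in> J" using J(1) \<open>0 < T\<close> by (auto simp: time_domain_def zero_ereal_def[symmetric])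
    have "{0..b} \<subseteq> J"
      using mem_is_interval_1_I[OF J0(2) \<open>0 \<in> J\<close> t1(1)] \<open>T \<le> ereal t1\<close> b by auto
    with J(2) have "solution H {0..b} w" using is_interval_cc by (rule solution_subset)
    moreover have wy: "w t = y t" if "t \<in> {0..\<tau>}" for t
      using that Mz(4)[OF that] J(3) Icc_subset_time_domain[OF Mz(2)] by (metis subsetD)
    ultimately obtain G where G: "G \<in> A" "\<forall>t\<in>{0..b}. (t, w t) \<in> G"
      using extend[of b w] \<open>\<tau> < b\<close> by auto
    have "M \<subseteq> G"
    proof
      fix m assume "m \<in> M"
      then obtain t where t: "t \<in> time_domain T" "m = (t, z t)" by (auto simp: Mz(1) graph_def)
      then have "t \<in> {0..b}" "w t = z t" using J(3) b by (auto simp: time_domain_def)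
      then show "m \<in> G" using G(2) t(2) by metis
    qed
    then have "G = M" using max G(1) by blast
    moreover have "(b, w b) \<in> G" using G(2) \<open>\<tau> < b\<close> \<open>\<tau> > 0\<close> by simp
    ultimately show False by (simp add: Mz(1) graph_iff b time_domain_def)
  qed
  with Mz(2,4) that show thesis by blast
qed

end

section \<open>Convergence of proximal random reshuffling\<close>

lemma has_vector_derivative_norm_le:
  fixes x :: "real \<Rightarrow> 'a::real_normed_vector"
  assumes "V-lipschitz_on S x" "(x has_vector_derivative w) (at t within S)" "t \<in> S"
    and "at t within S \<noteq> bot"
  shows "norm w \<le> V"
proof (rule Lim_norm_ubound[OF assms(4) difference_quotient_tendsto[OF assms(2)]])
  show "\<forall>\<^sub>F s in at t within S. norm ((x s - x t) /\<^sub>R (s - t)) \<le> V"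
    unfolding eventually_at
  proof (intro exI[of _ 1] conjI ballI impI)
    fix s assume s: "s \<in> S" "s \<noteq> t \<and> dist s t < 1"
    have "norm (x s - x t) \<le> V * \<bar>s - t\<bar>"
      using lipschitz_onD[OF assms(1) s(1) assms(3)] by (simp add: dist_norm)
    then have "norm (x s - x t) / \<bar>s - t\<bar> \<le> V" using s by (simp add: pos_divide_le_eq)
    then show "norm ((x s - x t) /\<^sub>R (s - t)) \<le> V" by (simp add: divide_inverse mult.commute)
  qed simp
qed

text \<open>Replaces the filter on extended reals by a real threshold, in one form for finite and
  infinite \<open>T\<close>.\<close>

lemma at_left_ereal_limit:
  fixes x :: "real \<Rightarrow> 'a::metric_space"
  assumes "((\<lambda>t. x (real_of_ereal t)) \<longlongrightarrow> l) (at_left T)" "0 < T" "e > 0"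
  obtains b where "0 \<le> b" "ereal b < T" "\<And>t. b < t \<Longrightarrow> ereal t < T \<Longrightarrow> dist (x t) l < e"
proof -
  have "\<forall>\<^sub>F t in at_left T. dist (x (real_of_ereal t)) l < e"
    using tendstoD[OF assms(1,3)] .
  then obtain c where c: "c < T" "\<forall>t>c. t < T \<longrightarrow> dist (x (real_of_ereal t)) l < e"
    unfolding eventually_at_left[OF \<open>0 < T\<close>] by blast
  have "max 0 c < T" using c assms by simp
  then obtain b where b: "max 0 c < ereal b" "ereal b < T" using ereal_dense2 by blast
  show thesis
  proof (rule that[of b])
    show "0 \<le> b" using b(1) by simp
    show "ereal b < T" by fact
    fix t assume t: "b < t" "ereal t < T"
    have "c < ereal b" using b(1) by simp
    also have "ereal b < ereal t" using t by simp
    finally show "dist (x t) l < e" using c(2)[rule_format, of "ereal t"] t by simp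
  qed
qed

section \<open>One iteration of the algorithm\<close>

context composite_inclusion
begin

lemma fuzzy_graph_mono: "\<rho> \<le> \<rho>' \<Longrightarrow> fuzzy_graph \<rho> \<subseteq> fuzzy_graph \<rho>'"
  unfolding fuzzy_graph_def by (fastforce intro: order_trans)

text \<open>\<open>V\<close> depends on \<open>R\<close> but not on the sequence or on
  \<open>k\<close>, so one constant serves all sequences of the compactness argument. The condition
  \<open>\<alpha> k * V \<le> 1\<close> keeps the inner iterates within distance \<open>1\<close> of
  \<open>X k\<close>, which is why the constants are taken on the ball of radius
  \<open>R + 1\<close>.\<close>

lemma prr_step:
  "\<exists>V\<ge>0. \<forall>\<alpha> x0 X k. prr_sequence N D g \<alpha> x0 X \<longrightarrow> X k \<in> C \<longrightarrow> norm (X k) \<le> R \<longrightarrow>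
    0 < \<alpha> k \<longrightarrow> \<alpha> k * V \<le> 1 \<longrightarrow>
    X (Suc k) \<in> C \<and> norm (X k - X (Suc k)) \<le> V * \<alpha> k \<and>
    (X k, (X k - X (Suc k)) /\<^sub>R \<alpha> k) \<in> fuzzy_graph (V * \<alpha> k)"
proof -
  obtain V where V: "V \<ge> 0" and step: "\<forall>x x' d z w \<alpha>. x \<in> C \<longrightarrow> norm x \<le> R + 1 \<longrightarrow> \<alpha> > 0 \<longrightarrow>
      w \<in> subdifferential g x' \<longrightarrow> (\<forall>i\<in>{1..N}. norm (z i) \<le> R + 1 \<and> d i \<in> D i (z i)) \<longrightarrow>
      x - x' = \<alpha> *\<^sub>R ((\<Sum>i=1..N. d i) + w) \<longrightarrow> norm (x - x') \<le> V * \<alpha>"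
    and D: "\<forall>i\<in>{1..N}. \<forall>x d. norm x \<le> R + 1 \<longrightarrow> d \<in> D i x \<longrightarrow> N * norm d \<le> V"
    using step_bound[of "R + 1"] by blast
  have "X (Suc k) \<in> C \<and> norm (X k - X (Suc k)) \<le> V * \<alpha> k \<and>
      (X k, (X k - X (Suc k)) /\<^sub>R \<alpha> k) \<in> fuzzy_graph (V * \<alpha> k)"
    if prr: "prr_sequence N D g \<alpha> x0 X" and X: "X k \<in> C" "norm (X k) \<le> R"
      and \<alpha>: "0 < \<alpha> k" "\<alpha> k * V \<le> 1" for \<alpha> x0 X k
  proof -
    obtain \<sigma> z where \<sigma>: "\<sigma> permutes {1..N}" and z0: "z 0 = X k"
      and "\<forall>i\<in>{1..N}. \<exists>d\<in>D (\<sigma> i) (z (i - 1)). z i = z (i - 1) - \<alpha> k *\<^sub>R d"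
      and px: "X (Suc k) \<in> prox (\<lambda>y. ereal (\<alpha> k) * g y) (z N)"
      using prr unfolding prr_sequence_def by blast
    then obtain e where e: "\<And>i. i \<in> {1..N} \<Longrightarrow> e i \<in> D (\<sigma> i) (z (i - 1))"
      "\<And>i. i \<in> {1..N} \<Longrightarrow> z i = z (i - 1) - \<alpha> k *\<^sub>R e i"
      by metis
    have \<sigma>N: "\<sigma> i \<in> {1..N}" if "i \<in> {1..N}" for i using permutes_in_image[OF \<sigma>] that by blast
    have zsum: "z n = X k - \<alpha> k *\<^sub>R (\<Sum>i=1..n. e i)" if "n \<le> N" for n
      using that
    proof (induction n)
      case (Suc n)
      then have "z (Suc n) = z n - \<alpha> k *\<^sub>R e (Suc n)" using e(2)[of "Suc n"] by simp
      with Suc show ?case by (simp add: scaleR_add_right)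
    qed (simp add: z0)
    \<comment> \<open>Scaled by \<open>N\<close> to match the bound
      \<open>N * norm d \<le> V\<close>: after \<open>n\<close> inner steps at most \<open>n\<close>
      of \<open>N\<close> equal shares of \<open>V * \<alpha> k\<close> are used up.\<close>
    have znear: "N * norm (z n - X k) \<le> n * (V * \<alpha> k)" if "n \<le> N" for n
      using that
    proof (induction n)
      case (Suc n)
      have IH: "N * norm (z n - X k) \<le> n * (V * \<alpha> k)" using Suc by simp
      also have "\<dots> \<le> real N * 1" using Suc.prems \<alpha> V by (intro mult_mono) (auto simp: mult.commute)
      finally have "norm (z n - X k) \<le> 1" using N by simp
      then have "norm (z n) \<le> R + 1" using X(2) norm_triangle_sub[of "z n" "X k"] by simp
      then have "N * norm (e (Suc n)) \<le> V" using D e(1)[of "Suc n"] \<sigma>N[of "Suc n"] Suc.prems by auto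
      then have "\<alpha> k * (N * norm (e (Suc n))) \<le> \<alpha> k * V" using \<alpha> by simp
      moreover have "norm (z (Suc n) - X k) \<le> norm (z n - X k) + \<alpha> k * norm (e (Suc n))"
      proof -
        have eq: "z (Suc n) - X k = (z n - X k) - \<alpha> k *\<^sub>R e (Suc n)" using e(2)[of "Suc n"] Suc.prems by simp
        show ?thesis unfolding eq
          using norm_triangle_ineq4[of "z n - X k" "\<alpha> k *\<^sub>R e (Suc n)"] \<alpha>(1) by simp
      qed
      then have "N * norm (z (Suc n) - X k) \<le> N * norm (z n - X k) + \<alpha> k * (N * norm (e (Suc n)))"
        using mult_left_mono[of _ _ "real N"] by (fastforce simp: algebra_simps)
      ultimately show ?case using IH by (simp add: algebra_simps)
    qed (simp add: z0)
    have zdist: "dist (z n) (X k) \<le> V * \<alpha> k" if "n \<le> N" for n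
    proof -
      have "N * norm (z n - X k) \<le> n * (V * \<alpha> k)" using znear[OF that] .
      also have "\<dots> \<le> N * (V * \<alpha> k)" using that V \<alpha> by (intro mult_right_mono) auto
      finally show ?thesis using N by (simp add: dist_norm)
    qed
    \<comment> \<open>\<open>\<tau> j\<close> is the position at which the field \<open>D j\<close>
      is used; reindexing by it removes the permutation from the sum.\<close>
    define \<tau> where "\<tau> = inv \<sigma>"
    have \<tau>: "\<tau> j \<in> {1..N}" "\<sigma> (\<tau> j) = j" if "j \<in> {1..N}" for j
      using permutes_in_image[OF permutes_inv[OF \<sigma>]] permutes_inverses[OF \<sigma>] that by (auto simp: \<tau>_def)
    define d where "d j = e (\<tau> j)" for j
    define y where "y j = z (\<tau> j - 1)" for j
    define w where "w = (z N - X (Suc k)) /\<^sub>R \<alpha> k"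
    have w: "w \<in> subdifferential g (X (Suc k))"
      unfolding w_def using prox_imp_resolvent[OF \<alpha>(1) px] .
    have dy: "d j \<in> D j (y j)" if "j \<in> {1..N}" for j
      using e(1)[OF \<tau>(1)[OF that]] \<tau>(2)[OF that] by (simp add: d_def y_def)
    have ynear: "dist (y j) (X k) \<le> V * \<alpha> k" if "j \<in> {1..N}" for j
      using \<tau>(1)[OF that] unfolding y_def by (intro zdist) auto
    have "(\<Sum>j=1..N. d j) = (\<Sum>i=1..N. (d \<circ> \<sigma>) i)" using sum.permute[OF \<sigma>] by blast
    then have sum: "(\<Sum>j=1..N. d j) = (\<Sum>i=1..N. e i)"
      by (simp add: d_def \<tau>_def permutes_inverses[OF \<sigma>])
    have eq: "X k - X (Suc k) = \<alpha> k *\<^sub>R ((\<Sum>j=1..N. d j) + w)"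
      using \<alpha>(1) zsum[of N] unfolding sum w_def by (simp add: scaleR_add_right)
    have yR: "norm (y j) \<le> R + 1" if "j \<in> {1..N}" for j
    proof -
      have "norm (y j - X k) \<le> 1" using ynear[OF that] \<alpha>(2) by (simp add: dist_norm mult.commute)
      then show ?thesis using X(2) norm_triangle_sub[of "y j" "X k"] by simp
    qed
    have short: "norm (X k - X (Suc k)) \<le> V * \<alpha> k"
    proof (rule step[rule_format, OF X(1) _ \<alpha>(1) w _ eq])
      show "norm (X k) \<le> R + 1" using X(2) by simp
      show "norm (y j) \<le> R + 1 \<and> d j \<in> D j (y j)" if "j \<in> {1..N}" for j using yR dy that by blast
    qed
    have "(X k - X (Suc k)) /\<^sub>R \<alpha> k = (\<Sum>j=1..N. d j) + w" using \<alpha>(1) unfolding eq by simp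
    then have "(X k, (X k - X (Suc k)) /\<^sub>R \<alpha> k) \<in> fuzzy_graph (V * \<alpha> k)"
      unfolding fuzzy_graph_def using dy ynear w short
      by (intro CollectI case_prodI exI[of _ d] exI[of _ y] exI[of _ "X (Suc k)"] exI[of _ w])
        (auto simp: dist_norm norm_minus_commute)
    with short subdifferentialD(1)[OF w] show ?thesis by blast
  qed
  with V show ?thesis by blast
qed

section \<open>Lifetime and limit of a convergent trajectory\<close>

lemma trajectory_bounded:
  assumes "trajectory H T x" "((\<lambda>t. x (real_of_ereal t)) \<longlongrightarrow> l) (at_left T)"
  shows "\<exists>R. \<forall>t\<in>time_domain T. norm (x t) \<le> R"
proof -
  have T: "0 < T" and sol: "solution H (time_domain T) x" using assms(1) by (auto simp: trajectory_def)
  obtain b where b: "0 \<le> b" "ereal b < T" "\<And>t. b < t \<Longrightarrow> ereal t < T \<Longrightarrow> dist (x t) l < 1"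
    using at_left_ereal_limit[OF assms(2) T, of 1] by auto
  have "bounded (x ` {0..b})"
    using compact_continuous_image[OF solution_continuous[OF sol Icc_subset_time_domain[OF b(2)]]]
    by (simp add: compact_imp_bounded)
  then obtain B where B: "\<forall>t\<in>{0..b}. norm (x t) \<le> B" by (auto simp: bounded_iff)
  show ?thesis
  proof (intro exI[of _ "max B (norm l + 1)"] ballI)
    fix t assume t: "t \<in> time_domain T"
    show "norm (x t) \<le> max B (norm l + 1)"
    proof (cases "t \<le> b")
      case True
      then show ?thesis using B t by (auto simp: time_domain_def le_max_iff_disj)
    next
      case False
      then have "dist (x t) l < 1" using b(3) t by (auto simp: time_domain_def)
      then have "norm (x t) \<le> norm l + 1" using norm_triangle_sub[of "x t" l] by (simp add: dist_norm)
      then show ?thesis by simp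
    qed
  qed
qed

lemma trajectory_lipschitz:
  assumes "solution H (time_domain T) x" "\<forall>t\<in>time_domain T. norm (x t) \<le> R"
  obtains V where "V \<ge> 0" "V-lipschitz_on (time_domain T) x"
proof -
  obtain V where V: "V \<ge> 0"
    "\<forall>a b x. solution H {a..b} x \<longrightarrow> (\<forall>t\<in>{a..b}. norm (x t) \<le> R) \<longrightarrow> V-lipschitz_on {a..b} x"
    using solution_lipschitz by blast
  have "V-lipschitz_on (time_domain T) x"
  proof (rule lipschitz_on_leI[OF _ V(1)])
    fix s t assume st: "s \<in> time_domain T" "t \<in> time_domain T" "s \<le> t"
    have sub: "{s..t} \<subseteq> time_domain T"
      using mem_is_interval_1_I[OF is_interval_time_domain st(1,2)] by auto
    have "V-lipschitz_on {s..t} x"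
      using V(2) solution_subset[OF assms(1) sub is_interval_cc] assms(2) sub by blast
    then show "dist (x s) (x t) \<le> V * dist s t" using st(3) by (intro lipschitz_onD) auto
  qed
  with V(1) show thesis by (rule that)
qed

text \<open>On a bounded lifetime the limit can be attached at the final time: the curve stays
  Lipschitz, and the inclusion may fail at a single time. The result is a solution on a closed
  interval, which already contradicts maximality.\<close>

lemma convergent_trajectory_global:
  assumes traj: "trajectory H T x" and lim: "((\<lambda>t. x (real_of_ereal t)) \<longlongrightarrow> l) (at_left T)"
  shows "T = \<infinity>"
proof (rule ccontr)
  assume "T \<noteq> \<infinity>"
  have T: "0 < T" and sol: "solution H (time_domain T) x" using traj by (auto simp: trajectory_def)
  with \<open>T \<noteq> \<infinity>\<close> obtain \<tau> where \<tau>: "T = ereal \<tau>" "\<tau> > 0" by (cases T) auto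
  have dom: "time_domain T = {0..<\<tau>}" using \<tau> by (auto simp: time_domain_def)
  obtain R where "\<forall>t\<in>time_domain T. norm (x t) \<le> R" using trajectory_bounded[OF assms] by blast
  then obtain V where V: "V \<ge> 0" "V-lipschitz_on {0..<\<tau>} x" using trajectory_lipschitz[OF sol] dom by metis
  define y where "y t = (if t < \<tau> then x t else l)" for t
  have end_dist: "dist (x s) l \<le> V * (\<tau> - s)" if s: "s \<in> {0..<\<tau>}" for s
  proof (rule field_le_epsilon)
    fix e :: real assume "e > 0"
    obtain b where b: "0 \<le> b" "ereal b < T" "\<And>t. b < t \<Longrightarrow> ereal t < T \<Longrightarrow> dist (x t) l < e"
      using at_left_ereal_limit[OF lim T \<open>e > 0\<close>] by blast
    obtain t where t: "max b s < t" "t < \<tau>" using dense[of "max b s" \<tau>] b(2) s \<tau> by auto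
    have "dist (x s) l \<le> dist (x s) (x t) + dist (x t) l" by (rule dist_triangle)
    also have "dist (x s) (x t) \<le> V * dist s t" using s t by (intro lipschitz_onD[OF V(2)]) auto
    also have "\<dots> \<le> V * (\<tau> - s)" using t V(1) by (intro mult_left_mono) (auto simp: dist_real_def)
    also have "dist (x t) l \<le> e" using b(3)[of t] t \<tau> by simp
    finally show "dist (x s) l \<le> V * (\<tau> - s) + e" by simp
  qed
  have ylip: "V-lipschitz_on {0..\<tau>} y"
  proof (rule lipschitz_on_leI[OF _ V(1)])
    fix s t assume st: "s \<in> {0..\<tau>}" "t \<in> {0..\<tau>}" "s \<le> t"
    consider "t < \<tau>" | "s < \<tau>" "t = \<tau>" | "s = \<tau>" "t = \<tau>" using st by fastforce
    then show "dist (y s) (y t) \<le> V * dist s t"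
    proof cases
      case 1
      then show ?thesis using st lipschitz_onD[OF V(2), of s t] by (simp add: y_def)
    next
      case 2
      then show ?thesis using st end_dist[of s] by (simp add: y_def dist_real_def)
    qed simp
  qed
  have "solution H {0..\<tau>} y"
    unfolding solution_def
  proof (intro conjI allI impI)
    show "abs_continuous_on {a..b} y" if "{a..b} \<subseteq> {0..\<tau>}" for a b
      using lipschitz_on_subset[OF ylip that] by (rule lipschitz_imp_abs_continuous_on)
    have "AE t in lebesgue. t \<in> {0..<\<tau>} \<longrightarrow> (\<exists>w. (x has_vector_derivative w) (at t within {0..<\<tau>}) \<and> - w \<in> H (x t))"
      using sol unfolding dom by (simp add: solution_def)
    moreover have "AE t in lebesgue. t \<noteq> \<tau>" unfolding AE_iff_negligible by simp
    ultimately show "AE t in lebesgue. t \<in> {0..\<tau>} \<longrightarrow> (\<exists>w. (y has_vector_derivative w) (at t within {0..\<tau>}) \<and> - w \<in> H (y t))"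
    proof eventually_elim
      case (elim t)
      show ?case
      proof
        assume "t \<in> {0..\<tau>}"
        then have t: "t \<in> {0..<\<tau>}" using elim(2) by auto
        then obtain w where w: "(x has_vector_derivative w) (at t within {0..<\<tau>})" "- w \<in> H (x t)"
          using elim(1) by blast
        have "(y has_vector_derivative w) (at t within {0..<\<tau>})"
          using has_vector_derivative_transform[OF t _ w(1), of y] by (simp add: y_def)
        moreover have "at t within {0..<\<tau>} = at t within {0..\<tau>}"
          using t by (intro at_within_nhd[of t "{..<\<tau>}"]) auto
        ultimately show "\<exists>w. (y has_vector_derivative w) (at t within {0..\<tau>}) \<and> - w \<in> H (y t)"
          using w(2) t by (auto simp: y_def)
      qed
    qed
  qed (auto simp: is_interval_cc)
  moreover have "time_domain T \<subset> {0..\<tau>}" using dom \<open>\<tau> > 0\<close> by auto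
  moreover have "\<forall>t\<in>time_domain T. y t = x t" by (simp add: dom y_def)
  ultimately show False using traj unfolding trajectory_def by blast
qed

lemma trajectory_limit_stationary:
  assumes traj: "trajectory H \<infinity> x" and lim: "((\<lambda>t. x (real_of_ereal t)) \<longlongrightarrow> l) (at_left \<infinity>)"
  shows "0 \<in> H l"
proof (rule ccontr)
  assume "0 \<notin> H l"
  then obtain a b where ab: "a \<bullet> 0 < b" "\<And>v. v \<in> H l \<Longrightarrow> b < a \<bullet> v"
    using separating_hyperplane_closed_point[OF convex_H closed_H] by blast
  have b: "b > 0" using ab(1) by simp
  have sol: "solution H (time_domain \<infinity>) x" using traj by (simp add: trajectory_def)
  have dom: "time_domain \<infinity> = {0..}" by (auto simp: time_domain_def)
  obtain R where "\<forall>t\<in>time_domain \<infinity>. norm (x t) \<le> R" using trajectory_bounded[OF assms] by blast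
  then obtain V where V: "V \<ge> 0" "V-lipschitz_on {0..} x" using trajectory_lipschitz[OF sol] dom by metis
  obtain \<delta> and J :: nat where \<delta>: "\<delta> > 0"
    "\<forall>j y s. j \<ge> J \<longrightarrow> (y, s) \<in> {(x, v). v \<in> H x} \<longrightarrow> dist y l < \<delta> \<longrightarrow> norm s \<le> V \<longrightarrow> b \<le> a \<bullet> s"
    using graphs_converge_halfspace[OF graphs_converge_H ab(2), where V = V] by blast
  obtain t0 where t0: "0 \<le> t0" "\<And>t. t0 < t \<Longrightarrow> dist (x t) l < \<delta>"
    using at_left_ereal_limit[OF lim _ \<delta>(1)] by auto
  define u where "u = t0 + 1"
  \<comment> \<open>\<open>a \<bullet> x\<close> would decrease at least at rate \<open>b\<close>
    forever, while \<open>x\<close> stays in a ball around \<open>l\<close>. The speed bound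
    \<open>V\<close> is what makes the half-space estimate available for the velocities.\<close>
  have fall: "a \<bullet> (x (u + h) - x u) \<le> - b * h" if "h > 0" for h
  proof -
    have sol': "solution H {u..u + h} x"
      using sol by (rule solution_subset) (use t0 in \<open>auto simp: dom u_def is_interval_cc\<close>)
    have "a \<bullet> (x (u + h) - x u) \<le> (- b) * (u + h - u)"
    proof (rule inner_increment_le)
      show "abs_continuous_on {u..u + h} x" using sol' by (simp add: solution_def)
      have "AE t in lebesgue. t \<in> {u..u + h} \<longrightarrow> (\<exists>w. (x has_vector_derivative w) (at t within {u..u + h}) \<and> - w \<in> H (x t))"
        using sol' by (simp add: solution_def)
      then show "AE t in lebesgue. t \<in> {u<..<u + h} \<longrightarrow>
          (\<exists>w. (x has_vector_derivative w) (at t within {u..u + h}) \<and> a \<bullet> w \<le> - b)"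
      proof eventually_elim
        case (elim t)
        show ?case
        proof
          assume t: "t \<in> {u<..<u + h}"
          then obtain w where w: "(x has_vector_derivative w) (at t within {u..u + h})" "- w \<in> H (x t)"
            using elim by auto
          have "norm w \<le> V"
          proof (rule has_vector_derivative_norm_le[OF _ w(1)])
            show "V-lipschitz_on {u..u + h} x"
              using V(2) by (rule lipschitz_on_subset) (use t0 in \<open>auto simp: u_def\<close>)
            have "at t within {u..u + h} = at t" using t by (intro at_within_interior) auto
            then show "at t within {u..u + h} \<noteq> bot" by simp
          qed (use t in auto)
          then have "b \<le> a \<bullet> (- w)" using t w(2) t0(2)[of t] by (intro \<delta>(2)[rule_format, of J]) (auto simp: u_def)
          then show "\<exists>w. (x has_vector_derivative w) (at t within {u..u + h}) \<and> a \<bullet> w \<le> - b"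
            using w(1) by auto
        qed
      qed
    qed (use that in simp)
    then show ?thesis by simp
  qed
  have near: "norm (x (u + h) - x u) \<le> 2 * \<delta>" if "h > 0" for h
    using dist_triangle2[of "x (u + h)" "x u" l] t0(2)[of u] t0(2)[of "u + h"] that
    by (simp add: u_def dist_norm)
  \<comment> \<open>After this time the drop \<open>b * h\<close> exceeds by \<open>1\<close> the
    largest change possible within that ball.\<close>
  define h where "h = (norm a * (2 * \<delta>) + 1) / b"
  have h: "h > 0" using b \<delta> by (simp add: h_def add_nonneg_pos)
  have "b * h \<le> - (a \<bullet> (x (u + h) - x u))" using fall[OF h] by simp
  also have "\<dots> \<le> norm a * norm (x (u + h) - x u)" using Cauchy_Schwarz_ineq2[of a "x (u + h) - x u"] by simp
  also have "\<dots> \<le> norm a * (2 * \<delta>)" using near[OF h] by (intro mult_left_mono) auto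
  finally show False using b by (simp add: h_def)
qed

text \<open>If tracking failed for arbitrarily small steps, the iterates up to the first exit from the
  tube around \<open>x\<close> would subconverge to a solution leaving \<open>x\<close>.\<close>

lemma prr_tracks_unique_solution:
  assumes x0: "x0 \<in> C" "x 0 = x0" and R: "\<forall>t\<ge>0. norm (x t) \<le> R"
    and cont: "continuous_on {0..T} x" and "\<eta> > 0"
    and unique: "\<forall>\<tau> y. \<tau> > 0 \<longrightarrow> solution H {0..\<tau>} y \<longrightarrow> y 0 = x0 \<longrightarrow> y \<tau> = x \<tau>"
  shows "\<exists>amax>0. \<forall>\<alpha> X k. (\<forall>k. \<alpha> k \<in> {0<..amax}) \<longrightarrow> \<alpha> sums T \<longrightarrow> prr_sequence N D g \<alpha> x0 X \<longrightarrow>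
      dist (X k) (x (\<Sum>i<k. \<alpha> i)) \<le> \<eta>"
proof (rule ccontr)
  assume neg: "\<not> ?thesis"
  obtain V where V: "V \<ge> 0" and step: "\<forall>\<alpha> x0 X k. prr_sequence N D g \<alpha> x0 X \<longrightarrow> X k \<in> C \<longrightarrow> norm (X k) \<le> R + \<eta> \<longrightarrow>
      0 < \<alpha> k \<longrightarrow> \<alpha> k * V \<le> 1 \<longrightarrow>
      X (Suc k) \<in> C \<and> norm (X k - X (Suc k)) \<le> V * \<alpha> k \<and>
      (X k, (X k - X (Suc k)) /\<^sub>R \<alpha> k) \<in> fuzzy_graph (V * \<alpha> k)"
    using prr_step by blast
  \<comment> \<open>Small enough for the condition of \<open>prr_step\<close>, with
    \<open>(V + 1) * m n\<close> tending to \<open>0\<close>.\<close>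
  define m where "m n = 1 / ((V + 1) * real (Suc n))" for n
  have m: "m n > 0" "m n * V \<le> 1" "(V + 1) * m n = inverse (real (Suc n))" for n
  proof -
    show "m n > 0" using V by (simp add: m_def)
    show eq: "(V + 1) * m n = inverse (real (Suc n))" using V by (simp add: m_def divide_inverse)
    have "m n * V \<le> (V + 1) * m n" using \<open>m n > 0\<close> by (simp add: algebra_simps)
    also have "\<dots> \<le> 1" unfolding eq by (simp add: field_simps)
    finally show "m n * V \<le> 1" .
  qed
  have "\<forall>n. \<exists>\<alpha> X k. (\<forall>k. \<alpha> k \<in> {0<..m n}) \<and> \<alpha> sums T \<and> prr_sequence N D g \<alpha> x0 X \<and>
      \<eta> < dist (X k) (x (\<Sum>i<k. \<alpha> i))"
  proof (intro allI, rule ccontr)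
    fix n
    assume none: "\<not> (\<exists>\<alpha> X k. (\<forall>k. \<alpha> k \<in> {0<..m n}) \<and> \<alpha> sums T \<and> prr_sequence N D g \<alpha> x0 X \<and>
      \<eta> < dist (X k) (x (\<Sum>i<k. \<alpha> i)))"
    have "dist (X k) (x (\<Sum>i<k. \<alpha> i)) \<le> \<eta>"
      if "\<forall>k. \<alpha> k \<in> {0<..m n}" "\<alpha> sums T" "prr_sequence N D g \<alpha> x0 X" for \<alpha> X k
    proof (rule ccontr)
      assume "\<not> ?thesis"
      then have "\<eta> < dist (X k) (x (\<Sum>i<k. \<alpha> i))" by simp
      with none that show False by blast
    qed
    then have "\<exists>amax>0. \<forall>\<alpha> X k. (\<forall>k. \<alpha> k \<in> {0<..amax}) \<longrightarrow> \<alpha> sums T \<longrightarrow> prr_sequence N D g \<alpha> x0 X \<longrightarrow>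
        dist (X k) (x (\<Sum>i<k. \<alpha> i)) \<le> \<eta>"
      using m(1)[of n] by (intro exI[of _ "m n"] conjI allI impI)
    with neg show False by (rule notE)
  qed
  then obtain \<alpha> X k' where chosen: "\<forall>n. (\<forall>k. \<alpha> n k \<in> {0<..m n}) \<and> \<alpha> n sums T \<and>
      prr_sequence N D g (\<alpha> n) x0 (X n) \<and> \<eta> < dist (X n (k' n)) (x (\<Sum>i<k' n. \<alpha> n i))"
    unfolding choice_iff by (elim exE)
  have \<alpha>: "\<alpha> n k \<in> {0<..m n}" "\<alpha> n sums T" and prr: "prr_sequence N D g (\<alpha> n) x0 (X n)"
    and far: "\<eta> < dist (X n (k' n)) (x (\<Sum>i<k' n. \<alpha> n i))" for n k
    using spec[OF chosen, of n] by simp_all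
  define t where "t n k = (\<Sum>i<k. \<alpha> n i)" for n k
  \<comment> \<open>The first index outside the tube. All earlier iterates are bounded by
    \<open>R + \<eta>\<close>, so \<open>prr_step\<close> covers even the step that leaves the
    tube.\<close>
  define K where "K n = (LEAST k. \<eta> < dist (X n k) (x (t n k)))" for n
  have K_far: "\<eta> < dist (X n (K n)) (x (t n (K n)))" for n
    unfolding K_def by (rule LeastI[of _ "k' n"]) (use far[of n] in \<open>simp add: t_def\<close>)
  have K_near: "dist (X n k) (x (t n k)) \<le> \<eta>" if "k < K n" for n k
    using not_less_Least[OF that[unfolded K_def]] by simp
  have t_Suc: "t n (Suc k) - t n k = \<alpha> n k" for n k by (simp add: t_def)
  have t_range: "0 \<le> t n k" "t n k \<le> T" for n k
  proof -
    have pos: "0 \<le> \<alpha> n i" for i using \<alpha>(1)[of n i] by simp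
    then show "0 \<le> t n k" by (simp add: t_def sum_nonneg)
    show "t n k \<le> T"
      using sum_le_suminf[of "\<alpha> n" "{..<k}"] \<alpha>(2)[of n] pos by (simp add: t_def sums_iff)
  qed
  have inR: "norm (X n k) \<le> R + \<eta>" if "k < K n" for n k
    using K_near[OF that] R[rule_format, OF t_range(1), of n k] norm_triangle_sub[of "X n k" "x (t n k)"]
    by (simp add: dist_norm)
  have \<alpha>V: "\<alpha> n k * V \<le> 1" for n k
  proof -
    have "\<alpha> n k * V \<le> m n * V" using \<alpha>(1)[of n k] V by (intro mult_right_mono) auto
    with m(2)[of n] show ?thesis by simp
  qed
  have XC: "X n k \<in> C" if "k \<le> K n" for n k
    using that
  proof (induction k)
    case 0
    then show ?case using prr[of n] x0 by (simp add: prr_sequence_def)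
  next
    case (Suc k)
    then show ?case using step[rule_format, OF prr _ inR _ \<alpha>V, of n k] \<alpha>(1)[of n k] by simp
  qed
  have stepX: "norm (X n k - X n (Suc k)) \<le> V * \<alpha> n k"
    "(X n k, (X n k - X n (Suc k)) /\<^sub>R \<alpha> n k) \<in> fuzzy_graph (V * \<alpha> n k)" if "k < K n" for n k
    using step[rule_format, OF prr XC inR _ \<alpha>V, of k n] \<alpha>(1)[of n k] that by simp_all
  \<comment> \<open>Exit times lie in \<open>{0..T}\<close> because the positive step sizes sum to
    \<open>T\<close>; a subsequence of them converges.\<close>
  have "bounded (range (\<lambda>n. t n (K n)))"
    using t_range by (auto simp: bounded_iff intro!: exI[of _ T])
  then obtain \<tau> q where q: "strict_mono (q :: nat \<Rightarrow> nat)" "((\<lambda>n. t n (K n)) \<circ> q) \<longlonglongrightarrow> \<tau>"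
    using bounded_imp_convergent_subsequence by blast
  have lim_t: "(\<lambda>j. t (q j) (K (q j))) \<longlonglongrightarrow> \<tau>" using q(2) by (simp add: o_def)
  have \<tau>: "\<tau> \<in> {0..T}"
    using LIMSEQ_le_const[OF lim_t] LIMSEQ_le_const2[OF lim_t] t_range by auto
  define \<rho> where "\<rho> j = (V + 1) * m (q j)" for j
  have rho: "\<rho> \<longlonglongrightarrow> 0"
  proof -
    have "((\<lambda>n. inverse (real (Suc n))) \<circ> q) \<longlonglongrightarrow> 0"
      using LIMSEQ_inverse_real_of_nat q(1) by (rule LIMSEQ_subseq_LIMSEQ)
    then show ?thesis unfolding \<rho>_def m(3) by (simp add: o_def)
  qed
  have \<alpha>\<rho>: "\<alpha> (q j) k \<le> \<rho> j" "V * \<alpha> (q j) k \<le> \<rho> j" for j k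
  proof -
    have *: "\<alpha> (q j) k \<le> m (q j)" "0 < m (q j)" using \<alpha>(1)[of "q j" k] m(1) by auto
    then have "V * \<alpha> (q j) k \<le> V * m (q j)" using V by (intro mult_left_mono) auto
    moreover have "0 \<le> V * m (q j)" using V * by simp
    ultimately show "\<alpha> (q j) k \<le> \<rho> j" "V * \<alpha> (q j) k \<le> \<rho> j" using * by (auto simp: \<rho>_def algebra_simps)
  qed
  obtain r y where r: "strict_mono r" and y: "solution H {0..\<tau>} y" "y 0 = x0"
    and lim_X: "(\<lambda>j. X (q (r j)) (K (q (r j)))) \<longlonglongrightarrow> y \<tau>"
  proof (rule chain_limit[where x = "\<lambda>j. X (q j)" and t = "\<lambda>j. t (q j)" and n = "\<lambda>j. K (q j)" and V = V
        and \<rho> = \<rho> and A = "\<lambda>j. fuzzy_graph (\<rho> j)" and H = H and p = x0 and \<tau> = \<tau>])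
    show "conservative_field (D 1) (f 1)" using conservative_D N by simp
    show "graphs_converge (\<lambda>j. fuzzy_graph (\<rho> j)) H" using rho by (rule fuzzy_graph_converge)
    show "t (q j) k < t (q j) (Suc k)" for j k using t_Suc[of "q j" k] \<alpha>(1)[of "q j" k] by simp
    show "t (q j) (Suc k) - t (q j) k \<le> \<rho> j" for j k unfolding t_Suc by (rule \<alpha>\<rho>)
    show "norm (X (q j) k - X (q j) (Suc k)) \<le> V * (t (q j) (Suc k) - t (q j) k)" if "k < K (q j)" for j k
      unfolding t_Suc using stepX(1)[OF that] .
    show "(X (q j) k, (X (q j) k - X (q j) (Suc k)) /\<^sub>R (t (q j) (Suc k) - t (q j) k)) \<in> fuzzy_graph (\<rho> j)"
      if "k < K (q j)" for j k
      unfolding t_Suc using stepX(2)[OF that] fuzzy_graph_mono[OF \<alpha>\<rho>(2)] by blast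
    show "X (q j) 0 = x0" for j using prr[of "q j"] by (simp add: prr_sequence_def)
    show "t (q j) 0 = 0" for j by (simp add: t_def)
  qed (use V convex_H closed_H rho lim_t in auto)
  \<comment> \<open>If the exit times tend to \<open>0\<close>, \<open>unique\<close> says nothing,
    but both curves start at \<open>x0\<close>.\<close>
  have "y \<tau> = x \<tau>" using unique[rule_format, of \<tau> y] y \<tau> x0 by (cases "\<tau> = 0") auto
  moreover have "(\<lambda>j. x (t (q (r j)) (K (q (r j))))) \<longlonglongrightarrow> x \<tau>"
  proof (rule continuous_on_tendsto_compose[OF cont _ \<tau>])
    show "(\<lambda>j. t (q (r j)) (K (q (r j)))) \<longlonglongrightarrow> \<tau>"
      using LIMSEQ_subseq_LIMSEQ[OF lim_t r] by (simp add: o_def)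
  qed (use t_range in auto)
  ultimately have "(\<lambda>j. dist (X (q (r j)) (K (q (r j)))) (x (t (q (r j)) (K (q (r j)))))) \<longlonglongrightarrow> dist (x \<tau>) (x \<tau>)"
    using lim_X by (intro tendsto_dist) auto
  then have "\<eta> \<le> dist (x \<tau>) (x \<tau>)"
    by (rule LIMSEQ_le_const) (use K_far less_imp_le in blast)
  with \<open>\<eta> > 0\<close> show False by simp
qed

text \<open>Tracking puts the limit of the iterates near \<open>x T\<close>, and \<open>x T\<close>
  is near the stationary limit of the trajectory once \<open>T\<close> is large. As that stationary
  point itself lies in the ball around the limit of the iterates, the second tolerance is exactly
  \<open>0\<close>. The bound on the step sizes depends on \<open>T\<close>, because the tracking
  lemma is for a fixed time interval \<open>{0..T}\<close>.\<close>

lemma prr_converges_near_stationary: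
  assumes x0: "x0 \<in> C" and "\<epsilon> > 0" and uct: "unique_convergent_trajectory H x0"
  shows "\<exists>T\<^sub>0\<ge>0. \<forall>T\<ge>T\<^sub>0. \<exists>\<alpha>max>0. \<forall>\<alpha> X.
    (\<forall>k. \<alpha> k \<in> {0<..\<alpha>max}) \<and> \<alpha> sums T \<and> prr_sequence N D g \<alpha> x0 X \<longrightarrow>
    (\<exists>l. X \<longlonglongrightarrow> l \<and> near_approx_stationary \<epsilon> 0 H l)"
proof -
  obtain S x l where traj: "trajectory H S x" and "x 0 = x0"
    and uniq: "\<And>T' y. trajectory H T' y \<Longrightarrow> y 0 = x0 \<Longrightarrow> T' = S \<and> (\<forall>t\<in>time_domain S. y t = x t)"
    and lim: "((\<lambda>t. x (real_of_ereal t)) \<longlongrightarrow> l) (at_left S)"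
    using uct unfolding unique_convergent_trajectory_def by metis
  have S: "S = \<infinity>" using convergent_trajectory_global[OF traj lim] .
  have stat: "0 \<in> H l" using trajectory_limit_stationary traj lim unfolding S by blast
  have dom: "time_domain S = {0..}" by (auto simp: S time_domain_def)
  have sol: "solution H {0..} x" using traj dom by (simp add: trajectory_def)
  obtain R where R: "\<forall>t\<ge>0. norm (x t) \<le> R" using trajectory_bounded[OF traj lim] dom by auto
  \<comment> \<open>The uniqueness hypothesis speaks of trajectories, so a solution on
    \<open>{0..\<tau>}\<close> is first continued to a maximal one.\<close>
  have unique: "\<forall>\<tau> y. \<tau> > 0 \<longrightarrow> solution H {0..\<tau>} y \<longrightarrow> y 0 = x0 \<longrightarrow> y \<tau> = x \<tau>"
  proof (intro allI impI)
    fix \<tau> y assume y: "\<tau> > 0" "solution H {0..\<tau>} y" "y 0 = x0"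
    obtain T z where z: "ereal \<tau> < T" "trajectory H T z" "\<And>t. t \<in> {0..\<tau>} \<Longrightarrow> z t = y t"
      using maximal_extension[OF y(2,1)] by blast
    have "z 0 = x0" using z(3)[of 0] y by simp
    then have "z \<tau> = x \<tau>" using uniq[OF z(2)] dom y(1) by simp
    then show "y \<tau> = x \<tau>" using z(3)[of \<tau>] y(1) by simp
  qed
  \<comment> \<open>The limit of the iterates is then within
    \<open>\<eta> + \<epsilon> / 2 \<le> \<epsilon>\<close> of \<open>l\<close>.\<close>
  define \<eta> where "\<eta> = min 1 (\<epsilon> / 4)"
  have \<eta>: "0 < \<eta>" "\<eta> \<le> 1" "\<eta> \<le> \<epsilon> / 4" using \<open>\<epsilon> > 0\<close> by (auto simp: \<eta>_def)
  obtain V where V: "V \<ge> 0" and step: "\<forall>\<alpha> x0 X k. prr_sequence N D g \<alpha> x0 X \<longrightarrow> X k \<in> C \<longrightarrow> norm (X k) \<le> R + \<eta> \<longrightarrow>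
      0 < \<alpha> k \<longrightarrow> \<alpha> k * V \<le> 1 \<longrightarrow>
      X (Suc k) \<in> C \<and> norm (X k - X (Suc k)) \<le> V * \<alpha> k \<and>
      (X k, (X k - X (Suc k)) /\<^sub>R \<alpha> k) \<in> fuzzy_graph (V * \<alpha> k)"
    using prr_step by blast
  obtain b where b: "0 \<le> b" "\<And>t. b < t \<Longrightarrow> dist (x t) l < \<epsilon> / 2"
    using at_left_ereal_limit[OF lim, of "\<epsilon> / 2"] \<open>\<epsilon> > 0\<close> by (auto simp: S)
  show ?thesis
  proof (rule exI[of _ "b + 1"], intro conjI allI impI)
    show "0 \<le> b + 1" using b by simp
    fix T assume T: "b + 1 \<le> T"
    have cont: "continuous_on {0..T} x" using solution_continuous[OF sol, of 0 T] by auto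
    obtain a where a: "a > 0" "\<forall>\<alpha> X k. (\<forall>k. \<alpha> k \<in> {0<..a}) \<longrightarrow> \<alpha> sums T \<longrightarrow>
        prr_sequence N D g \<alpha> x0 X \<longrightarrow> dist (X k) (x (\<Sum>i<k. \<alpha> i)) \<le> \<eta>"
      using prr_tracks_unique_solution[where x = x, OF x0 \<open>x 0 = x0\<close> R cont \<eta>(1) unique] by blast
    define amax where "amax = min a (1 / (V + 1))"
    have amax: "0 < amax" "amax \<le> a" "amax * V \<le> 1"
    proof -
      show "0 < amax" "amax \<le> a" using a V by (auto simp: amax_def)
      have "amax * V \<le> (1 / (V + 1)) * V" using V by (intro mult_right_mono) (auto simp: amax_def)
      also have "\<dots> \<le> 1" using V by (simp add: field_simps)
      finally show "amax * V \<le> 1" .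
    qed
    show "\<exists>\<alpha>max>0. \<forall>\<alpha> X. (\<forall>k. \<alpha> k \<in> {0<..\<alpha>max}) \<and> \<alpha> sums T \<and> prr_sequence N D g \<alpha> x0 X \<longrightarrow>
      (\<exists>l. X \<longlonglongrightarrow> l \<and> near_approx_stationary \<epsilon> 0 H l)"
    proof (intro exI[of _ amax] conjI[OF amax(1)] allI impI)
      fix \<alpha> X
      assume "(\<forall>k. \<alpha> k \<in> {0<..amax}) \<and> \<alpha> sums T \<and> prr_sequence N D g \<alpha> x0 X"
      then have \<alpha>: "\<forall>k. \<alpha> k \<in> {0<..amax}" and sums: "\<alpha> sums T" and prr: "prr_sequence N D g \<alpha> x0 X"
        by blast+
      have near: "dist (X k) (x (\<Sum>i<k. \<alpha> i)) \<le> \<eta>" for k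
        using \<alpha> amax(2) by (intro a(2)[rule_format] sums prr) (auto intro: order_trans)
      have pos: "0 < \<alpha> k" for k using \<alpha> by simp
      have XR: "norm (X k) \<le> R + \<eta>" for k
      proof -
        have "norm (x (\<Sum>i<k. \<alpha> i)) \<le> R" using pos by (intro R[rule_format] sum_nonneg) (simp add: less_imp_le)
        then show ?thesis using near[of k] norm_triangle_sub[of "X k" "x (\<Sum>i<k. \<alpha> i)"] by (simp add: dist_norm)
      qed
      have \<alpha>V: "\<alpha> k * V \<le> 1" for k
      proof -
        have "\<alpha> k * V \<le> amax * V" using \<alpha> V by (intro mult_right_mono) auto
        with amax(3) show ?thesis by simp
      qed
      have XC: "X k \<in> C" for k
      proof (induction k)
        case 0
        then show ?case using prr x0 by (simp add: prr_sequence_def)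
      next
        case (Suc k)
        then show ?case using step[rule_format, OF prr Suc.IH XR pos \<alpha>V] by simp
      qed
      have short: "norm (X (Suc k) - X k) \<le> V * \<alpha> k" for k
        using step[rule_format, OF prr XC XR pos \<alpha>V] by (simp add: norm_minus_commute)
      \<comment> \<open>The path of the iterates has length at most \<open>V * T\<close>, so they
        converge; tracking then only has to locate the limit.\<close>
      have "summable (\<lambda>k. V * \<alpha> k)" using sums by (intro summable_mult) (rule sums_summable)
      then have "summable (\<lambda>k. X (Suc k) - X k)"
        by (rule summable_comparison_test'[where N = 0]) (use short in simp)
      then have "(\<lambda>n. \<Sum>k<n. X (Suc k) - X k) \<longlonglongrightarrow> (\<Sum>k. X (Suc k) - X k)" by (rule summable_LIMSEQ)
      then have "(\<lambda>n. X n - X 0 + X 0) \<longlonglongrightarrow> (\<Sum>k. X (Suc k) - X k) + X 0"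
        unfolding sum_lessThan_telescope by (intro tendsto_add tendsto_const)
      then obtain l' where l': "X \<longlonglongrightarrow> l'" by auto
      have t: "(\<lambda>k. \<Sum>i<k. \<alpha> i) \<longlonglongrightarrow> T" using sums by (simp add: sums_def)
      have "(\<lambda>k. x (\<Sum>i<k. \<alpha> i)) \<longlonglongrightarrow> x T"
      proof (rule continuous_on_tendsto_compose[OF cont t])
        show "T \<in> {0..T}" using T b by simp
        have "(\<Sum>i<k. \<alpha> i) \<in> {0..T}" for k
          using sum_le_suminf[of \<alpha> "{..<k}"] sums pos
          by (auto simp: sums_iff less_imp_le intro!: sum_nonneg)
        then show "\<forall>\<^sub>F k in sequentially. (\<Sum>i<k. \<alpha> i) \<in> {0..T}" by simp
      qed
      then have "(\<lambda>k. dist (X k) (x (\<Sum>i<k. \<alpha> i))) \<longlonglongrightarrow> dist l' (x T)"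
        using l' by (intro tendsto_dist)
      then have "dist l' (x T) \<le> \<eta>" by (rule LIMSEQ_le_const2) (use near in blast)
      moreover have "dist (x T) l < \<epsilon> / 2" using b(2)[of T] T by simp
      ultimately have "dist l' l \<le> \<epsilon>" using dist_triangle[of l' l "x T"] \<eta> \<open>\<epsilon> > 0\<close> by simp
      then have "0 \<in> (\<Union>y\<in>cball l' \<epsilon>. H y)" using stat by auto
      then have "edist_set 0 (\<Union>y\<in>cball l' \<epsilon>. H y) \<le> ereal (dist (0::'a) 0)"
        unfolding edist_set_def by (rule INF_lower)
      then have "near_approx_stationary \<epsilon> 0 H l'" by (simp add: near_approx_stationary_def)
      with l' show "\<exists>l. X \<longlonglongrightarrow> l \<and> near_approx_stationary \<epsilon> 0 H l" by blast
    qed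
  qed
qed

end

theorem theorem3p10:
  fixes N :: nat
    and f :: "nat \<Rightarrow> 'a::euclidean_space \<Rightarrow> real"
    and D :: "nat \<Rightarrow> 'a \<Rightarrow> 'a set"
    and g :: "'a \<Rightarrow> ereal"
    and \<Phi> :: "'a \<Rightarrow> ereal"
    and D\<^sub>\<Phi> :: "'a \<Rightarrow> 'a set"
    and \<epsilon> :: real
    and x0 :: 'a
  defines "\<Phi> \<equiv> \<lambda>x. ereal (\<Sum>i=1..N. f i x) + g x"
    and "D\<^sub>\<Phi> \<equiv> \<lambda>x. (\<Sum>i=1..N. D i x) + subdifferential g x"
  assumes "N \<ge> 1"
    and "\<And>i. i \<in> {1..N} \<Longrightarrow> locally_lipschitz_on UNIV (f i)"
    and "\<And>i. i \<in> {1..N} \<Longrightarrow> locally_bounded (D i)"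
    and "\<And>i. i \<in> {1..N} \<Longrightarrow> conservative_field (D i) (f i)"
    and "\<And>i x. i \<in> {1..N} \<Longrightarrow> D i x \<noteq> {} \<and> convex (D i x)"
    and "proper_fun g" and "econvex g" and "closed (edom g)"
    and "locally_lipschitz_on (edom g) (\<lambda>x. real_of_ereal (g x))"
    and "\<exists>m::real. \<forall>x. ereal m \<le> \<Phi> x"
    and "\<epsilon> > 0"
    and "x0 \<in> edom \<Phi>"
    and "unique_convergent_trajectory D\<^sub>\<Phi> x0"
  shows "\<exists>T\<^sub>0\<ge>0. \<forall>T\<ge>T\<^sub>0. \<exists>\<alpha>max>0. \<forall>(\<alpha> :: nat \<Rightarrow> real) (x :: nat \<Rightarrow> 'a).
           (\<forall>k. \<alpha> k \<in> {0<..\<alpha>max}) \<and> \<alpha> sums T \<and> prr_sequence N D g \<alpha> x0 x \<longrightarrow>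
           (\<exists>l. x \<longlonglongrightarrow> l \<and> near_approx_stationary \<epsilon> 0 D\<^sub>\<Phi> l)"
proof -
  interpret composite_inclusion g N f D
    by unfold_locales (use assms in blast)+
  have H: "H = D\<^sub>\<Phi>" by (rule ext) (simp add: H_def D\<^sub>\<Phi>_def)
  have "x0 \<in> edom g" using \<open>x0 \<in> edom \<Phi>\<close> by (auto simp: edom_def \<Phi>_def)
  with prr_converges_near_stationary[unfolded H] assms show ?thesis by blast
qed

end
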